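(* Let $M$ be a von Neumann algebra, let $A$ be a weak* closed subalgebra of $M$ (not assumed selfadjoint), and let $D$ be an atomic von Neumann subalgebra of $M$ containing the unit of $M$, with $D \subset A \subset M$. Suppose that $\Phi : A \to D$ is a unital weak* continuous homomorphism which is also a $D$-bimodule map, i.e. $\Phi(1)=1$ and $\Phi(d_1 a d_2) = d_1 \Phi(a) d_2$ for all $a \in A$ and $d_1,d_2 \in D$. Then $\Phi$ extends to a normal conditional expectation $\Psi : M \to D$; that is, there is a normal conditional expectation $\Psi$ of $M$ onto $D$ with $\Psi|_A = \Phi$.
   Context: Homomorphism means (complex) linear and multiplicative map. A von Neumann algebra $D$ is atomic (purely atomic) if it is isomorphic to an $\ell^\infty$-direct sum $\oplus_{i \in I} B(H_i)$ for Hilbert spaces $H_i$; equivalently every nonzero projection in $D$ dominates a minimal nonzero projection. Normal means weak* continuous. A conditional expectation $\Psi : M \to D$ onto a von Neumann subalgebra $D$ containing the unit of $M$ is a unital positive linear map that restricts to the identity on $D$ and is a $D$-bimodule map (equivalently, a norm one linear projection of $M$ onto $D$). *)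

theory Defs
  imports "HOL-Analysis.Analysis"
begin

section \<open>Complex Hilbert spaces\<close>

text \<open>A complex inner product space is presented on top of its underlying real inner product
  space, so that norm, topology and completeness are those of the library. The inner product is
  linear in its first argument.\<close>

class complex_inner = real_inner +
  fixes scaleC :: "complex \<Rightarrow> 'a \<Rightarrow> 'a"  (infixr "*\<^sub>C" 75)
    and cinner :: "'a \<Rightarrow> 'a \<Rightarrow> complex"
  assumes scaleC_add_right: "c *\<^sub>C (x + y) = c *\<^sub>C x + c *\<^sub>C y"
    and scaleC_add_left: "(b + c) *\<^sub>C x = b *\<^sub>C x + c *\<^sub>C x"
    and scaleC_scaleC: "b *\<^sub>C (c *\<^sub>C x) = (b * c) *\<^sub>C x"
    and scaleR_scaleC: "r *\<^sub>R x = complex_of_real r *\<^sub>C x"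
    and cinner_commute: "cinner x y = cnj (cinner y x)"
    and cinner_add_left: "cinner (x + y) z = cinner x z + cinner y z"
    and cinner_scaleC_left: "cinner (c *\<^sub>C x) y = c * cinner x y"
    and inner_eq_Re_cinner: "inner x y = Re (cinner x y)"

class complex_hilbert = complex_inner + complete_space

lemma norm_scaleC: "norm (c *\<^sub>C x) = cmod c * norm (x :: 'a :: complex_inner)"
proof -
  have real: "Im (cinner x x) = 0"
    using cinner_commute[of x x] by (simp add: complex_eq_iff)
  have "cinner (c *\<^sub>C x) (c *\<^sub>C x) = c * cnj (c * cinner x x)"
    by (metis cinner_scaleC_left cinner_commute)
  also have "\<dots> = (c * cnj c) * cinner x x"
    using cinner_commute[of x x] by simp
  also have "\<dots> = of_real ((cmod c)\<^sup>2) * cinner x x"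
    by (simp only: complex_norm_square)
  finally have "Re (cinner (c *\<^sub>C x) (c *\<^sub>C x)) = (cmod c)\<^sup>2 * Re (cinner x x)"
    by (simp only: Re_complex_of_real times_complex.sel Im_complex_of_real)
  then show ?thesis
    by (simp add: norm_eq_sqrt_inner inner_eq_Re_cinner real_sqrt_mult)
qed

section \<open>Bounded operators\<close>

text \<open>The library type of bounded operators consists of the real-linear ones; \<open>BH\<close> is the
  algebra of bounded complex-linear operators.\<close>

definition BH :: "('a :: complex_inner \<Rightarrow>\<^sub>L 'a) set" where
  "BH = {T. \<forall>c x. blinfun_apply T (c *\<^sub>C x) = c *\<^sub>C blinfun_apply T x}"

lift_definition scaleC_op :: "complex \<Rightarrow> ('a :: complex_inner \<Rightarrow>\<^sub>L 'a) \<Rightarrow> ('a \<Rightarrow>\<^sub>L 'a)"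
  is "\<lambda>c T x. c *\<^sub>C T x"
proof -
  fix c :: complex and T :: "'a \<Rightarrow> 'a"
  assume "bounded_linear T"
  moreover have "bounded_linear (\<lambda>x :: 'a. c *\<^sub>C x)"
  proof (rule bounded_linear_intro[where K = "cmod c"])
    fix r and x :: 'a
    show "c *\<^sub>C (r *\<^sub>R x) = r *\<^sub>R (c *\<^sub>C x)"
      by (simp add: scaleR_scaleC scaleC_scaleC mult.commute)
  qed (simp_all add: scaleC_add_right norm_scaleC mult.commute)
  ultimately show "bounded_linear (\<lambda>x. c *\<^sub>C T x)"
    by (rule bounded_linear_compose[rotated])
qed

definition is_adjoint :: "('a :: complex_inner \<Rightarrow>\<^sub>L 'a) \<Rightarrow> ('a \<Rightarrow>\<^sub>L 'a) \<Rightarrow> bool" where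
  "is_adjoint T S \<longleftrightarrow>
     (\<forall>x y. cinner (blinfun_apply T x) y = cinner x (blinfun_apply S y))"

definition positive_op :: "('a :: complex_inner \<Rightarrow>\<^sub>L 'a) \<Rightarrow> bool" where
  "positive_op T \<longleftrightarrow>
     (\<forall>x. Im (cinner (blinfun_apply T x) x) = 0 \<and> 0 \<le> Re (cinner (blinfun_apply T x) x))"

definition op_le :: "('a :: complex_inner \<Rightarrow>\<^sub>L 'a) \<Rightarrow> ('a \<Rightarrow>\<^sub>L 'a) \<Rightarrow> bool" where
  "op_le S T \<longleftrightarrow> positive_op (T - S)"

text \<open>The weak* topology of \<open>B(H)\<close> as the dual of the trace class operators: the coarsest topology
  making all functionals \<open>T \<mapsto> \<Sum>n. \<langle>T x\<^sub>n, y\<^sub>n\<rangle>\<close> with square-summable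
  \<open>(x\<^sub>n)\<close> and \<open>(y\<^sub>n)\<close> continuous. The weak* topology of a von Neumann
  algebra on \<open>H\<close>, and of its weak* closed subspaces, is the relative one.\<close>

definition ultraweak :: "('a :: complex_inner \<Rightarrow>\<^sub>L 'a) topology" where
  "ultraweak = topology_generated_by
     {{T. (\<Sum>n. cinner (blinfun_apply T (x n)) (y n)) \<in> U} | x y U.
        summable (\<lambda>n::nat. (norm (x n))\<^sup>2) \<and> summable (\<lambda>n. (norm (y n))\<^sup>2) \<and> open U}"

definition weak_star :: "('a :: complex_inner \<Rightarrow>\<^sub>L 'a) set \<Rightarrow> ('a \<Rightarrow>\<^sub>L 'a) topology" where
  "weak_star M = subtopology ultraweak M"

section \<open>Von Neumann algebras\<close>

definition subalgebra_BH :: "('a :: complex_inner \<Rightarrow>\<^sub>L 'a) set \<Rightarrow> bool" where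
  "subalgebra_BH A \<longleftrightarrow> A \<subseteq> BH \<and> 0 \<in> A \<and>
     (\<forall>S\<in>A. \<forall>T\<in>A. S + T \<in> A) \<and>
     (\<forall>c. \<forall>T\<in>A. scaleC_op c T \<in> A) \<and>
     (\<forall>S\<in>A. \<forall>T\<in>A. S o\<^sub>L T \<in> A)"

definition commutant :: "('a :: complex_inner \<Rightarrow>\<^sub>L 'a) set \<Rightarrow> ('a \<Rightarrow>\<^sub>L 'a) set" where
  "commutant S = {T \<in> BH. \<forall>R\<in>S. T o\<^sub>L R = R o\<^sub>L T}"

text \<open>A von Neumann algebra on \<open>H\<close> is a selfadjoint algebra of operators which equals its double
  commutant; its unit is then the identity operator.\<close>

definition von_neumann_algebra :: "('a :: complex_hilbert \<Rightarrow>\<^sub>L 'a) set \<Rightarrow> bool" where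
  "von_neumann_algebra M \<longleftrightarrow> subalgebra_BH M \<and>
     (\<forall>T\<in>M. \<exists>S\<in>M. is_adjoint T S) \<and>
     commutant (commutant M) = M"

definition projections :: "('a :: complex_inner \<Rightarrow>\<^sub>L 'a) set \<Rightarrow> ('a \<Rightarrow>\<^sub>L 'a) set" where
  "projections D = {p \<in> D. p o\<^sub>L p = p \<and> is_adjoint p p}"

definition minimal_projection :: "('a :: complex_inner \<Rightarrow>\<^sub>L 'a) set \<Rightarrow> ('a \<Rightarrow>\<^sub>L 'a) \<Rightarrow> bool" where
  "minimal_projection D e \<longleftrightarrow> e \<in> projections D \<and> e \<noteq> 0 \<and>
     (\<forall>q\<in>projections D. op_le q e \<longrightarrow> q = 0 \<or> q = e)"

definition atomic :: "('a :: complex_inner \<Rightarrow>\<^sub>L 'a) set \<Rightarrow> bool" where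
  "atomic D \<longleftrightarrow>
     (\<forall>p\<in>projections D. p \<noteq> 0 \<longrightarrow> (\<exists>e. minimal_projection D e \<and> op_le e p))"

section \<open>Maps between operator algebras\<close>

text \<open>Maps are total functions; only their values on the algebra \<open>A\<close> matter.\<close>

definition clinear_map_on ::
  "('a :: complex_inner \<Rightarrow>\<^sub>L 'a) set \<Rightarrow> (('a \<Rightarrow>\<^sub>L 'a) \<Rightarrow> ('a \<Rightarrow>\<^sub>L 'a)) \<Rightarrow> bool" where
  "clinear_map_on A f \<longleftrightarrow>
     (\<forall>a\<in>A. \<forall>b\<in>A. f (a + b) = f a + f b) \<and>
     (\<forall>c. \<forall>a\<in>A. f (scaleC_op c a) = scaleC_op c (f a))"

definition homomorphism_on ::
  "('a :: complex_inner \<Rightarrow>\<^sub>L 'a) set \<Rightarrow> (('a \<Rightarrow>\<^sub>L 'a) \<Rightarrow> ('a \<Rightarrow>\<^sub>L 'a)) \<Rightarrow> bool" where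
  "homomorphism_on A f \<longleftrightarrow> clinear_map_on A f \<and>
     (\<forall>a\<in>A. \<forall>b\<in>A. f (a o\<^sub>L b) = f a o\<^sub>L f b)"

definition bimodule_map_on ::
  "('a :: complex_inner \<Rightarrow>\<^sub>L 'a) set \<Rightarrow> ('a \<Rightarrow>\<^sub>L 'a) set \<Rightarrow> (('a \<Rightarrow>\<^sub>L 'a) \<Rightarrow> ('a \<Rightarrow>\<^sub>L 'a)) \<Rightarrow> bool" where
  "bimodule_map_on D A f \<longleftrightarrow>
     (\<forall>a\<in>A. \<forall>d1\<in>D. \<forall>d2\<in>D. f (d1 o\<^sub>L a o\<^sub>L d2) = d1 o\<^sub>L f a o\<^sub>L d2)"

definition conditional_expectation ::
  "('a :: complex_inner \<Rightarrow>\<^sub>L 'a) set \<Rightarrow> ('a \<Rightarrow>\<^sub>L 'a) set \<Rightarrow> (('a \<Rightarrow>\<^sub>L 'a) \<Rightarrow> ('a \<Rightarrow>\<^sub>L 'a)) \<Rightarrow> bool" where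
  "conditional_expectation M D \<Psi> \<longleftrightarrow>
     \<Psi> ` M \<subseteq> D \<and> clinear_map_on M \<Psi> \<and> \<Psi> id_blinfun = id_blinfun \<and>
     (\<forall>T\<in>M. positive_op T \<longrightarrow> positive_op (\<Psi> T)) \<and>
     (\<forall>d\<in>D. \<Psi> d = d) \<and> bimodule_map_on D M \<Psi>"

end

theory Submission
  imports Defs
begin

text \<open>A minimal projection \<open>e\<close> of \<open>D\<close> satisfies \<open>eDe = \<complex>e\<close>, so \<open>\<Phi>\<close> restricts to a weak* continuous
  character of \<open>eAe\<close>. By the argument of Hoffman and Rossi this character extends to a normal state
  \<open>T \<mapsto> \<Sum>n. \<langle>T \<zeta>\<^sub>n, \<zeta>\<^sub>n\<rangle>\<close> with all \<open>\<zeta>\<^sub>n\<close> in the range of \<open>e\<close>. Since \<open>D\<close> is atomic, the Hilbert space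
  is the orthogonal sum of cyclic subspaces \<open>Db\<close>, where \<open>b\<close> runs through orthonormal bases of
  the ranges of a maximal family of pairwise inequivalent minimal projections.
  The module maps \<open>G\<^bsub>b,n\<^esub>\<close> which send \<open>d b\<close> to \<open>d \<zeta>\<^sub>n\<close> and vanish on the complement of \<open>Db\<close>
  commute with \<open>D\<close> and satisfy \<open>\<Sum>b n. \<parallel>G\<^bsub>b,n\<^esub> x\<parallel>\<^sup>2 = \<parallel>x\<parallel>\<^sup>2\<close>, and the expectation is the normal map
  \<open>T \<mapsto> \<Sum>b n. G\<^bsub>b,n\<^esub>* T G\<^bsub>b,n\<^esub>\<close>, which is even defined on all of \<open>B(H)\<close>.\<close>

section \<open>Complex Hilbert spaces\<close>

text \<open>A functional \<open>T \<mapsto> \<Sum>n. \<langle>T x_n, y_n\<rangle>\<close> is a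
  single vector functional after amplification to countably many copies of the space, so the
  Hoffman-Rossi step comes down to one orthogonal projection in \<open>l2\<close>. Positivity of the
  extension is then automatic: a character of the form
  \<open>\<langle>a \<eta>, \<eta>\<rangle>\<close> makes sense, and is positive, for every
  operator. A state on one corner must still be spread over the whole space. Bimodularity prescribes
  the value at vectors \<open>c b\<close>, \<open>d b\<close> through the state at
  \<open>d* T c\<close>, and Parseval over the cyclic subspaces turns these prescriptions into one
  bounded operator. Two obstacles shape the rest. The frame may be uncountable while the ultraweak
  topology is given by sequences; hence sums over the frame are unordered, and normality passes
  through countable supports. Moreover the formula does not show that its values lie in
  \<open>D\<close>; this is tested against the commutant, and succeeds because the vectors \<zeta>
  depend on the minimal projection alone, not on the basis vector \<open>b\<close>.\<close>

instance complex_hilbert \<subseteq> banach ..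

lemma cinner_add_right: "cinner x (y + z) = cinner x y + cinner x z"
  by (metis cinner_add_left cinner_commute complex_cnj_add)

lemma cinner_scaleC_right: "cinner x (c *\<^sub>C y) = cnj c * cinner x y"
  by (metis cinner_scaleC_left cinner_commute complex_cnj_mult)

lemma scaleC_minus1: "(-1) *\<^sub>C x = - (x :: 'a :: complex_inner)"
  using scaleR_scaleC[of "-1" x] by simp

lemma scaleC_minus_left: "(- c) *\<^sub>C x = - (c *\<^sub>C (x :: 'a :: complex_inner))"
  by (metis scaleC_scaleC scaleC_minus1 mult_minus1)

lemma scaleC_one: "1 *\<^sub>C x = (x :: 'a :: complex_inner)"
  using scaleR_scaleC[of "1" x] by simp

lemma scaleC_zero_left: "0 *\<^sub>C x = (0 :: 'a :: complex_inner)"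
  using scaleR_scaleC[of "0" x] by simp

lemma scaleC_zero_right: "c *\<^sub>C 0 = (0 :: 'a :: complex_inner)"
  by (metis scaleC_scaleC scaleC_zero_left mult_zero_right)

lemma scaleC_minus_right: "c *\<^sub>C (- x) = - (c *\<^sub>C (x :: 'a :: complex_inner))"
  by (metis scaleC_scaleC scaleC_minus1 mult.commute)

lemma scaleC_diff_right: "c *\<^sub>C (x - y) = c *\<^sub>C x - c *\<^sub>C (y :: 'a :: complex_inner)"
  by (metis scaleC_add_right scaleC_minus_right diff_conv_add_uminus)

lemma scaleC_left_commute: "b *\<^sub>C (c *\<^sub>C x) = c *\<^sub>C (b *\<^sub>C (x :: 'a :: complex_inner))"
  by (simp add: scaleC_scaleC mult.commute)

lemma cinner_minus_left: "cinner (- x) y = - cinner x y"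
  by (metis cinner_scaleC_left scaleC_minus1 mult_minus1)

lemma cinner_minus_right: "cinner x (- y) = - cinner x y"
  by (metis cinner_minus_left cinner_commute complex_cnj_minus)

lemma cinner_diff_left: "cinner (x - y) z = cinner x z - cinner y z"
  by (metis cinner_add_left cinner_minus_left diff_conv_add_uminus)

lemma cinner_diff_right: "cinner x (y - z) = cinner x y - cinner x z"
  by (metis cinner_add_right cinner_minus_right diff_conv_add_uminus)

lemma cinner_zero_left [simp]: "cinner 0 y = 0"
  by (metis cinner_diff_left diff_self)

lemma cinner_zero_right [simp]: "cinner x 0 = 0"
  by (metis cinner_diff_right diff_self)

lemma cinner_scaleR_left: "cinner (r *\<^sub>R x) y = of_real r * cinner x y"
  by (simp add: scaleR_scaleC cinner_scaleC_left)

lemma cinner_scaleR_right: "cinner x (r *\<^sub>R y) = of_real r * cinner x y"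
  by (simp add: scaleR_scaleC cinner_scaleC_right)

lemma cinner_self: "cinner x x = of_real ((norm x)\<^sup>2)"
proof -
  have "Im (cinner x x) = 0"
    using cinner_commute[of x x] by (simp add: complex_eq_iff)
  then show ?thesis
    by (simp add: complex_eq_iff power2_norm_eq_inner inner_eq_Re_cinner)
qed

lemma cinner_eq_inner: "cinner x y = Complex (inner x y) (inner x (\<i> *\<^sub>C y))"
  by (simp add: complex_eq_iff inner_eq_Re_cinner cinner_scaleC_right)

lemma cinner_eqI:
  assumes "\<And>y. cinner x y = cinner x' y" shows "x = x'"
proof -
  have "cinner (x - x') (x - x') = 0"
    by (simp add: cinner_diff_left assms)
  then show ?thesis by (simp add: cinner_self)
qed

lemma norm_cinner_le: "cmod (cinner x y) \<le> norm x * norm y"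
proof (cases "cinner x y = 0")
  case False
  \<comment> \<open>Rotating \<open>x\<close> by the conjugate phase makes the product real and
    nonnegative, so that the real Cauchy-Schwarz inequality applies.\<close>
  define c where "c = cnj (sgn (cinner x y))"
  have "cinner (c *\<^sub>C x) y = of_real (cmod (cinner x y))"
    unfolding c_def cinner_scaleC_left using False
    by (simp add: sgn_div_norm divide_simps scaleR_conv_of_real power2_eq_square mult.commute
        flip: complex_norm_square)
  then have "cmod (cinner x y) = inner (c *\<^sub>C x) y"
    by (simp add: inner_eq_Re_cinner)
  also have "\<dots> \<le> norm (c *\<^sub>C x) * norm y" by (rule norm_cauchy_schwarz)
  also have "norm (c *\<^sub>C x) = norm x"
    using False by (simp add: norm_scaleC c_def norm_sgn)
  finally show ?thesis .
qed simp

section \<open>Orthogonal projection, Riesz representation and adjoints\<close>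

lemma closed_projection_exists:
  fixes S :: "'a :: {real_inner, complete_space} set"
  assumes S: "closed S" "subspace S"
  shows "\<exists>p\<in>S. \<forall>s\<in>S. inner (x - p) s = 0"
proof -
  have ne: "S \<noteq> {}" using S(2) subspace_0 by auto
  define \<delta> where "\<delta> = (INF s\<in>S. (norm (x - s))\<^sup>2)"
  have bdd: "bdd_below ((\<lambda>s. (norm (x - s))\<^sup>2) ` S)" by (rule bdd_belowI[of _ 0]) auto
  have lower: "\<delta> \<le> (norm (x - s))\<^sup>2" if "s \<in> S" for s
    unfolding \<delta>_def using bdd that by (rule cINF_lower)
  have "\<exists>s\<in>S. (norm (x - s))\<^sup>2 < \<delta> + inverse (Suc n)" for n
  proof -
    have "\<delta> < \<delta> + inverse (Suc n)" by simp
    then show ?thesis unfolding \<delta>_def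
      by (subst (asm) cINF_less_iff) (use ne bdd in auto)
  qed
  then obtain s where s: "\<And>n. s n \<in> S" "\<And>n. (norm (x - s n))\<^sup>2 < \<delta> + inverse (Suc n)"
    by metis
  \<comment> \<open>Parallelogram law: the midpoint is again in \<open>S\<close>, hence at squared
    distance at least \<delta>, which forces a minimising sequence to be Cauchy.\<close>
  have par: "(norm (s m - s n))\<^sup>2 \<le> 2 * inverse (Suc m) + 2 * inverse (Suc n)" for m n
  proof -
    have mid: "(1/2) *\<^sub>R (s m + s n) \<in> S" using S(2) s(1) by (simp add: subspace_add subspace_scale)
    have "(norm (s m - s n))\<^sup>2 + 4 * (norm (x - (1/2) *\<^sub>R (s m + s n)))\<^sup>2
        = 2 * (norm (x - s m))\<^sup>2 + 2 * (norm (x - s n))\<^sup>2"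
      by (simp add: power2_norm_eq_inner inner_diff_left inner_diff_right inner_add_left
          inner_add_right inner_commute algebra_simps)
    then show ?thesis using lower[OF mid] s(2)[of m] s(2)[of n] by linarith
  qed
  have "Cauchy s"
  proof (rule CauchyI)
    fix e :: real assume "0 < e"
    then obtain N where N: "inverse (Suc N) < e\<^sup>2 / 4"
      using reals_Archimedean[of "e\<^sup>2/4"] by auto
    have "norm (s m - s n) < e" if "m \<ge> N" "n \<ge> N" for m n
    proof -
      have "inverse (Suc m) \<le> inverse (real (Suc N))" "inverse (Suc n) \<le> inverse (real (Suc N))"
        using that by (auto intro!: le_imp_inverse_le)
      then have "(norm (s m - s n))\<^sup>2 < e\<^sup>2" using par[of m n] N by linarith
      then show ?thesis using \<open>0 < e\<close> power_less_imp_less_base[of _ 2 e] by auto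
    qed
    then show "\<exists>M. \<forall>m\<ge>M. \<forall>n\<ge>M. norm (s m - s n) < e" by blast
  qed
  then obtain p where p: "s \<longlonglongrightarrow> p" by (meson Cauchy_convergent_iff convergent_def)
  have "p \<in> S" using closed_sequentially[OF S(1) _ p] s(1) by blast
  have "(\<lambda>n. (norm (x - s n))\<^sup>2) \<longlonglongrightarrow> (norm (x - p))\<^sup>2"
    by (intro tendsto_intros p)
  moreover have "(\<lambda>n. \<delta> + inverse (Suc n)) \<longlonglongrightarrow> \<delta> + 0"
    by (intro tendsto_intros LIMSEQ_inverse_real_of_nat)
  ultimately have p_le: "(norm (x - p))\<^sup>2 \<le> \<delta>"
    using s(2) by (metis (no_types, lifting) LIMSEQ_le add_0_right less_imp_le)
  have "inner (x - p) t = 0" if t: "t \<in> S" for t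
  proof (cases "t = 0")
    case False
    \<comment> \<open>The minimiser of the quadratic \<open>r \<mapsto> norm (x - p - r t)\<close>
      squared; moving there would come closer than \<delta> unless the inner product
      vanishes.\<close>
    define r where "r = inner (x - p) t / inner t t"
    have "p + r *\<^sub>R t \<in> S" using \<open>p \<in> S\<close> t S(2) by (simp add: subspace_add subspace_scale)
    then have "(norm (x - p))\<^sup>2 \<le> (norm ((x - p) - r *\<^sub>R t))\<^sup>2"
      using order_trans[OF p_le lower[OF \<open>p + r *\<^sub>R t \<in> S\<close>]] by (simp only: diff_diff_eq)
    also have "\<dots> = (norm (x - p))\<^sup>2 - (inner (x - p) t)\<^sup>2 / inner t t"
    proof -
      have "(norm ((x - p) - r *\<^sub>R t))\<^sup>2
          = (norm (x - p))\<^sup>2 - 2 * r * inner (x - p) t + r\<^sup>2 * inner t t"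
        unfolding power2_norm_eq_inner
        by (simp add: inner_diff_left inner_diff_right inner_commute
            algebra_simps power2_eq_square)
      then show ?thesis using False by (simp add: r_def power2_eq_square)
    qed
    finally have "(inner (x - p) t)\<^sup>2 / inner t t \<le> 0" by simp
    moreover have "inner t t > 0" using False by simp
    ultimately show ?thesis by (simp add: divide_le_0_iff)
  qed simp
  then show ?thesis using \<open>p \<in> S\<close> by blast
qed

definition csubspace :: "'a :: complex_inner set \<Rightarrow> bool" where
  "csubspace S \<longleftrightarrow> 0 \<in> S \<and> (\<forall>x\<in>S. \<forall>y\<in>S. x + y \<in> S) \<and> (\<forall>c. \<forall>x\<in>S. c *\<^sub>C x \<in> S)"

lemma csubspace_subspace: "csubspace S \<Longrightarrow> subspace S"
  by (simp add: csubspace_def subspace_def scaleR_scaleC)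

text \<open>Real orthogonality to a subspace closed under multiplication by \<open>\<i>\<close> is
  already complex orthogonality, because the imaginary part of \<open>cinner\<close> is the real
  inner product with \<open>\<i> *\<^sub>C s\<close>.\<close>

lemma closed_csubspace_projection_exists:
  fixes S :: "'a :: complex_hilbert set"
  assumes S: "closed S" "csubspace S"
  shows "\<exists>p\<in>S. \<forall>s\<in>S. cinner (x - p) s = 0"
proof -
  obtain p where "p \<in> S" "\<forall>s\<in>S. inner (x - p) s = 0"
    using closed_projection_exists[OF S(1) csubspace_subspace[OF S(2)]] by blast
  then show ?thesis using S(2) unfolding csubspace_def
    by (auto simp: cinner_eq_inner complex_eq_iff)
qed

lemma riesz_representation:
  fixes f :: "'a :: {real_inner, complete_space} \<Rightarrow> real"
  assumes "bounded_linear f"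
  shows "\<exists>z. \<forall>y. f y = inner z y"
proof (cases "\<forall>y. f y = 0")
  case True
  then show ?thesis by (intro exI[of _ 0]) simp
next
  case False
  interpret bounded_linear f by fact
  obtain v where v: "f v \<noteq> 0" using False by blast
  let ?K = "{y. f y = 0}"
  have "closed ?K"
    by (intro closed_Collect_eq continuous_on linear_continuous_on assms) (auto intro: continuous_intros)
  moreover have "subspace ?K" by (auto simp: subspace_def add scale zero)
  ultimately obtain p where p: "f p = 0" "\<And>s. f s = 0 \<Longrightarrow> inner (v - p) s = 0"
    using closed_projection_exists[of ?K v] by blast
  \<comment> \<open>This vector spans the orthogonal complement of the kernel: every
    \<open>y\<close> differs from a multiple of it by an element of the kernel.\<close>
  define w where "w = v - p"
  have w: "f w \<noteq> 0" using v p(1) by (simp add: w_def diff)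
  then have "w \<noteq> 0" using zero by auto
  have "f y = inner ((f w / inner w w) *\<^sub>R w) y" for y
  proof -
    have "f (y - (f y / f w) *\<^sub>R w) = 0" using w by (simp add: diff scale)
    then have "inner w (y - (f y / f w) *\<^sub>R w) = 0" unfolding w_def by (rule p(2))
    then have "inner w y = f y / f w * inner w w" by (simp add: inner_diff_right)
    then show ?thesis using w \<open>w \<noteq> 0\<close> by (simp add: field_simps)
  qed
  then show ?thesis by blast
qed

text \<open>Riesz is applied to the real part of \<open>B x\<close>, and evaluating at
  \<open>\<i> *\<^sub>C y\<close> recovers the imaginary part. Both the adjoint and the Kraus sum
  are obtained in this way from their forms.\<close>

lemma sesquilinear_form_operator:
  fixes B :: "'a :: complex_hilbert \<Rightarrow> 'a \<Rightarrow> complex"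
  assumes add1: "\<And>x x' y. B (x + x') y = B x y + B x' y"
    and scale1: "\<And>c x y. B (c *\<^sub>C x) y = c * B x y"
    and add2: "\<And>x y y'. B x (y + y') = B x y + B x y'"
    and scale2: "\<And>c x y. B x (c *\<^sub>C y) = cnj c * B x y"
    and bound: "\<And>x y. cmod (B x y) \<le> K * norm x * norm y"
  shows "\<exists>S\<in>BH. \<forall>x y. cinner (blinfun_apply S x) y = B x y"
proof -
  have "\<exists>z. \<forall>y. cinner z y = B x y" for x
  proof -
    have "bounded_linear (\<lambda>y. Re (B x y))"
    proof (rule bounded_linear_intro[where K = "K * norm x"])
      show "norm (Re (B x y)) \<le> norm y * (K * norm x)" for y
        using bound[of x y] abs_Re_le_cmod[of "B x y"] by (simp add: mult_ac)
    qed (simp_all add: add2 scaleR_scaleC scale2)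
    then obtain z where z: "\<And>y. Re (B x y) = inner z y" using riesz_representation by blast
    have "cinner z y = B x y" for y
      using z[of y] z[of "\<i> *\<^sub>C y"] by (simp add: cinner_eq_inner complex_eq_iff scale2)
    then show ?thesis by blast
  qed
  then obtain S where S: "\<And>x y. cinner (S x) y = B x y" by metis
  have Sscale: "S (c *\<^sub>C x) = c *\<^sub>C S x" for c x
    by (rule cinner_eqI) (simp add: S scale1 cinner_scaleC_left)
  have bl: "bounded_linear S"
  proof (rule bounded_linear_intro[where K = K])
    show "S (x + x') = S x + S x'" for x x'
      by (rule cinner_eqI) (simp add: S add1 cinner_add_left)
    show "S (r *\<^sub>R x) = r *\<^sub>R S x" for r x by (simp add: scaleR_scaleC Sscale)
    show "norm (S x) \<le> norm x * K" for x
    proof (cases "S x = 0")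
      case True
      \<comment> \<open>The sign of \<open>K\<close> is not given; the bound at \<open>B x x\<close>
        forces it to be nonnegative as soon as \<open>x \<noteq> 0\<close>.\<close>
      have "0 \<le> K * (norm x * norm x)" using bound[of x x] by (metis mult.assoc norm_ge_zero order_trans)
      then have "0 \<le> norm x * K"
        by (cases "x = 0") (simp_all add: zero_le_mult_iff mult_le_0_iff)
      then show ?thesis using True by simp
    next
      case False
      have "norm (S x) * norm (S x) = cmod (B x (S x))"
        using S[of x "S x"] by (metis cinner_self norm_of_real abs_of_nonneg zero_le_power2 power2_eq_square)
      also have "\<dots> \<le> (K * norm x) * norm (S x)" by (rule bound)
      finally show ?thesis using False by (simp add: mult.commute)
    qed
  qed
  show ?thesis
    by (rule bexI[of _ "Blinfun S"]) (simp_all add: bounded_linear_Blinfun_apply[OF bl] S BH_def Sscale)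
qed

lemma BH_scaleC: "T \<in> BH \<Longrightarrow> blinfun_apply T (c *\<^sub>C x) = c *\<^sub>C blinfun_apply T x"
  by (simp add: BH_def)

lemma adjoint_exists:
  fixes T :: "'a :: complex_hilbert \<Rightarrow>\<^sub>L 'a"
  assumes "T \<in> BH"
  shows "\<exists>S\<in>BH. is_adjoint T S"
proof -
  have "\<exists>S\<in>BH. \<forall>x y. cinner (blinfun_apply S x) y = cinner x (blinfun_apply T y)"
  proof (rule sesquilinear_form_operator[where K = "norm T"])
    fix x y
    have "cmod (cinner x (blinfun_apply T y)) \<le> norm x * norm (blinfun_apply T y)"
      by (rule norm_cinner_le)
    also have "\<dots> \<le> norm x * (norm T * norm y)" by (intro mult_left_mono norm_blinfun) auto
    finally show "cmod (cinner x (blinfun_apply T y)) \<le> norm T * norm x * norm y"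
      by (simp add: mult_ac)
  qed (simp_all add: cinner_add_left cinner_add_right cinner_scaleC_left cinner_scaleC_right
      blinfun.add_right BH_scaleC[OF assms])
  then show ?thesis unfolding is_adjoint_def by (metis cinner_commute)
qed

section \<open>Parseval identity for orthogonal families of projections\<close>

text \<open>The hypothesis \<open>proj\<close> makes each \<open>P b\<close> a selfadjoint
  idempotent. Pythagoras measures the residual \<open>Q F x\<close> of a finite partial sum; vectors
  with arbitrarily small residual form a closed subspace that contains every range, so only vectors
  killed by all \<open>P b\<close> could be missed.\<close>

lemma parseval_real:
  fixes P :: "'b \<Rightarrow> 'a :: complex_hilbert \<Rightarrow> 'a"
  assumes add: "\<And>b x y. b \<in> B \<Longrightarrow> P b (x + y) = P b x + P b y"
    and scale: "\<And>b c x. b \<in> B \<Longrightarrow> P b (c *\<^sub>C x) = c *\<^sub>C P b x"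
    and proj: "\<And>b x y. b \<in> B \<Longrightarrow> cinner (P b x) (P b y) = cinner (P b x) y"
    and orth: "\<And>b b' x y. b \<in> B \<Longrightarrow> b' \<in> B \<Longrightarrow> b \<noteq> b' \<Longrightarrow> cinner (P b x) (P b' y) = 0"
    and total: "\<And>x. (\<And>b. b \<in> B \<Longrightarrow> P b x = 0) \<Longrightarrow> x = 0"
  shows "((\<lambda>b. (norm (P b x))\<^sup>2) has_sum (norm x)\<^sup>2) B"
proof -
  define Q where "Q F x = x - (\<Sum>b\<in>F. P b x)" for F x
  have Qadd: "Q F (x + y) = Q F x + Q F y" if "F \<subseteq> B" for F x y
  proof -
    have "(\<Sum>b\<in>F. P b (x + y)) = (\<Sum>b\<in>F. P b x + P b y)"
      using that by (intro sum.cong) (auto simp: add)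
    then show ?thesis by (simp add: Q_def sum.distrib algebra_simps)
  qed
  have sum_scaleC: "(\<Sum>b\<in>F. c *\<^sub>C f b) = c *\<^sub>C (\<Sum>b\<in>F. f b)" for F c and f :: "'b \<Rightarrow> 'a"
    by (induction F rule: infinite_finite_induct) (simp_all add: scaleC_zero_right scaleC_add_right)
  have Qscale: "Q F (c *\<^sub>C x) = c *\<^sub>C Q F x" if "F \<subseteq> B" for F c x
  proof -
    have "(\<Sum>b\<in>F. P b (c *\<^sub>C x)) = (\<Sum>b\<in>F. c *\<^sub>C P b x)"
      using that by (intro sum.cong) (auto simp: scale)
    then show ?thesis by (simp add: Q_def sum_scaleC scaleC_diff_right)
  qed
  have in_P: "inner (P b x) y = inner (P b x) (P b y)" if "b \<in> B" for b x y
    using proj[OF that] by (simp add: inner_eq_Re_cinner)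
  have in_orth: "inner (P b x) (P b' y) = 0" if "b \<in> B" "b' \<in> B" "b \<noteq> b'" for b b' x y
    using orth[OF that] by (simp add: inner_eq_Re_cinner)
  have Qnorm: "(norm (Q F x))\<^sup>2 = (norm x)\<^sup>2 - (\<Sum>b\<in>F. (norm (P b x))\<^sup>2)"
    if F: "finite F" "F \<subseteq> B" for F x
  proof -
    define s where "s = (\<Sum>b\<in>F. P b x)"
    have 1: "inner s x = (\<Sum>b\<in>F. (norm (P b x))\<^sup>2)"
      unfolding s_def inner_sum_left power2_norm_eq_inner
      using F by (intro sum.cong refl in_P) auto
    have "inner s s = (\<Sum>b\<in>F. \<Sum>b'\<in>F. inner (P b x) (P b' x))"
      by (simp only: s_def inner_sum_left) (simp only: inner_sum_right)
    also have "\<dots> = (\<Sum>b\<in>F. (norm (P b x))\<^sup>2)"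
    proof (rule sum.cong[OF refl])
      fix b assume b: "b \<in> F"
      have "(\<Sum>b'\<in>F. inner (P b x) (P b' x)) = (\<Sum>b'\<in>{b}. inner (P b x) (P b' x))"
        using F b by (intro sum.mono_neutral_right) (auto intro!: in_orth)
      then show "(\<Sum>b'\<in>F. inner (P b x) (P b' x)) = (norm (P b x))\<^sup>2"
        by (simp add: power2_norm_eq_inner)
    qed
    finally show ?thesis using 1
      by (simp add: Q_def flip: s_def)
        (simp add: power2_norm_eq_inner inner_diff_left inner_diff_right inner_commute)
  qed
  have Qle: "norm (Q F x) \<le> norm x" if F: "finite F" "F \<subseteq> B" for F x
  proof -
    have "(norm (Q F x))\<^sup>2 \<le> (norm x)\<^sup>2" using Qnorm[OF F, of x] by (simp add: sum_nonneg)
    then show ?thesis by simp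
  qed
  have Qmono: "norm (Q G x) \<le> norm (Q F x)" if "finite G" "G \<subseteq> B" "F \<subseteq> G" for F G x
  proof -
    have "finite F" "F \<subseteq> B" using that finite_subset by auto
    moreover have "(\<Sum>b\<in>F. (norm (P b x))\<^sup>2) \<le> (\<Sum>b\<in>G. (norm (P b x))\<^sup>2)"
      using that by (intro sum_mono2) auto
    ultimately have "(norm (Q G x))\<^sup>2 \<le> (norm (Q F x))\<^sup>2" using Qnorm that by simp
    then show ?thesis by simp
  qed
  \<comment> \<open>The vectors approximated by their own finite partial sums; since residuals
    decrease in \<open>F\<close>, this set is closed under sums.\<close>
  define W where "W = {x. \<forall>e>0. \<exists>F. finite F \<and> F \<subseteq> B \<and> norm (Q F x) < e}"
  have WD: "\<exists>F. finite F \<and> F \<subseteq> B \<and> norm (Q F x) < e" if "x \<in> W" "e > 0" for x e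
    using that unfolding W_def by auto
  have W0: "0 \<in> W"
    unfolding W_def by (auto intro!: exI[of _ "{}"] simp: Q_def)
  have Wadd: "x + y \<in> W" if "x \<in> W" "y \<in> W" for x y
    unfolding W_def
  proof safe
    fix e :: real assume "e > 0"
    obtain F where F: "finite F" "F \<subseteq> B" "norm (Q F x) < e/2"
      using WD[OF \<open>x \<in> W\<close> half_gt_zero[OF \<open>e > 0\<close>]] by auto
    obtain G where G: "finite G" "G \<subseteq> B" "norm (Q G y) < e/2"
      using WD[OF \<open>y \<in> W\<close> half_gt_zero[OF \<open>e > 0\<close>]] by auto
    have "norm (Q (F \<union> G) (x + y)) \<le> norm (Q (F \<union> G) x) + norm (Q (F \<union> G) y)"
      using F G by (simp add: Qadd norm_triangle_ineq)
    also have "\<dots> < e"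
      using Qmono[of "F \<union> G" F x] Qmono[of "F \<union> G" G y] F G by auto
    finally show "\<exists>F. finite F \<and> F \<subseteq> B \<and> norm (Q F (x + y)) < e"
      using F G by (intro exI[of _ "F \<union> G"]) auto
  qed
  have Wscale: "c *\<^sub>C x \<in> W" if "x \<in> W" for c x
    unfolding W_def
  proof safe
    fix e :: real assume "e > 0"
    have pos: "cmod c + 1 > 0" by (simp add: add_nonneg_pos)
    then have "e / (cmod c + 1) > 0" using \<open>e > 0\<close> by simp
    then obtain F where F: "finite F" "F \<subseteq> B" "norm (Q F x) < e / (cmod c + 1)"
      using WD[OF \<open>x \<in> W\<close>] by blast
    have "norm (Q F (c *\<^sub>C x)) \<le> (cmod c + 1) * norm (Q F x)"
      using F by (simp add: Qscale norm_scaleC distrib_right)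
    also have "\<dots> < e" using F(3) pos by (simp add: field_simps)
    finally show "\<exists>F. finite F \<and> F \<subseteq> B \<and> norm (Q F (c *\<^sub>C x)) < e" using F by blast
  qed
  have Wclosed: "closed W"
  proof (rule closed_sequential_limits[THEN iffD2], safe)
    fix s l assume s: "\<forall>n::nat. s n \<in> W" and l: "s \<longlonglongrightarrow> l"
    show "l \<in> W" unfolding W_def
    proof safe
      fix e :: real assume "e > 0"
      then obtain n where "norm (s n - l) < e/2"
        using LIMSEQ_D[OF l, of "e/2"] by auto
      then have n: "norm (l - s n) < e/2" by (simp add: norm_minus_commute)
      obtain F where F: "finite F" "F \<subseteq> B" "norm (Q F (s n)) < e/2"
        using WD[OF s[rule_format, of n] half_gt_zero[OF \<open>e > 0\<close>]] by auto
      have "norm (Q F l) = norm (Q F (l - s n) + Q F (s n))"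
        using F by (simp flip: Qadd)
      also have "\<dots> \<le> norm (l - s n) + norm (Q F (s n))"
        using Qle[OF F(1,2), of "l - s n"] norm_triangle_ineq[of "Q F (l - s n)" "Q F (s n)"] by linarith
      also have "\<dots> < e" using n F(3) by simp
      finally show "\<exists>F. finite F \<and> F \<subseteq> B \<and> norm (Q F l) < e" using F by blast
    qed
  qed
  have PW: "P b y \<in> W" if b: "b \<in> B" for b y
  proof -
    have "P b (P b y) = P b y"
    proof (rule cinner_eqI)
      fix z
      have "cinner (P b (P b y)) z = cnj (cinner (P b z) (P b (P b y)))"
        using proj[OF b, of "P b y" z] cinner_commute[of "P b (P b y)"] by metis
      also have "\<dots> = cinner (P b y) (P b z)"
        using proj[OF b, of z "P b y"] cinner_commute[of "P b y"] by metis
      finally show "cinner (P b (P b y)) z = cinner (P b y) z" using proj[OF b, of y z] by simp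
    qed
    then have "Q {b} (P b y) = 0" by (simp add: Q_def)
    then show ?thesis unfolding W_def using b by (auto intro!: exI[of _ "{b}"])
  qed
  have "csubspace W" using W0 Wadd Wscale by (simp add: csubspace_def)
  then obtain p where p: "p \<in> W" "\<And>s. s \<in> W \<Longrightarrow> cinner (x - p) s = 0"
    using closed_csubspace_projection_exists[OF Wclosed] by blast
  \<comment> \<open>The component orthogonal to \<open>W\<close> is orthogonal to the range of every
    \<open>P b\<close>, hence in the kernel of each by selfadjointness.\<close>
  have "x - p = 0"
  proof (rule total)
    fix b assume b: "b \<in> B"
    have "cinner (x - p) (P b (x - p)) = 0" by (intro p(2) PW b)
    then have "cinner (P b (x - p)) (P b (x - p)) = 0"
      using proj[OF b, of "x - p" "x - p"] cinner_commute[of "P b (x - p)" "x - p"] by simp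
    then show "P b (x - p) = 0" by (simp add: cinner_self)
  qed
  then have "x \<in> W" using p(1) by simp
  let ?S = "\<lambda>F. \<Sum>b\<in>F. (norm (P b x))\<^sup>2"
  have upper: "?S F \<le> (norm x)\<^sup>2" if "finite F" "F \<subseteq> B" for F
    using Qnorm[OF that, of x] by (metis diff_ge_0_iff_ge zero_le_power2)
  show ?thesis
    unfolding has_sum_def
  proof (rule order_tendstoI)
    fix a assume a: "a < (norm x)\<^sup>2"
    obtain F where F: "finite F" "F \<subseteq> B" "norm (Q F x) < sqrt ((norm x)\<^sup>2 - a)"
      using WD[OF \<open>x \<in> W\<close>, of "sqrt ((norm x)\<^sup>2 - a)"] a by auto
    have "(norm (Q F x))\<^sup>2 < (norm x)\<^sup>2 - a"
      using power_strict_mono[OF F(3) norm_ge_zero, of 2] a by simp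
    then have "a < ?S F" using Qnorm[OF F(1,2), of x] by simp
    then have "a < ?S G" if "finite G" "F \<subseteq> G" "G \<subseteq> B" for G
      using that sum_mono2[of G F "\<lambda>b. (norm (P b x))\<^sup>2"] by fastforce
    then show "\<forall>\<^sub>F G in finite_subsets_at_top B. a < ?S G"
      unfolding eventually_finite_subsets_at_top using F(1,2) by blast
  next
    fix a assume "(norm x)\<^sup>2 < a"
    then show "\<forall>\<^sub>F G in finite_subsets_at_top B. ?S G < a"
      by (intro eventually_finite_subsets_at_top_weakI le_less_trans[OF upper])
  qed
qed

lemma has_sum_inner_polarization:
  fixes P :: "'b \<Rightarrow> 'a :: real_inner \<Rightarrow> 'a"
  assumes sum: "\<And>x. ((\<lambda>b. (norm (P b x))\<^sup>2) has_sum (norm x)\<^sup>2) B"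
    and add: "\<And>b x y. b \<in> B \<Longrightarrow> P b (x + y) = P b x + P b y"
  shows "((\<lambda>b. inner (P b x) (P b y)) has_sum inner x y) B"
proof -
  have pol: "inner u v = ((norm (u + v))\<^sup>2 - (norm u)\<^sup>2 - (norm v)\<^sup>2) / 2" for u v :: 'a
    by (simp add: power2_norm_eq_inner inner_add_left inner_add_right inner_commute)
  have "((\<lambda>b. ((norm (P b (x + y)))\<^sup>2 + (- (norm (P b x))\<^sup>2) + (- (norm (P b y))\<^sup>2)) * (1/2)) has_sum
      ((norm (x + y))\<^sup>2 + (- (norm x)\<^sup>2) + (- (norm y)\<^sup>2)) * (1/2)) B"
    by (intro has_sum_cmult_left has_sum_add has_sum_uminusI sum)
  then have "((\<lambda>b. ((norm (P b (x + y)))\<^sup>2 - (norm (P b x))\<^sup>2 - (norm (P b y))\<^sup>2) / 2) has_sum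
      inner x y) B"
    by (simp add: pol[of x y])
  then show ?thesis
    by (rule has_sum_cong[THEN iffD1, rotated]) (simp add: add pol)
qed

lemma has_sum_Complex:
  assumes "(f has_sum a) A" "(g has_sum b) A"
  shows "((\<lambda>x. Complex (f x) (g x)) has_sum Complex a b) A"
proof -
  have "((\<lambda>x. of_real (f x) + \<i> * of_real (g x)) has_sum (of_real a + \<i> * of_real b)) A"
    by (intro has_sum_add has_sum_cmult_right has_sum_of_real assms)
  then show ?thesis by (simp add: Complex_eq)
qed

lemma parseval:
  fixes P :: "'b \<Rightarrow> 'a :: complex_hilbert \<Rightarrow> 'a"
  assumes add: "\<And>b x y. b \<in> B \<Longrightarrow> P b (x + y) = P b x + P b y"
    and scale: "\<And>b c x. b \<in> B \<Longrightarrow> P b (c *\<^sub>C x) = c *\<^sub>C P b x"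
    and proj: "\<And>b x y. b \<in> B \<Longrightarrow> cinner (P b x) (P b y) = cinner (P b x) y"
    and orth: "\<And>b b' x y. b \<in> B \<Longrightarrow> b' \<in> B \<Longrightarrow> b \<noteq> b' \<Longrightarrow> cinner (P b x) (P b' y) = 0"
    and total: "\<And>x. (\<And>b. b \<in> B \<Longrightarrow> P b x = 0) \<Longrightarrow> x = 0"
  shows "((\<lambda>b. cinner (P b x) (P b y)) has_sum cinner x y) B"
proof -
  have *: "((\<lambda>b. inner (P b x) (P b y)) has_sum inner x y) B" for x y
    using parseval_real[of B P, OF add scale proj orth total]
    by (rule has_sum_inner_polarization) (auto simp: add)
  have "((\<lambda>b. Complex (inner (P b x) (P b y)) (inner (P b x) (P b (\<i> *\<^sub>C y)))) has_sum cinner x y) B"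
    unfolding cinner_eq_inner[of x y] by (intro has_sum_Complex *)
  then show ?thesis
    by (rule has_sum_cong[THEN iffD1, rotated]) (simp add: scale cinner_eq_inner)
qed

section \<open>Square-summable sequences\<close>

text \<open>The amplification by countably many copies, on which ultraweakly continuous functionals
  become vector functionals. It carries a real structure because orthogonal projection is a real
  statement; complex values are recovered later by multiplying operators with scalars.\<close>

typedef (overloaded) 'a l2 = "{f :: nat \<Rightarrow> 'a :: real_inner. summable (\<lambda>n. (norm (f n))\<^sup>2)}"
  morphisms l2_nth Abs_l2
  by (rule exI[of _ "\<lambda>_. 0"]) simp

lemma l2_eqI: "(\<And>n. l2_nth x n = l2_nth y n) \<Longrightarrow> x = y"
  by (metis ext l2_nth_inject)

lemma l2_summable: "summable (\<lambda>n. (norm (l2_nth x n))\<^sup>2)"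
  using l2_nth[of x] by simp

lemma l2_nth_Abs:
  "summable (\<lambda>n. (norm (f n))\<^sup>2) \<Longrightarrow> l2_nth (Abs_l2 f) = f"
  by (simp add: Abs_l2_inverse)

lemma summable_norm_mult:
  fixes f :: "nat \<Rightarrow> 'a :: real_normed_vector" and g :: "nat \<Rightarrow> 'b :: real_normed_vector"
  assumes "summable (\<lambda>n. (norm (f n))\<^sup>2)" "summable (\<lambda>n. (norm (g n))\<^sup>2)"
  shows "summable (\<lambda>n. norm (f n) * norm (g n))"
proof (rule summable_comparison_test')
  show "summable (\<lambda>n. (norm (f n))\<^sup>2 + (norm (g n))\<^sup>2)" by (intro summable_add assms)
  fix n :: nat
  have "0 \<le> norm (f n) * norm (g n)" by simp
  then have "norm (f n) * norm (g n) \<le> (norm (f n))\<^sup>2 + (norm (g n))\<^sup>2"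
    using sum_squares_bound[of "norm (f n)" "norm (g n)"] by linarith
  then show "norm (norm (f n) * norm (g n)) \<le> (norm (f n))\<^sup>2 + (norm (g n))\<^sup>2" by simp
qed

lemma summable_inner:
  fixes f g :: "nat \<Rightarrow> 'a :: real_inner"
  assumes "summable (\<lambda>n. (norm (f n))\<^sup>2)" "summable (\<lambda>n. (norm (g n))\<^sup>2)"
  shows "summable (\<lambda>n. inner (f n) (g n))"
  by (rule summable_comparison_test'[OF summable_norm_mult[OF assms]])
    (simp add: Cauchy_Schwarz_ineq2)

lemma summable_norm_add_power2:
  fixes f g :: "nat \<Rightarrow> 'a :: real_inner"
  assumes "summable (\<lambda>n. (norm (f n))\<^sup>2)" "summable (\<lambda>n. (norm (g n))\<^sup>2)"
  shows "summable (\<lambda>n. (norm (f n + g n))\<^sup>2)"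
proof -
  have "(norm (f n + g n))\<^sup>2 = (norm (f n))\<^sup>2 + 2 * inner (f n) (g n) + (norm (g n))\<^sup>2" for n
    by (simp add: power2_norm_eq_inner inner_add_left inner_add_right inner_commute)
  then show ?thesis using assms by (simp add: summable_add summable_mult summable_inner)
qed

lemma summable_norm_blinfun_power2:
  assumes "summable (\<lambda>n. (norm (f n))\<^sup>2)"
  shows "summable (\<lambda>n. (norm (blinfun_apply T (f n)))\<^sup>2)"
proof (rule summable_comparison_test')
  show "summable (\<lambda>n. (norm T)\<^sup>2 * (norm (f n))\<^sup>2)" by (intro summable_mult assms)
  show "norm ((norm (blinfun_apply T (f n)))\<^sup>2) \<le> (norm T)\<^sup>2 * (norm (f n))\<^sup>2" for n
    by (simp add: power_mono norm_blinfun flip: power_mult_distrib)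
qed

instantiation l2 :: (real_inner) real_inner
begin

definition zero_l2 where "0 = Abs_l2 (\<lambda>_. 0)"
definition plus_l2 where "x + y = Abs_l2 (\<lambda>n. l2_nth x n + l2_nth y n)"
definition uminus_l2 where "- x = Abs_l2 (\<lambda>n. - l2_nth x n)"
definition minus_l2 where "x - (y :: 'a l2) = x + - y"
definition scaleR_l2 where "r *\<^sub>R x = Abs_l2 (\<lambda>n. r *\<^sub>R l2_nth x n)"
definition inner_l2 where "inner x y = (\<Sum>n. inner (l2_nth x n) (l2_nth y n))"
definition norm_l2 where "norm x = sqrt (inner x (x :: 'a l2))"
definition sgn_l2 where "sgn x = inverse (norm x) *\<^sub>R (x :: 'a l2)"
definition dist_l2 where "dist x y = norm (x - y :: 'a l2)"
definition uniformity_l2 where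
  "(uniformity :: ('a l2 \<times> 'a l2) filter) = (INF e\<in>{0 <..}. principal {(x, y). dist x y < e})"
definition open_l2 where
  "open (U :: 'a l2 set) \<longleftrightarrow> (\<forall>x\<in>U. eventually (\<lambda>(x', y). x' = x \<longrightarrow> y \<in> U) uniformity)"

lemma l2_nth_zero [simp]: "l2_nth 0 n = 0"
  by (simp add: zero_l2_def l2_nth_Abs)

lemma l2_nth_add [simp]: "l2_nth (x + y) n = l2_nth x n + l2_nth y n"
  by (simp add: plus_l2_def l2_nth_Abs summable_norm_add_power2 l2_summable)

lemma l2_nth_uminus [simp]: "l2_nth (- x) n = - l2_nth x n"
  by (simp add: uminus_l2_def l2_nth_Abs l2_summable)

lemma l2_nth_minus [simp]: "l2_nth (x - y) n = l2_nth x n - l2_nth y n"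
  by (simp add: minus_l2_def)

lemma l2_nth_scaleR [simp]: "l2_nth (r *\<^sub>R x) n = r *\<^sub>R l2_nth x n"
  by (simp add: scaleR_l2_def l2_nth_Abs power_mult_distrib summable_mult l2_summable)

lemma l2_inner_sums: "(\<lambda>n. inner (l2_nth x n) (l2_nth y n)) sums inner x y"
  unfolding inner_l2_def by (intro summable_sums summable_inner l2_summable)

instance
proof
  fix x y z :: "'a l2" and r s :: real
  show "x + y + z = x + (y + z)" "x + y = y + x" "0 + x = x" "- x + x = 0" "x - y = x + - y"
    "r *\<^sub>R (x + y) = r *\<^sub>R x + r *\<^sub>R y" "(r + s) *\<^sub>R x = r *\<^sub>R x + s *\<^sub>R x"
    "r *\<^sub>R s *\<^sub>R x = (r * s) *\<^sub>R x" "1 *\<^sub>R x = x"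
    by (auto intro!: l2_eqI simp: algebra_simps minus_l2_def)
  show "inner x y = inner y x" by (simp add: inner_l2_def inner_commute)
  show "inner (x + y) z = inner x z + inner y z"
    using sums_add[OF l2_inner_sums[of x z] l2_inner_sums[of y z]] l2_inner_sums[of "x + y" z]
    by (auto simp: inner_add_left intro: sums_unique2)
  show "inner (r *\<^sub>R x) y = r * inner x y"
    using sums_mult[OF l2_inner_sums[of x y], of r] l2_inner_sums[of "r *\<^sub>R x" y]
    by (auto intro: sums_unique2)
  show "0 \<le> inner x x"
    unfolding inner_l2_def by (intro suminf_nonneg summable_inner l2_summable) simp
  show "inner x x = 0 \<longleftrightarrow> x = 0"
  proof
    assume "inner x x = 0"
    then have "\<forall>n. inner (l2_nth x n) (l2_nth x n) = 0"
      using suminf_eq_zero_iff[OF summable_inner[OF l2_summable[of x] l2_summable[of x]]]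
      by (simp add: inner_l2_def)
    then show "x = 0" by (intro l2_eqI) simp
  qed (simp add: inner_l2_def)
qed (simp_all add: norm_l2_def sgn_l2_def dist_l2_def uniformity_l2_def open_l2_def)

end

lemma l2_norm_sums: "(\<lambda>n. (norm (l2_nth x n))\<^sup>2) sums (norm x)\<^sup>2"
  using l2_inner_sums[of x x] by (simp add: power2_norm_eq_inner)

lemma norm_l2_nth_le: "norm (l2_nth x n) \<le> norm x"
proof (rule power2_le_imp_le)
  show "(norm (l2_nth x n))\<^sup>2 \<le> (norm x)\<^sup>2"
    using sum_le_suminf[OF sums_summable[OF l2_norm_sums[of x]], of "{n}"] sums_unique[OF l2_norm_sums[of x]]
    by simp
qed simp

instance l2 :: ("{real_inner, complete_space}") complete_space
proof
  fix X :: "nat \<Rightarrow> 'a l2" assume X: "Cauchy X"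
  have "Cauchy (\<lambda>m. l2_nth (X m) n)" for n
  proof (rule CauchyI)
    fix e :: real assume "e > 0"
    then obtain M where "\<forall>m\<ge>M. \<forall>k\<ge>M. norm (X m - X k) < e" using CauchyD[OF X] by blast
    then show "\<exists>M. \<forall>m\<ge>M. \<forall>k\<ge>M. norm (l2_nth (X m) n - l2_nth (X k) n) < e"
      using norm_l2_nth_le[of "X _ - X _" n] by (metis l2_nth_minus le_less_trans)
  qed
  define l where "l n = lim (\<lambda>m. l2_nth (X m) n)" for n
  have l: "(\<lambda>m. l2_nth (X m) n) \<longlonglongrightarrow> l n" for n
    using \<open>Cauchy (\<lambda>m. l2_nth (X m) n)\<close> by (simp add: l_def Cauchy_convergent_iff convergent_LIMSEQ_iff)
  \<comment> \<open>For finitely many coordinates \<open>k\<close> may tend to infinity termwise;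
    the bound is uniform in \<open>N\<close>, so it survives for the full series.\<close>
  have bound: "(\<Sum>n<N. (norm (l2_nth (X m) n - l n))\<^sup>2) \<le> e\<^sup>2"
    if M: "\<forall>m\<ge>M. \<forall>k\<ge>M. norm (X m - X k) < e" "m \<ge> M" for M m e N
  proof (rule tendsto_upperbound)
    show "(\<lambda>k. \<Sum>n<N. (norm (l2_nth (X m) n - l2_nth (X k) n))\<^sup>2)
        \<longlonglongrightarrow> (\<Sum>n<N. (norm (l2_nth (X m) n - l n))\<^sup>2)"
      by (intro tendsto_intros l)
    show "\<forall>\<^sub>F k in sequentially. (\<Sum>n<N. (norm (l2_nth (X m) n - l2_nth (X k) n))\<^sup>2) \<le> e\<^sup>2"
      using eventually_ge_at_top[of M]
    proof eventually_elim
      case (elim k)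
      have "(\<Sum>n<N. (norm (l2_nth (X m - X k) n))\<^sup>2) \<le> (norm (X m - X k))\<^sup>2"
        using sum_le_suminf[OF sums_summable[OF l2_norm_sums], of "{..<N}" "X m - X k"]
          sums_unique[OF l2_norm_sums[of "X m - X k"]] by simp
      also have "\<dots> \<le> e\<^sup>2" using M elim by (intro power_mono) (auto simp: less_imp_le)
      finally show ?case by simp
    qed
  qed simp
  have summ: "summable (\<lambda>n. (norm (l2_nth (X m) n - l n))\<^sup>2)"
    and sum_le: "(\<Sum>n. (norm (l2_nth (X m) n - l n))\<^sup>2) \<le> e\<^sup>2"
    if M: "\<forall>m\<ge>M. \<forall>k\<ge>M. norm (X m - X k) < e" "m \<ge> M" for M m e
  proof -
    show s: "summable (\<lambda>n. (norm (l2_nth (X m) n - l n))\<^sup>2)"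
      by (rule bounded_imp_summable[where B = "e\<^sup>2"]) (use bound[OF M, of "Suc _"] in \<open>auto simp: lessThan_Suc_atMost\<close>)
    show "(\<Sum>n. (norm (l2_nth (X m) n - l n))\<^sup>2) \<le> e\<^sup>2"
      by (rule suminf_le_const[OF s bound[OF M]])
  qed
  obtain M0 where M0: "\<forall>m\<ge>M0. \<forall>k\<ge>M0. norm (X m - X k) < 1" using CauchyD[OF X, of 1] by auto
  \<comment> \<open>The limit is written as a member of the sequence minus a square-summable
    difference, so that it is itself square-summable.\<close>
  have "summable (\<lambda>n. (norm (l2_nth (X M0) n + - (l2_nth (X M0) n - l n)))\<^sup>2)"
    using summ[OF M0 order_refl]
    by (intro summable_norm_add_power2 l2_summable) (simp only: norm_minus_cancel)
  then have "summable (\<lambda>n. (norm (l n))\<^sup>2)" by simp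
  then have L: "l2_nth (Abs_l2 l) = l" by (rule l2_nth_Abs)
  have "X \<longlonglongrightarrow> Abs_l2 l"
  proof (rule LIMSEQ_I)
    fix e :: real assume "e > 0"
    then obtain M where M: "\<forall>m\<ge>M. \<forall>k\<ge>M. norm (X m - X k) < e/2"
      using CauchyD[OF X, of "e/2"] by auto
    have "norm (X m - Abs_l2 l) < e" if "m \<ge> M" for m
    proof -
      have "(norm (X m - Abs_l2 l))\<^sup>2 \<le> (e/2)\<^sup>2"
        using sum_le[OF M that] sums_unique[OF l2_norm_sums[of "X m - Abs_l2 l"]] by (simp add: L)
      then have "norm (X m - Abs_l2 l) \<le> e/2" using power2_le_imp_le[of "norm (X m - Abs_l2 l)" "e/2"] \<open>e > 0\<close> by argo
      then show ?thesis using \<open>e > 0\<close> by simp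
    qed
    then show "\<exists>M. \<forall>m\<ge>M. norm (X m - Abs_l2 l) < e" by blast
  qed
  then show "convergent X" by (auto simp: convergent_def)
qed

text \<open>The amplified operator \<open>T \<otimes> 1\<close>.\<close>

definition l2_map :: "('a \<Rightarrow>\<^sub>L 'b) \<Rightarrow> 'a :: real_inner l2 \<Rightarrow> 'b :: real_inner l2" where
  "l2_map T x = Abs_l2 (\<lambda>n. blinfun_apply T (l2_nth x n))"

lemma l2_nth_map [simp]: "l2_nth (l2_map T x) n = blinfun_apply T (l2_nth x n)"
  by (simp add: l2_map_def l2_nth_Abs summable_norm_blinfun_power2 l2_summable)

lemma norm_l2_map_le: "norm (l2_map T x) \<le> norm T * norm x"
proof (rule power2_le_imp_le)
  have "(norm (l2_map T x))\<^sup>2 \<le> (norm T)\<^sup>2 * (norm x)\<^sup>2"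
  proof (rule sums_le[OF _ l2_norm_sums sums_mult[OF l2_norm_sums]])
    show "(norm (l2_nth (l2_map T x) n))\<^sup>2 \<le> (norm T)\<^sup>2 * (norm (l2_nth x n))\<^sup>2" for n
      by (simp add: power_mono norm_blinfun flip: power_mult_distrib)
  qed
  then show "(norm (l2_map T x))\<^sup>2 \<le> (norm T * norm x)\<^sup>2" by (simp add: power_mult_distrib)
qed simp

lemma bounded_linear_l2_map: "bounded_linear (l2_map T)"
proof (rule bounded_linear_intro[where K = "norm T"])
  show "norm (l2_map T x) \<le> norm x * norm T" for x
    using norm_l2_map_le[of T x] by (simp add: mult.commute)
qed (auto intro!: l2_eqI simp: blinfun.add_right blinfun.scaleR_right)

section \<open>Square roots of squares of selfadjoint operators\<close>

lemma blinfun_tendsto_apply: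
  "X \<longlonglongrightarrow> T \<Longrightarrow> (\<lambda>n. blinfun_apply (X n) x) \<longlonglongrightarrow> blinfun_apply T x"
  by (intro tendsto_intros)

lemma adjoint_shift: "is_adjoint T S \<Longrightarrow> cinner (T x) y = cinner x (S y)"
  by (simp add: is_adjoint_def)

lemma is_adjoint_sym: "is_adjoint T S \<Longrightarrow> is_adjoint S T"
  unfolding is_adjoint_def by (metis cinner_commute)

lemma is_adjoint_add: "is_adjoint T S \<Longrightarrow> is_adjoint T' S' \<Longrightarrow> is_adjoint (T + T') (S + S')"
  by (simp add: is_adjoint_def blinfun.add_left cinner_add_left cinner_add_right)

lemma is_adjoint_diff: "is_adjoint T S \<Longrightarrow> is_adjoint T' S' \<Longrightarrow> is_adjoint (T - T') (S - S')"
  by (simp add: is_adjoint_def blinfun.diff_left cinner_diff_left cinner_diff_right)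

lemma is_adjoint_scaleR: "is_adjoint T S \<Longrightarrow> is_adjoint (r *\<^sub>R T) (r *\<^sub>R S)"
  by (simp add: is_adjoint_def blinfun.scaleR_left cinner_scaleR_left cinner_scaleR_right)

lemma is_adjoint_scaleC: "is_adjoint T S \<Longrightarrow> is_adjoint (scaleC_op c T) (scaleC_op (cnj c) S)"
  by (simp add: is_adjoint_def scaleC_op.rep_eq cinner_scaleC_left cinner_scaleC_right)

lemma is_adjoint_id: "is_adjoint id_blinfun id_blinfun"
  by (simp add: is_adjoint_def)

lemma BH_closed_ops:
  "0 \<in> BH" "id_blinfun \<in> BH"
  "S \<in> BH \<Longrightarrow> T \<in> BH \<Longrightarrow> S + T \<in> BH"
  "S \<in> BH \<Longrightarrow> T \<in> BH \<Longrightarrow> S - T \<in> BH"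
  "T \<in> BH \<Longrightarrow> r *\<^sub>R T \<in> BH"
  "T \<in> BH \<Longrightarrow> scaleC_op c T \<in> BH"
  "S \<in> BH \<Longrightarrow> T \<in> BH \<Longrightarrow> S o\<^sub>L T \<in> BH"
  by (auto simp: BH_def blinfun.add_left blinfun.diff_left blinfun.zero_left scaleC_zero_right
      scaleC_add_right scaleC_diff_right blinfun.scaleR_left scaleC_op.rep_eq scaleC_left_commute scaleR_scaleC)

lemma BH_limit:
  assumes "X \<longlonglongrightarrow> T" "\<And>n. X n \<in> BH"
  shows "T \<in> (BH :: ('a :: complex_inner \<Rightarrow>\<^sub>L 'a) set)"
proof -
  have "T (c *\<^sub>C x) = c *\<^sub>C T x" for c x
  proof (rule LIMSEQ_unique)
    show "(\<lambda>n. X n (c *\<^sub>C x)) \<longlonglongrightarrow> T (c *\<^sub>C x)" by (rule blinfun_tendsto_apply[OF assms(1)])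
    have "(\<lambda>n. scaleC_op c id_blinfun (X n x)) \<longlonglongrightarrow> scaleC_op c id_blinfun (T x)"
      by (intro blinfun.tendsto tendsto_const blinfun_tendsto_apply assms(1))
    then show "(\<lambda>n. X n (c *\<^sub>C x)) \<longlonglongrightarrow> c *\<^sub>C T x"
      by (simp add: scaleC_op.rep_eq BH_scaleC[OF assms(2)])
  qed
  then show ?thesis by (simp add: BH_def)
qed

lemma commute_limit:
  fixes R :: "'a :: real_normed_vector \<Rightarrow>\<^sub>L 'a"
  assumes "X \<longlonglongrightarrow> T" "\<And>n. R o\<^sub>L X n = X n o\<^sub>L R"
  shows "R o\<^sub>L T = T o\<^sub>L R"
proof (rule LIMSEQ_unique)
  show "(\<lambda>n. R o\<^sub>L X n) \<longlonglongrightarrow> (R o\<^sub>L T)"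
    by (intro bounded_bilinear.tendsto[OF bounded_bilinear_blinfun_compose] tendsto_const assms)
  show "(\<lambda>n. R o\<^sub>L X n) \<longlonglongrightarrow> (T o\<^sub>L R)"
    unfolding assms(2)
    by (intro bounded_bilinear.tendsto[OF bounded_bilinear_blinfun_compose] tendsto_const assms)
qed

text \<open>The fixed point equation says that \<open>1 - Z\<close> is a square root of \<open>1 - T\<close>; the iteration is
  majorised in norm by its scalar counterpart for \<open>T = 1\<close>, which converges.\<close>

primrec sqrt_iter :: "('a :: real_normed_vector \<Rightarrow>\<^sub>L 'a) \<Rightarrow> nat \<Rightarrow> ('a \<Rightarrow>\<^sub>L 'a)" where
  "sqrt_iter T 0 = 0"
| "sqrt_iter T (Suc n) = (1/2) *\<^sub>R (T + (sqrt_iter T n o\<^sub>L sqrt_iter T n))"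

primrec sqrt_iter_real :: "nat \<Rightarrow> real" where
  "sqrt_iter_real 0 = 0"
| "sqrt_iter_real (Suc n) = (1/2) * (1 + sqrt_iter_real n * sqrt_iter_real n)"

lemmas compose_bilinear =
  bounded_bilinear.add_left[OF bounded_bilinear_blinfun_compose]
  bounded_bilinear.add_right[OF bounded_bilinear_blinfun_compose]
  bounded_bilinear.diff_left[OF bounded_bilinear_blinfun_compose]
  bounded_bilinear.diff_right[OF bounded_bilinear_blinfun_compose]
  bounded_bilinear.scaleR_left[OF bounded_bilinear_blinfun_compose]
  bounded_bilinear.scaleR_right[OF bounded_bilinear_blinfun_compose]

lemma compose_assoc: "(A o\<^sub>L B) o\<^sub>L C = A o\<^sub>L (B o\<^sub>L C)"
  by (rule blinfun_eqI) simp

lemma sqrt_iter_real_bounds: "0 \<le> sqrt_iter_real n \<and> sqrt_iter_real n \<le> 1"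
proof (induction n)
  case (Suc n)
  then have "sqrt_iter_real n * sqrt_iter_real n \<le> 1" by (simp add: mult_le_one)
  then show ?case using Suc by simp
qed simp

lemma sqrt_iter_real_mono: "mono sqrt_iter_real"
proof (rule incseq_SucI)
  fix n
  show "sqrt_iter_real n \<le> sqrt_iter_real (Suc n)"
    using zero_le_power2[of "1 - sqrt_iter_real n"] by (simp add: power2_eq_square algebra_simps)
qed

lemma sqrt_iter_commute:
  assumes "R o\<^sub>L T = T o\<^sub>L R"
  shows "R o\<^sub>L sqrt_iter T n = sqrt_iter T n o\<^sub>L R"
proof (induction n)
  case (Suc n)
  have "R o\<^sub>L (sqrt_iter T n o\<^sub>L sqrt_iter T n) = (sqrt_iter T n o\<^sub>L sqrt_iter T n) o\<^sub>L R"
    by (metis Suc compose_assoc)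
  then show ?case by (simp add: compose_bilinear assms)
qed simp

lemma norm_sqrt_iter_le:
  assumes "norm T \<le> 1" shows "norm (sqrt_iter T n) \<le> sqrt_iter_real n"
proof (induction n)
  case (Suc n)
  have "norm (sqrt_iter T n o\<^sub>L sqrt_iter T n) \<le> sqrt_iter_real n * sqrt_iter_real n"
    using norm_blinfun_compose[of "sqrt_iter T n" "sqrt_iter T n"]
      mult_mono[OF Suc Suc] sqrt_iter_real_bounds[of n] by simp
  then show ?case
    using norm_triangle_ineq[of T "sqrt_iter T n o\<^sub>L sqrt_iter T n"] assms by simp
qed simp

text \<open>A difference of squares factors, so each increment is dominated by the scalar increment.
  Telescoping then transfers the Cauchy property of the bounded monotone scalar sequence to the
  operators.\<close>

lemma norm_sqrt_iter_diff_le: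
  assumes "norm T \<le> 1"
  shows "norm (sqrt_iter T (Suc n) - sqrt_iter T n) \<le> sqrt_iter_real (Suc n) - sqrt_iter_real n"
proof (induction n)
  case 0
  then show ?case using assms by simp
next
  case (Suc n)
  let ?Z = "sqrt_iter T" and ?s = sqrt_iter_real
  \<comment> \<open>Every iterate commutes with \<open>T\<close>, hence with every other iterate;
    the factorisation below needs this.\<close>
  have comm: "?Z (Suc n) o\<^sub>L ?Z n = ?Z n o\<^sub>L ?Z (Suc n)"
    by (rule sqrt_iter_commute) (rule sqrt_iter_commute[symmetric, OF refl])
  have "?Z (Suc (Suc n)) - ?Z (Suc n)
      = (1/2) *\<^sub>R ((T + (?Z (Suc n) o\<^sub>L ?Z (Suc n))) - (T + (?Z n o\<^sub>L ?Z n)))"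
    by (simp only: sqrt_iter.simps(2)[of T "Suc n"] sqrt_iter.simps(2)[of T n] scaleR_diff_right)
  also have "\<dots> = (1/2) *\<^sub>R ((?Z (Suc n) - ?Z n) o\<^sub>L (?Z (Suc n) + ?Z n))"
    unfolding compose_bilinear comm by simp
  finally have "norm (?Z (Suc (Suc n)) - ?Z (Suc n))
      \<le> (1/2) * (norm (?Z (Suc n) - ?Z n) * norm (?Z (Suc n) + ?Z n))"
    using norm_blinfun_compose[of "?Z (Suc n) - ?Z n" "?Z (Suc n) + ?Z n"] by (simp del: sqrt_iter.simps)
  also have "\<dots> \<le> (1/2) * ((?s (Suc n) - ?s n) * (?s (Suc n) + ?s n))"
  proof (intro mult_left_mono mult_mono Suc)
    show "norm (?Z (Suc n) + ?Z n) \<le> ?s (Suc n) + ?s n"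
      using norm_triangle_ineq[of "?Z (Suc n)" "?Z n"] norm_sqrt_iter_le[OF assms, of n]
        norm_sqrt_iter_le[OF assms, of "Suc n"] by linarith
    show "0 \<le> ?s (Suc n) - ?s n" using incseq_SucD[OF sqrt_iter_real_mono, of n] by linarith
  qed simp_all
  also have "\<dots> = ?s (Suc (Suc n)) - ?s (Suc n)"
    by (simp only: sqrt_iter_real.simps(2)[of "Suc n"] sqrt_iter_real.simps(2)[of n]) algebra
  finally show ?case .
qed

lemma sqrt_iter_convergent:
  fixes T :: "'a :: banach \<Rightarrow>\<^sub>L 'a"
  assumes "norm T \<le> 1"
  shows "convergent (sqrt_iter T)"
proof -
  have le: "norm (sqrt_iter T (n + k) - sqrt_iter T n) \<le> sqrt_iter_real (n + k) - sqrt_iter_real n" for n k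
  proof (induction k)
    case (Suc k)
    have "norm (sqrt_iter T (n + Suc k) - sqrt_iter T n)
        \<le> norm (sqrt_iter T (Suc (n + k)) - sqrt_iter T (n + k)) + norm (sqrt_iter T (n + k) - sqrt_iter T n)"
      using norm_triangle_ineq[of "sqrt_iter T (Suc (n + k)) - sqrt_iter T (n + k)"
          "sqrt_iter T (n + k) - sqrt_iter T n"] by (simp del: sqrt_iter.simps)
    then show ?case
      using Suc norm_sqrt_iter_diff_le[OF assms, of "n + k"] by (simp del: sqrt_iter.simps sqrt_iter_real.simps)
  qed simp
  have "convergent sqrt_iter_real"
    by (rule Bseq_mono_convergent[OF BseqI'[where K = 1]])
      (use sqrt_iter_real_bounds sqrt_iter_real_mono in \<open>auto simp: mono_def\<close>)
  then have C: "Cauchy sqrt_iter_real" by (rule convergent_Cauchy)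
  have "Cauchy (sqrt_iter T)"
    unfolding Cauchy_altdef2
  proof safe
    fix e :: real assume "e > 0"
    then obtain N where N: "\<And>m. m \<ge> N \<Longrightarrow> dist (sqrt_iter_real m) (sqrt_iter_real N) < e"
      using C unfolding Cauchy_altdef2 by blast
    have "dist (sqrt_iter T m) (sqrt_iter T N) < e" if "m \<ge> N" for m
      using le[of N "m - N"] N[OF that] that by (simp add: dist_norm)
    then show "\<exists>N. \<forall>n\<ge>N. dist (sqrt_iter T n) (sqrt_iter T N) < e" by blast
  qed
  then show ?thesis by (simp add: Cauchy_convergent_iff)
qed

lemma sqrt_iter_BH: "T \<in> BH \<Longrightarrow> sqrt_iter T n \<in> BH"
  by (induction n) (simp_all add: BH_closed_ops)

text \<open>Here \<open>h\<close> is the absolute value of \<open>Y\<close>. Commutation with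
  everything that commutes with \<open>Y\<close> passes from the iterates to their limit, and
  positivity of \<open>h = 1 - Z\<close> follows from \<open>norm Z \<le> 1\<close>. The operator
  serves to separate the positive from the negative part of \<open>Y\<close>.\<close>

lemma absolute_value_exists:
  fixes Y :: "'a :: complex_hilbert \<Rightarrow>\<^sub>L 'a"
  assumes Y: "Y \<in> BH" "is_adjoint Y Y" "norm Y \<le> 1"
  shows "\<exists>h\<in>BH. h o\<^sub>L h = Y o\<^sub>L Y \<and> (\<forall>R. R o\<^sub>L Y = Y o\<^sub>L R \<longrightarrow> R o\<^sub>L h = h o\<^sub>L R)
      \<and> (\<forall>x. 0 \<le> Re (cinner (h x) x))"
proof -
  \<comment> \<open>With \<open>h = 1 - Z\<close> the equation \<open>2 Z = T + Z Z\<close> reads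
    \<open>h h = 1 - T\<close>, which is \<open>Y Y\<close> for this choice of
    \<open>T\<close>.\<close>
  define T where "T = id_blinfun - (Y o\<^sub>L Y)"
  have Yle: "norm (Y x) \<le> norm x" for x
    using norm_blinfun[of Y x] mult_right_mono[OF Y(3), of "norm x"] by simp
  have "norm T \<le> 1"
  proof (rule norm_blinfun_bound)
    fix x
    have "inner x (Y (Y x)) = (norm (Y x))\<^sup>2"
      using adjoint_shift[OF Y(2), of x "Y x"]
      by (simp add: inner_eq_Re_cinner power2_norm_eq_inner)
    then have "(norm (T x))\<^sup>2 = (norm x)\<^sup>2 - 2 * (norm (Y x))\<^sup>2 + (norm (Y (Y x)))\<^sup>2"
      by (simp add: T_def blinfun.diff_left power2_norm_eq_inner inner_diff_left inner_diff_right inner_commute)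
    also have "\<dots> \<le> (norm x)\<^sup>2"
      using power_mono[OF Yle[of "Y x"] norm_ge_zero, of 2] zero_le_power2[of "norm (Y x)"] by linarith
    finally show "norm (T x) \<le> 1 * norm x" by simp
  qed simp
  then obtain Z where Z: "sqrt_iter T \<longlonglongrightarrow> Z"
    using sqrt_iter_convergent by (auto simp: convergent_def)
  have T: "T \<in> BH" by (simp add: T_def BH_closed_ops Y)
  have "Z \<in> BH" by (rule BH_limit[OF Z sqrt_iter_BH[OF T]])
  have "norm (sqrt_iter T n) \<le> 1" for n
    using norm_sqrt_iter_le[OF \<open>norm T \<le> 1\<close>, of n] sqrt_iter_real_bounds[of n] by linarith
  then have "norm Z \<le> 1"
    by (intro Lim_bounded[OF tendsto_norm[OF Z]]) auto
  have "(\<lambda>n. sqrt_iter T (Suc n)) \<longlonglongrightarrow> (1/2) *\<^sub>R (T + (Z o\<^sub>L Z))"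
    unfolding sqrt_iter.simps
    by (intro tendsto_intros Z bounded_bilinear.tendsto[OF bounded_bilinear_blinfun_compose])
  then have fix_eq: "Z = (1/2) *\<^sub>R (T + (Z o\<^sub>L Z))"
    using LIMSEQ_Suc[OF Z] LIMSEQ_unique by blast
  define h where "h = id_blinfun - Z"
  have "h \<in> BH" by (simp add: h_def BH_closed_ops \<open>Z \<in> BH\<close>)
  moreover have "h o\<^sub>L h = Y o\<^sub>L Y"
  proof (rule blinfun_eqI)
    fix x
    have "Z x = (1/2) *\<^sub>R (T x + Z (Z x))"
      using fix_eq by (metis blinfun.add_left blinfun.scaleR_left blinfun_apply_blinfun_compose)
    then have "Z x + Z x = T x + Z (Z x)" by (metis scaleR_half_double scaleR_add_right)
    then show "(h o\<^sub>L h) x = (Y o\<^sub>L Y) x"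
      by (simp add: h_def T_def blinfun.diff_left blinfun.diff_right algebra_simps)
  qed
  moreover have "R o\<^sub>L h = h o\<^sub>L R" if R: "R o\<^sub>L Y = Y o\<^sub>L R" for R
  proof -
    have "R o\<^sub>L (Y o\<^sub>L Y) = (Y o\<^sub>L Y) o\<^sub>L R" by (metis R compose_assoc)
    then have "R o\<^sub>L T = T o\<^sub>L R"
      by (auto simp: T_def compose_bilinear intro!: blinfun_eqI)
    then have "R o\<^sub>L Z = Z o\<^sub>L R" by (intro commute_limit[OF Z] sqrt_iter_commute)
    then show ?thesis by (auto simp: h_def compose_bilinear intro!: blinfun_eqI)
  qed
  moreover have "0 \<le> Re (cinner (h x) x)" for x
  proof -
    have "inner (Z x) x \<le> norm (Z x) * norm x" by (rule norm_cauchy_schwarz)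
    also have "\<dots> \<le> norm x * norm x"
      using norm_blinfun[of Z x] mult_right_mono[OF \<open>norm Z \<le> 1\<close>, of "norm x"]
      by (intro mult_right_mono) auto
    finally show ?thesis
      by (simp add: h_def blinfun.diff_left cinner_diff_left flip: inner_eq_Re_cinner power2_norm_eq_inner)
        (simp add: power2_norm_eq_inner power2_eq_square flip: power2_norm_eq_inner)
  qed
  ultimately show ?thesis by blast
qed

section \<open>Von Neumann algebras and minimal projections\<close>

lemma compose_eq_apply: "A o\<^sub>L B = C o\<^sub>L E \<Longrightarrow> A (B x) = C (E x)"
  by (metis blinfun_apply_blinfun_compose)

lemma idem_apply: "p o\<^sub>L p = p \<Longrightarrow> p (p x) = p x"
  by (metis blinfun_apply_blinfun_compose)

lemma commutantD: "R \<in> commutant D \<Longrightarrow> d \<in> D \<Longrightarrow> R (d x) = d (R x)"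
  by (auto simp: commutant_def intro: compose_eq_apply)

lemma commutant_BH: "R \<in> commutant D \<Longrightarrow> R \<in> BH"
  by (simp add: commutant_def)

lemma orthogonal_projection_operator:
  fixes S :: "'a :: complex_hilbert set"
  assumes S: "closed S" "csubspace S"
  shows "\<exists>p\<in>BH. is_adjoint p p \<and> p o\<^sub>L p = p \<and> (\<forall>x. p x = x \<longleftrightarrow> x \<in> S)"
proof -
  obtain P where P: "\<And>x. P x \<in> S" "\<And>x s. s \<in> S \<Longrightarrow> cinner (x - P x) s = 0"
    using closed_csubspace_projection_exists[OF S] by metis
  have sub: "0 \<in> S" "\<And>x y. x \<in> S \<Longrightarrow> y \<in> S \<Longrightarrow> x + y \<in> S" "\<And>c x. x \<in> S \<Longrightarrow> c *\<^sub>C x \<in> S"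
    using S(2) by (auto simp: csubspace_def)
  have diff: "x - y \<in> S" if "x \<in> S" "y \<in> S" for x y
    using sub(2)[OF that(1) sub(3)[OF that(2), of "-1"]] by (simp add: scaleC_minus1)
  have unique: "P x = u" if "u \<in> S" "\<And>s. s \<in> S \<Longrightarrow> cinner (x - u) s = 0" for x u
  proof -
    have d: "P x - u \<in> S" by (intro diff P that)
    have "cinner (P x - u) (P x - u) = cinner (x - u) (P x - u) - cinner (x - P x) (P x - u)"
      by (simp add: cinner_diff_left)
    also have "\<dots> = 0" using that(2)[OF d] P(2)[OF d] by simp
    finally show ?thesis by (simp add: cinner_self)
  qed
  have add: "P (x + y) = P x + P y" for x y
    using P(2) by (intro unique sub P) (simp add: add_diff_add cinner_add_left)
  have scale: "P (c *\<^sub>C x) = c *\<^sub>C P x" for c x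
    using P(2) by (intro unique sub P) (simp add: cinner_scaleC_left flip: scaleC_diff_right)
  have shift: "cinner (P x) y = cinner (P x) (P y)" for x y
    using P(2)[OF P(1), of y x] cinner_commute[of "y - P y" "P x"] by (simp add: cinner_diff_right)
  have bound: "norm (P x) \<le> norm x" for x
  proof (cases "P x = 0")
    case False
    have "norm (P x) * norm (P x) = cmod (cinner (P x) x)"
      using shift[of x x] by (simp add: cinner_self power2_eq_square norm_mult)
    also have "\<dots> \<le> norm (P x) * norm x" by (rule norm_cinner_le)
    finally show ?thesis using False by simp
  qed simp
  have bl: "bounded_linear P"
    by (rule bounded_linear_intro[where K = 1]) (simp_all add: add scaleR_scaleC scale bound)
  have PP: "P x = x" if "x \<in> S" for x using that by (intro unique) auto
  show ?thesis
  proof (intro bexI[of _ "Blinfun P"] conjI allI)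
    show "Blinfun P \<in> BH" by (simp add: BH_def bounded_linear_Blinfun_apply[OF bl] scale)
    show "Blinfun P o\<^sub>L Blinfun P = Blinfun P"
      by (rule blinfun_eqI) (simp add: bounded_linear_Blinfun_apply[OF bl] PP P(1))
    show "is_adjoint (Blinfun P) (Blinfun P)"
      unfolding is_adjoint_def bounded_linear_Blinfun_apply[OF bl]
      using shift by (metis cinner_commute)
    show "Blinfun P x = x \<longleftrightarrow> x \<in> S" for x
      using PP P(1)[of x] by (auto simp: bounded_linear_Blinfun_apply[OF bl])
  qed
qed

locale vn_algebra =
  fixes D :: "('a :: complex_hilbert \<Rightarrow>\<^sub>L 'a) set"
  assumes vn: "von_neumann_algebra D"
begin

lemma in_BH: "d \<in> D \<Longrightarrow> d \<in> BH"
  using vn by (auto simp: von_neumann_algebra_def subalgebra_BH_def)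

lemma scaleC_apply: "d \<in> D \<Longrightarrow> d (c *\<^sub>C x) = c *\<^sub>C d x"
  by (simp add: in_BH BH_scaleC)

lemma bicommutantI:
  assumes "T \<in> BH" "\<And>R x. R \<in> commutant D \<Longrightarrow> T (R x) = R (T x)"
  shows "T \<in> D"
proof -
  have "T \<in> commutant (commutant D)"
    unfolding commutant_def[of "commutant D"] using assms by (auto intro!: blinfun_eqI)
  then show ?thesis using vn by (simp add: von_neumann_algebra_def)
qed

lemma id_mem: "id_blinfun \<in> D"
  by (rule bicommutantI) (simp_all add: BH_closed_ops)

lemma add_mem: "S \<in> D \<Longrightarrow> T \<in> D \<Longrightarrow> S + T \<in> D"
  and scaleC_mem: "T \<in> D \<Longrightarrow> scaleC_op c T \<in> D"
  and compose_mem: "S \<in> D \<Longrightarrow> T \<in> D \<Longrightarrow> S o\<^sub>L T \<in> D"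
  and zero_mem: "0 \<in> D"
  using vn by (auto simp: von_neumann_algebra_def subalgebra_BH_def)

lemma scaleC_minus_one_op: "scaleC_op (-1) T = - T"
  by (rule blinfun_eqI) (simp add: scaleC_op.rep_eq scaleC_minus1 blinfun.minus_left)

lemma diff_mem: "S \<in> D \<Longrightarrow> T \<in> D \<Longrightarrow> S - T \<in> D"
  by (metis add_mem scaleC_mem scaleC_minus_one_op diff_conv_add_uminus)

lemma adjoint_mem:
  assumes "d \<in> D" obtains d' where "d' \<in> D" "is_adjoint d d'"
  using vn assms by (auto simp: von_neumann_algebra_def)

lemma limit_mem:
  assumes "X \<longlonglongrightarrow> T" "\<And>n. X n \<in> D"
  shows "T \<in> D"
proof (rule bicommutantI)
  show "T \<in> BH" using assms in_BH by (blast intro: BH_limit[OF assms(1)])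
  fix R x assume R: "R \<in> commutant D"
  have "R o\<^sub>L T = T o\<^sub>L R"
    by (rule commute_limit[OF assms(1)]) (use R assms(2) in \<open>auto simp: commutant_def\<close>)
  then show "T (R x) = R (T x)" by (rule compose_eq_apply[symmetric])
qed

lemma adjoint_commutant:
  assumes "R \<in> commutant D"
  obtains R' where "R' \<in> commutant D" "is_adjoint R R'"
proof -
  obtain R' where R': "R' \<in> BH" "is_adjoint R R'"
    using adjoint_exists[OF commutant_BH[OF assms]] by blast
  have "R' o\<^sub>L d = d o\<^sub>L R'" if d: "d \<in> D" for d
  proof -
    obtain d' where d': "d' \<in> D" "is_adjoint d d'" by (rule adjoint_mem[OF d])
    have "cinner x (R' (d y)) = cinner x (d (R' y))" for x y
      using adjoint_shift[OF R'(2), of x "d y"] adjoint_shift[OF is_adjoint_sym[OF d'(2)], of "R x" y]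
        adjoint_shift[OF R'(2), of "d' x" y] adjoint_shift[OF is_adjoint_sym[OF d'(2)], of x "R' y"]
        commutantD[OF assms d'(1)] by simp
    then show ?thesis
      by (intro blinfun_eqI cinner_eqI) (metis blinfun_apply_blinfun_compose cinner_commute)
  qed
  then show ?thesis using R' that by (auto simp: commutant_def)
qed

text \<open>The commutant is selfadjoint, so an invariant subspace is reducing; its projection then
  commutes with the commutant and lies in \<open>D\<close> by the double commutant property. All new
  projections of \<open>D\<close> are produced in this way.\<close>

lemma invariant_projection:
  assumes S: "closed S" "csubspace S"
    and inv: "\<And>R x. R \<in> commutant D \<Longrightarrow> x \<in> S \<Longrightarrow> R x \<in> S"
  shows "\<exists>p\<in>projections D. \<forall>x. p x = x \<longleftrightarrow> x \<in> S"
proof -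
  obtain p where p: "p \<in> BH" "is_adjoint p p" "p o\<^sub>L p = p" "\<And>x. p x = x \<longleftrightarrow> x \<in> S"
    using orthogonal_projection_operator[OF S] by blast
  have pR: "p (R (p x)) = R (p x)" if "R \<in> commutant D" for R x
    using p(4) inv[OF that] idem_apply[OF p(3)] by metis
  have "p \<in> D"
  proof (rule bicommutantI[OF p(1)])
    fix R x assume R: "R \<in> commutant D"
    obtain R' where R': "R' \<in> commutant D" "is_adjoint R R'" by (rule adjoint_commutant[OF R])
    show "p (R x) = R (p x)"
    proof (rule cinner_eqI)
      fix y
      have "cinner (p (R x)) y = cinner x (p (R' (p y)))"
        using p(2) R'(2) pR[OF R'(1)] by (simp add: is_adjoint_def)
      also have "\<dots> = cinner (p (R (p x))) y"
        using p(2) R'(2) by (simp add: is_adjoint_def)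
      finally show "cinner (p (R x)) y = cinner (R (p x)) y" using pR[OF R] by simp
    qed
  qed
  then show ?thesis using p by (auto simp: projections_def)
qed

end

lemma projection_op_le:
  assumes p: "p o\<^sub>L p = p" "is_adjoint p p" and e: "e o\<^sub>L e = e" "is_adjoint e e"
    and pe: "\<And>x. e (p x) = p x"
  shows "op_le p e"
proof -
  have "cinner (p x) x = of_real ((norm (p x))\<^sup>2)" for x
    using adjoint_shift[OF p(2), of "p x" x] idem_apply[OF p(1), of x]
    by (metis cinner_self)
  moreover have "cinner (e x) x = of_real ((norm (e x))\<^sup>2)" for x
    using adjoint_shift[OF e(2), of "e x" x] idem_apply[OF e(1), of x]
    by (metis cinner_self)
  moreover have "norm (p x) \<le> norm (e x)" for x
  proof -
    have "p x = p (e x)"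
    proof (rule cinner_eqI)
      fix y show "cinner (p x) y = cinner (p (e x)) y"
        using p(2) e(2) pe by (simp add: is_adjoint_def)
    qed
    have "norm (p x) * norm (p x) = cmod (cinner (p x) (e x))"
      using adjoint_shift[OF p(2), of "p x" "e x"] \<open>p x = p (e x)\<close> idem_apply[OF p(1), of x]
      by (simp add: cinner_self power2_eq_square norm_mult)
    also have "\<dots> \<le> norm (p x) * norm (e x)" by (rule norm_cinner_le)
    finally show ?thesis by (cases "p x = 0") auto
  qed
  ultimately show ?thesis
    by (simp add: op_le_def positive_op_def blinfun.diff_left cinner_diff_left power_mono)
qed

section \<open>Compressions by minimal projections are scalar\<close>

context vn_algebra
begin

lemma minimal_projectionD:
  assumes "minimal_projection D e"
  shows "e \<in> D" "e (e x) = e x" "is_adjoint e e" "e \<noteq> 0" "e o\<^sub>L e = e"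
  using assms by (auto simp: minimal_projection_def projections_def idem_apply)

text \<open>Minimality read as irreducibility: the projection onto \<open>S\<close> belongs to
  \<open>D\<close> and lies below \<open>e\<close>, so the commutant acts on the range of
  \<open>e\<close> without proper closed invariant subspaces.\<close>

lemma minimal_invariant_subspace:
  assumes e: "minimal_projection D e"
    and S: "closed S" "csubspace S" "\<And>x. x \<in> S \<Longrightarrow> e x = x"
    and inv: "\<And>R x. R \<in> commutant D \<Longrightarrow> x \<in> S \<Longrightarrow> R x \<in> S"
  shows "S \<subseteq> {0} \<or> (\<forall>x. e x = x \<longrightarrow> x \<in> S)"
proof -
  obtain p where p: "p \<in> projections D" "\<And>x. p x = x \<longleftrightarrow> x \<in> S"
    using invariant_projection[OF S(1,2) inv] by blast
  then have p': "p o\<^sub>L p = p" "is_adjoint p p" by (auto simp: projections_def)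
  have "p x \<in> S" for x using p(2) idem_apply[OF p'(1)] by metis
  then have "op_le p e"
    by (intro projection_op_le p' minimal_projectionD[OF e] S(3))
  then have "p = 0 \<or> p = e" using e p(1) by (auto simp: minimal_projection_def)
  then show ?thesis
  proof
    assume "p = 0"
    then have "x = 0" if "x \<in> S" for x using p(2)[of x] that by simp
    then show ?thesis by blast
  next
    assume "p = e"
    then show ?thesis using p(2) by blast
  qed
qed

lemma selfadjoint_form_zero:
  fixes z :: "'a \<Rightarrow>\<^sub>L 'a"
  assumes z: "is_adjoint z z" "\<And>x. inner (z x) x = 0"
  shows "z x = 0"
proof -
  have sym: "inner (z u) v = inner (z v) u" for u v
    using adjoint_shift[OF z(1), of u v] cinner_commute[of u "z v"] by (simp add: inner_eq_Re_cinner)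
  \<comment> \<open>Polarisation: after the diagonal terms vanish, the cross terms are twice the
    squared norm of \<open>z x\<close>.\<close>
  have "inner (z (x + z x)) (x + z x) = 0" by (rule z(2))
  then have "inner (z x) (z x) = 0"
    using z(2)[of x] z(2)[of "z x"] sym[of "z x" x]
    by (simp add: blinfun.add_right inner_add_left inner_add_right)
  then show ?thesis by simp
qed

text \<open>A spectral splitting at the threshold \<open>t\<close>. Let \<open>w\<close> be a
  rescaled \<open>y - t\<close> and \<open>h\<close> its absolute value. The part of the range of
  \<open>e\<close> on which \<open>h = w\<close> is invariant under the commutant, hence everything
  or zero; in the first case \<open>w\<close> is positive there, in the second it equals
  \<open>- h\<close>.\<close>

lemma minimal_compress_dichotomy:
  assumes e: "minimal_projection D e" and y: "y \<in> D" "is_adjoint y y" "\<And>x. e (y x) = y (e x)"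
  shows "(\<forall>x. e x = x \<longrightarrow> t * (norm x)\<^sup>2 \<le> inner (y x) x)
    \<or> (\<forall>x. e x = x \<longrightarrow> inner (y x) x \<le> t * (norm x)\<^sup>2)"
proof -
  \<comment> \<open>Scales to a contraction, as the absolute value construction requires; adding
    \<open>1\<close> keeps the denominator positive.\<close>
  define r where "r = 1 / (norm (y - t *\<^sub>R id_blinfun) + 1)"
  have r: "r > 0" by (simp add: r_def add_nonneg_pos)
  define w where "w = r *\<^sub>R (y - t *\<^sub>R id_blinfun)"
  have "norm w \<le> 1" by (simp add: w_def r_def divide_le_eq_1 add_nonneg_pos)
  moreover have "w \<in> BH" "is_adjoint w w"
    by (auto simp: w_def BH_closed_ops in_BH y is_adjoint_scaleR is_adjoint_diff is_adjoint_id)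
  ultimately obtain h where h: "h \<in> BH" "h o\<^sub>L h = w o\<^sub>L w"
    "\<And>R. R o\<^sub>L w = w o\<^sub>L R \<Longrightarrow> R o\<^sub>L h = h o\<^sub>L R" "\<And>x. 0 \<le> Re (cinner (h x) x)"
    using absolute_value_exists by blast
  have w_apply: "w x = r *\<^sub>R (y x - t *\<^sub>R x)" for x
    by (simp add: w_def blinfun.diff_left blinfun.scaleR_left)
  have ew: "e (w x) = w (e x)" for x
    by (simp add: w_apply blinfun.diff_right blinfun.scaleR_right y)
  have hcomm: "R (h x) = h (R x)" if "\<And>x. R (w x) = w (R x)" for R :: "'a \<Rightarrow>\<^sub>L 'a" and x
  proof (rule compose_eq_apply, rule h(3))
    show "R o\<^sub>L w = w o\<^sub>L R" using that by (auto intro!: blinfun_eqI)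
  qed
  have eh: "e (h x) = h (e x)" for x by (rule hcomm[OF ew])
  have wh: "w (h x) = h (w x)" for x by (rule hcomm[OF refl])
  have w_form: "inner (w x) x = r * (inner (y x) x - t * (norm x)\<^sup>2)" for x
    by (simp add: w_apply inner_diff_left power2_norm_eq_inner)
  define S where "S = {x. e x = x \<and> h x = w x}"
  have "closed S"
    unfolding S_def by (intro closed_Collect_conj closed_Collect_eq continuous_intros)
  moreover have "csubspace S"
    using \<open>w \<in> BH\<close> h(1) in_BH minimal_projectionD(1)[OF e]
    by (auto simp: S_def csubspace_def blinfun.add_right blinfun.zero_right BH_scaleC)
  moreover have "R x \<in> S" if R: "R \<in> commutant D" and "x \<in> S" for R x
  proof -
    have Rw: "R (w z) = w (R z)" for z
      by (simp add: w_apply blinfun.diff_right blinfun.scaleR_right commutantD[OF R y(1)])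
    have "h (R x) = R (h x)" by (rule hcomm[OF Rw, symmetric])
    moreover have "e (R x) = R (e x)" by (rule commutantD[OF R minimal_projectionD(1)[OF e], symmetric])
    ultimately show ?thesis using \<open>x \<in> S\<close> Rw[of x] by (simp add: S_def)
  qed
  ultimately have "S \<subseteq> {0} \<or> (\<forall>x. e x = x \<longrightarrow> x \<in> S)"
    by (intro minimal_invariant_subspace[OF e]) (auto simp: S_def)
  then show ?thesis
  proof
    assume "\<forall>x. e x = x \<longrightarrow> x \<in> S"
    then have "0 \<le> inner (w x) x" if "e x = x" for x
      using that h(4)[of x] by (simp add: S_def inner_eq_Re_cinner)
    then show ?thesis using r by (auto simp: w_form zero_le_mult_iff)
  next
    assume S0: "S \<subseteq> {0}"
    have "inner (w x) x \<le> 0" if x: "e x = x" for x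
    proof -
      have "h (h x) = w (w x)" using h(2) by (rule compose_eq_apply)
      \<comment> \<open>Since \<open>h\<close> and \<open>w\<close> commute and
        \<open>h h = w w\<close>, both \<open>h\<close> and \<open>w\<close> send
        \<open>h x + w x\<close> to the same vector.\<close>
      then have "h x + w x \<in> S"
        using x by (simp add: S_def blinfun.add_right eh ew wh)
      then have "w x = - h x" using S0 by (auto simp: eq_neg_iff_add_eq_0 add.commute)
      then show ?thesis using h(4)[of x] by (simp add: inner_eq_Re_cinner cinner_minus_left)
    qed
    then show ?thesis using r by (auto simp: w_form mult_le_0_iff)
  qed
qed

text \<open>If the quadratic form of the compression took two values at unit vectors of the range of
  \<open>e\<close>, a threshold strictly between them would violate the dichotomy. A selfadjoint
  operator with constant quadratic form on unit vectors is a scalar.\<close>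

lemma minimal_compress_selfadjoint:
  assumes e: "minimal_projection D e" and d: "d \<in> D" "is_adjoint d d"
  shows "\<exists>\<mu>::real. \<forall>x. e (d (e x)) = \<mu> *\<^sub>R e x"
proof -
  note ep = minimal_projectionD[OF e]
  define y where "y = e o\<^sub>L d o\<^sub>L e"
  have y: "y \<in> D" "is_adjoint y y" "\<And>x. e (y x) = y (e x)"
    using d ep by (auto simp: y_def compose_mem is_adjoint_def)
  have ne: "\<exists>x0. e x0 = x0 \<and> norm x0 = 1"
  proof -
    obtain z where "e z \<noteq> 0" using ep(4) by (metis blinfun_eqI blinfun.zero_left)
    then show ?thesis
      by (intro exI[of _ "(1 / norm (e z)) *\<^sub>R e z"]) (simp add: blinfun.scaleR_right ep)
  qed
  then obtain x0 where x0: "e x0 = x0" "norm x0 = 1" by blast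
  define \<mu> where "\<mu> = inner (y x0) x0"
  have form: "inner (y x) x = \<mu> * (norm x)\<^sup>2" if x: "e x = x" for x
  proof (rule ccontr)
    assume ne: "inner (y x) x \<noteq> \<mu> * (norm x)\<^sup>2"
    then have "x \<noteq> 0" by (auto simp: blinfun.zero_right)
    then have pos: "(norm x)\<^sup>2 > 0" by simp
    define q where "q = inner (y x) x / (norm x)\<^sup>2"
    have q: "inner (y x) x = q * (norm x)\<^sup>2" using pos by (simp add: q_def)
    then have "q \<noteq> \<mu>" using ne by auto
    define t where "t = (q + \<mu>) / 2"
    have "t \<le> q \<and> t \<le> \<mu> \<or> q \<le> t \<and> \<mu> \<le> t"
      using minimal_compress_dichotomy[OF e y, of t]
    proof
      assume le: "\<forall>x. e x = x \<longrightarrow> t * (norm x)\<^sup>2 \<le> inner (y x) x"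
      show ?thesis
        using le[rule_format, OF x] le[rule_format, OF x0(1)] x0(2) q pos by (simp add: \<mu>_def)
    next
      assume le: "\<forall>x. e x = x \<longrightarrow> inner (y x) x \<le> t * (norm x)\<^sup>2"
      show ?thesis
        using le[rule_format, OF x] le[rule_format, OF x0(1)] x0(2) q pos by (simp add: \<mu>_def)
    qed
    then show False using \<open>q \<noteq> \<mu>\<close> by (auto simp: t_def)
  qed
  define z where "z = y - \<mu> *\<^sub>R e"
  have "z x = 0" for x
  proof (rule selfadjoint_form_zero)
    show "is_adjoint z z" by (auto simp: z_def intro!: is_adjoint_diff is_adjoint_scaleR y ep)
    fix x
    have "y x = e (y (e x))" by (simp add: y_def ep)
    then have "inner (y x) x = inner (y (e x)) (e x)"
      using adjoint_shift[OF ep(3), of "y (e x)" x] by (simp add: inner_eq_Re_cinner)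
    moreover have "inner (e x) x = (norm (e x))\<^sup>2"
      using adjoint_shift[OF ep(3), of "e x" x] ep(2)[of x]
      by (simp add: inner_eq_Re_cinner cinner_self)
    ultimately show "inner (z x) x = 0"
      using form[of "e x"] ep by (simp add: z_def blinfun.diff_left blinfun.scaleR_left inner_diff_left)
  qed
  then have "y x = \<mu> *\<^sub>R e x" for x by (simp add: z_def blinfun.diff_left blinfun.scaleR_left)
  then show ?thesis by (auto simp: y_def)
qed

lemma minimal_compress_scalar:
  assumes e: "minimal_projection D e" and d: "d \<in> D"
  shows "\<exists>c. \<forall>x. e (d (e x)) = c *\<^sub>C e x"
proof -
  obtain d' where d': "d' \<in> D" "is_adjoint d d'" by (rule adjoint_mem[OF d])
  \<comment> \<open>Both are selfadjoint, and \<open>2 d = ?a - \<i> ?b\<close>.\<close>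
  let ?a = "d + d'" and ?b = "scaleC_op \<i> (d - d')"
  have "is_adjoint ?a ?a"
    using is_adjoint_add[OF d'(2) is_adjoint_sym[OF d'(2)]] by (simp add: add.commute)
  then obtain \<alpha> where \<alpha>: "\<And>x. e (?a (e x)) = \<alpha> *\<^sub>R e x"
    using minimal_compress_selfadjoint[OF e add_mem[OF d d'(1)]] by blast
  have "scaleC_op (cnj \<i>) (d' - d) = ?b"
    by (rule blinfun_eqI) (simp add: scaleC_op.rep_eq blinfun.diff_left scaleC_diff_right scaleC_minus_left)
  then have "is_adjoint ?b ?b"
    using is_adjoint_scaleC[OF is_adjoint_diff[OF d'(2) is_adjoint_sym[OF d'(2)]], of \<i>] by simp
  then obtain \<beta> where \<beta>: "\<And>x. e (?b (e x)) = \<beta> *\<^sub>R e x"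
    using minimal_compress_selfadjoint[OF e scaleC_mem[OF diff_mem[OF d d'(1)]]] by blast
  have "e (d (e x)) = ((complex_of_real \<alpha> - \<i> * complex_of_real \<beta>) / 2) *\<^sub>C e x" for x
  proof -
    have eC: "e (c *\<^sub>C u) = c *\<^sub>C e u" for c u by (rule scaleC_apply[OF minimal_projectionD(1)[OF e]])
    have "e (?a (e x)) + (- \<i>) *\<^sub>C e (?b (e x)) = 2 *\<^sub>C e (d (e x))"
      by (simp add: blinfun.add_left blinfun.diff_left blinfun.add_right blinfun.diff_right
          scaleC_op.rep_eq eC scaleC_scaleC scaleC_one scaleC_add_left[of 1 1, simplified])
    then have "2 *\<^sub>C e (d (e x)) = (complex_of_real \<alpha> - \<i> * complex_of_real \<beta>) *\<^sub>C e x"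
      unfolding \<alpha> \<beta> by (simp add: scaleR_scaleC scaleC_scaleC flip: scaleC_add_left)
    then have "(1/2) *\<^sub>C 2 *\<^sub>C e (d (e x)) = (1/2) *\<^sub>C (complex_of_real \<alpha> - \<i> * complex_of_real \<beta>) *\<^sub>C e x" by simp
    then show ?thesis by (simp add: scaleC_scaleC scaleC_one)
  qed
  then show ?thesis by blast
qed

end

section \<open>The ultraweak topology\<close>

lemma topspace_ultraweak: "topspace ultraweak = UNIV"
proof -
  have "UNIV \<in> {{T :: 'a \<Rightarrow>\<^sub>L 'a. (\<Sum>n. cinner (T (x n)) (y n)) \<in> U} | x y U.
        summable (\<lambda>n::nat. (norm (x n))\<^sup>2) \<and> summable (\<lambda>n. (norm (y n))\<^sup>2) \<and> open U}"
    by (intro CollectI exI[of _ "\<lambda>_. 0"] exI[of _ UNIV]) simp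
  from Union_upper[OF this] show ?thesis
    unfolding ultraweak_def topology_generated_by_topspace by (rule top.extremum_uniqueI)
qed

lemma topspace_weak_star: "topspace (weak_star M) = M"
  by (simp add: weak_star_def topspace_ultraweak)

lemma suminf_norm_mult_le:
  fixes f :: "nat \<Rightarrow> 'a :: real_normed_vector" and g :: "nat \<Rightarrow> 'b :: real_normed_vector"
  assumes f: "summable (\<lambda>n. (norm (f n))\<^sup>2)" and g: "summable (\<lambda>n. (norm (g n))\<^sup>2)"
  shows "(\<Sum>n. norm (f n) * norm (g n))\<^sup>2 \<le> (\<Sum>n. (norm (f n))\<^sup>2) * (\<Sum>n. (norm (g n))\<^sup>2)"
proof -
  define F G where "F = Abs_l2 (\<lambda>n. norm (f n))" and "G = Abs_l2 (\<lambda>n. norm (g n))"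
  have F: "l2_nth F = (\<lambda>n. norm (f n))" and G: "l2_nth G = (\<lambda>n. norm (g n))"
    unfolding F_def G_def using f g by (simp_all add: l2_nth_Abs)
  have "(inner F G)\<^sup>2 \<le> inner F F * inner G G" by (rule Cauchy_Schwarz_ineq)
  then show ?thesis by (simp add: inner_l2_def F G power2_eq_square mult.commute)
qed

text \<open>Turns ultraweak openness into a bound on the amplified operator at a single vector of
  \<open>l2\<close>, the form needed for a distance argument there. Cauchy-Schwarz treats the
  defining functionals.\<close>

lemma ultrastrong_nbhd:
  fixes U :: "('a :: complex_inner \<Rightarrow>\<^sub>L 'a) set"
  assumes "openin ultraweak U" "T0 \<in> U"
  shows "\<exists>x \<delta>. summable (\<lambda>n::nat. (norm (x n))\<^sup>2) \<and> \<delta> > 0 \<and>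
    (\<forall>T. (\<Sum>n. (norm ((T - T0) (x n)))\<^sup>2) < \<delta> \<longrightarrow> T \<in> U)"
  using openin_topology_generated_by[OF assms(1)[unfolded ultraweak_def]] assms(2)
proof (induction U rule: generate_topology_on.induct)
  case (Int a b)
  obtain x \<delta> where x: "summable (\<lambda>n::nat. (norm (x n))\<^sup>2)" "\<delta> > 0"
    "\<And>T. (\<Sum>n. (norm ((T - T0) (x n)))\<^sup>2) < \<delta> \<Longrightarrow> T \<in> a"
    using Int by blast
  obtain y \<epsilon> where y: "summable (\<lambda>n::nat. (norm (y n))\<^sup>2)" "\<epsilon> > 0"
    "\<And>T. (\<Sum>n. (norm ((T - T0) (y n)))\<^sup>2) < \<epsilon> \<Longrightarrow> T \<in> b"
    using Int by blast
  \<comment> \<open>Interleaving merges the two test sequences into one whose quadratic sum is the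
    sum of both, so one threshold controls both sets.\<close>
  define z where "z n = (if even n then x (n div 2) else y ((n - 1) div 2))" for n
  have z: "(\<lambda>n. (norm (S (z n)))\<^sup>2) sums
      ((\<Sum>n. (norm (S (y n)))\<^sup>2) + (\<Sum>n. (norm (S (x n)))\<^sup>2))" for S :: "'a \<Rightarrow>\<^sub>L 'a"
    using sums_if[OF summable_sums summable_sums, OF summable_norm_blinfun_power2[OF y(1), of S]
        summable_norm_blinfun_power2[OF x(1), of S]]
    by (simp add: z_def if_distrib[of "\<lambda>u. (norm (blinfun_apply S u))\<^sup>2"])
  have "summable (\<lambda>n. (norm (z n))\<^sup>2)"
    using sums_summable[OF z[of id_blinfun]] by simp
  moreover have "T \<in> a \<inter> b" if "(\<Sum>n. (norm ((T - T0) (z n)))\<^sup>2) < min \<delta> \<epsilon>" for T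
  proof -
    have "0 \<le> (\<Sum>n. (norm ((T - T0) (x n)))\<^sup>2)" "0 \<le> (\<Sum>n. (norm ((T - T0) (y n)))\<^sup>2)"
      by (intro suminf_nonneg summable_norm_blinfun_power2 x y; simp)+
    then show ?thesis using that x(3)[of T] y(3)[of T] sums_unique[OF z[of "T - T0"]] by auto
  qed
  ultimately show ?case using x(2) y(2) by (intro exI[of _ z] exI[of _ "min \<delta> \<epsilon>"]) auto
next
  case (UN K)
  then obtain k where k: "k \<in> K" "T0 \<in> k" by blast
  from UN.IH[OF this] obtain x \<delta> where "summable (\<lambda>n::nat. (norm (x n))\<^sup>2)" "\<delta> > 0"
    "\<And>T. (\<Sum>n. (norm ((T - T0) (x n)))\<^sup>2) < \<delta> \<Longrightarrow> T \<in> k" by blast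
  then show ?case using k by blast
next
  case (Basis s)
  then obtain x y :: "nat \<Rightarrow> 'a" and V where
    s: "s = {T :: 'a \<Rightarrow>\<^sub>L 'a. (\<Sum>n. cinner (T (x n)) (y n)) \<in> V}"
    and x: "summable (\<lambda>n. (norm (x n))\<^sup>2)" and y: "summable (\<lambda>n. (norm (y n))\<^sup>2)" and V: "open V"
    by blast
  let ?f = "\<lambda>T :: 'a \<Rightarrow>\<^sub>L 'a. \<Sum>n. cinner (T (x n)) (y n)"
  let ?Y = "\<Sum>n. (norm (y n))\<^sup>2"
  have Y: "?Y \<ge> 0" by (intro suminf_nonneg y) simp
  obtain e where e: "e > 0" "ball (?f T0) e \<subseteq> V"
    using V Basis.prems by (auto simp: s open_contains_ball)
  have summ: "summable (\<lambda>n. cmod (cinner (T (x n)) (y n)))" for T :: "'a \<Rightarrow>\<^sub>L 'a"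
    by (rule summable_comparison_test'[OF summable_norm_mult[OF summable_norm_blinfun_power2[OF x, of T] y]])
      (simp add: norm_cinner_le)
  \<comment> \<open>The squared error is at most the given sum times \<open>?Y\<close>; the added
    \<open>1\<close> keeps the divisor positive when all \<open>y n\<close> vanish.\<close>
  have "T \<in> s" if T: "(\<Sum>n. (norm ((T - T0) (x n)))\<^sup>2) < e\<^sup>2 / (?Y + 1)" for T
  proof -
    let ?q = "\<Sum>n. (norm ((T - T0) (x n)))\<^sup>2"
    have "?f T - ?f T0 = ?f (T - T0)"
      by (simp add: suminf_diff[OF summable_norm_cancel summable_norm_cancel, OF summ summ]
          blinfun.diff_left cinner_diff_left)
    then have "cmod (?f T - ?f T0) \<le> (\<Sum>n. cmod (cinner ((T - T0) (x n)) (y n)))"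
      using summable_norm[OF summ[of "T - T0"]] by simp
    also have "\<dots> \<le> (\<Sum>n. norm ((T - T0) (x n)) * norm (y n))"
      by (intro suminf_le norm_cinner_le summ summable_norm_mult summable_norm_blinfun_power2 x y)
    finally have "(cmod (?f T - ?f T0))\<^sup>2 \<le> (\<Sum>n. norm ((T - T0) (x n)) * norm (y n))\<^sup>2"
      by (intro power_mono) auto
    also have "\<dots> \<le> ?q * ?Y"
      by (intro suminf_norm_mult_le summable_norm_blinfun_power2 x y)
    also have "\<dots> \<le> ?q * (?Y + 1)"
      by (intro mult_left_mono suminf_nonneg summable_norm_blinfun_power2 x) auto
    also have "\<dots> < e\<^sup>2"
      using T Y by (simp add: pos_less_divide_eq add_nonneg_pos)
    finally have "cmod (?f T - ?f T0) < e"
      using e(1) by (auto intro: power_less_imp_less_base)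
    then have "?f T \<in> ball (?f T0) e" by (simp add: dist_norm norm_minus_commute)
    then show ?thesis using e(2) by (auto simp: s)
  qed
  moreover have "e\<^sup>2 / (?Y + 1) > 0" using e(1) Y by (simp add: add_nonneg_pos)
  ultimately show ?case using x by blast
qed simp

text \<open>If each defining functional composed with \<Psi> is again a defining functional on
  \<open>M\<close>, subbasic open sets pull back to subbasic ones.\<close>

lemma weak_star_continuousI:
  fixes M D :: "('a :: complex_inner \<Rightarrow>\<^sub>L 'a) set" and \<Psi> :: "('a \<Rightarrow>\<^sub>L 'a) \<Rightarrow> ('a \<Rightarrow>\<^sub>L 'a)"
  assumes maps: "\<Psi> ` M \<subseteq> D"
    and transfer: "\<And>x y :: nat \<Rightarrow> 'a. summable (\<lambda>n. (norm (x n))\<^sup>2) \<Longrightarrow>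
      summable (\<lambda>n. (norm (y n))\<^sup>2) \<Longrightarrow>
      \<exists>x' y'. summable (\<lambda>n::nat. (norm (x' n))\<^sup>2) \<and> summable (\<lambda>n. (norm (y' n))\<^sup>2) \<and>
        (\<forall>T\<in>M. (\<Sum>n. cinner (\<Psi> T (x n)) (y n)) = (\<Sum>n. cinner (T (x' n)) (y' n)))"
  shows "continuous_map (weak_star M) (weak_star D) \<Psi>"
proof -
  have "continuous_map (weak_star M) ultraweak \<Psi>"
    unfolding ultraweak_def[where 'a = 'a]
  proof (rule continuous_on_generated_topo)
    fix W :: "('a \<Rightarrow>\<^sub>L 'a) set"
    assume "W \<in> {{T. (\<Sum>n. cinner (blinfun_apply T (x n)) (y n)) \<in> U} | x y U.
        summable (\<lambda>n::nat. (norm (x n))\<^sup>2) \<and> summable (\<lambda>n. (norm (y n))\<^sup>2) \<and> open U}"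
    then obtain x y :: "nat \<Rightarrow> 'a" and U where
      W: "W = {T. (\<Sum>n. cinner (blinfun_apply T (x n)) (y n)) \<in> U}" and U: "open U"
      and "summable (\<lambda>n. (norm (x n))\<^sup>2)" "summable (\<lambda>n. (norm (y n))\<^sup>2)"
      by blast
    then obtain x' y' where x': "summable (\<lambda>n::nat. (norm (x' n))\<^sup>2)" "summable (\<lambda>n. (norm (y' n))\<^sup>2)"
      "\<And>T. T \<in> M \<Longrightarrow> (\<Sum>n. cinner (\<Psi> T (x n)) (y n)) = (\<Sum>n. cinner (T (x' n)) (y' n))"
      using transfer by blast
    let ?V = "{T :: 'a \<Rightarrow>\<^sub>L 'a. (\<Sum>n. cinner (T (x' n)) (y' n)) \<in> U}"
    have "openin ultraweak ?V"
      unfolding ultraweak_def using x'(1,2) U by (intro topology_generated_by_Basis) blast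
    moreover have "\<Psi> -` W \<inter> topspace (weak_star M) = ?V \<inter> M"
      by (auto simp: topspace_weak_star W x'(3))
    ultimately show "openin (weak_star M) (\<Psi> -` W \<inter> topspace (weak_star M))"
      unfolding weak_star_def openin_subtopology by auto
  next
    show "\<Psi> ` topspace (weak_star M) \<subseteq> \<Union> {{T. (\<Sum>n. cinner (blinfun_apply T (x n)) (y n)) \<in> U} | x y U.
        summable (\<lambda>n::nat. (norm (x n))\<^sup>2) \<and> summable (\<lambda>n. (norm (y n))\<^sup>2) \<and> open U}"
      using topspace_ultraweak[where 'a = 'a]
      unfolding ultraweak_def topology_generated_by_topspace by simp
  qed
  then show ?thesis
    unfolding weak_star_def[of D] using maps
    by (auto simp: continuous_map_in_subtopology topspace_weak_star)
qed

section \<open>Kraus families\<close>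

text \<open>Rewrites an unordered sum with countable support as a sum over the natural numbers
  padded with zeros, bridging arbitrary index sets and the sequences that define the ultraweak
  topology.\<close>

lemma has_sum_countable_support:
  assumes \<psi>: "bij_betw \<psi> K J" and J: "J \<subseteq> A" "\<And>j. j \<in> A - J \<Longrightarrow> F j = 0"
  shows "((\<lambda>k. if k \<in> K then F (\<psi> k) else 0) has_sum s) UNIV \<longleftrightarrow> (F has_sum s) A"
proof -
  have "((\<lambda>k. if k \<in> K then F (\<psi> k) else 0) has_sum s) UNIV \<longleftrightarrow> ((\<lambda>k. F (\<psi> k)) has_sum s) K"
    by (rule has_sum_cong_neutral) auto
  also have "\<dots> \<longleftrightarrow> (F has_sum s) J" by (rule has_sum_reindex_bij_betw[OF \<psi>])
  also have "\<dots> \<longleftrightarrow> (F has_sum s) A"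
    using J by (intro has_sum_cong_neutral) auto
  finally show ?thesis .
qed

text \<open>\<open>G_norm\<close> is the weak form of \<open>\<Sum>i. G_i* G_i = 1\<close>. It
  bounds every \<open>G i\<close>, makes all sums below converge absolutely, and allows an
  uncountable index set.\<close>

locale kraus_family =
  fixes G :: "'i \<Rightarrow> 'a :: complex_hilbert \<Rightarrow> 'a" and I :: "'i set"
  assumes G_add: "i \<in> I \<Longrightarrow> G i (x + y) = G i x + G i y"
    and G_scaleC: "i \<in> I \<Longrightarrow> G i (c *\<^sub>C x) = c *\<^sub>C G i x"
    and G_norm: "((\<lambda>i. (norm (G i x))\<^sup>2) has_sum (norm x)\<^sup>2) I"
begin

lemma norm_term_le: "cmod (cinner (blinfun_apply T u) v) \<le> norm T * ((norm u)\<^sup>2 + (norm v)\<^sup>2)"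
proof -
  have "cmod (cinner (T u) v) \<le> norm (T u) * norm v" by (rule norm_cinner_le)
  also have "\<dots> \<le> (norm T * norm u) * norm v" by (intro mult_right_mono norm_blinfun) auto
  also have "\<dots> = norm T * (norm u * norm v)" by simp
  also have "norm u * norm v \<le> (norm u)\<^sup>2 + (norm v)\<^sup>2"
    using sum_squares_bound[of "norm u" "norm v"]
      mult_nonneg_nonneg[OF norm_ge_zero[of u] norm_ge_zero[of v]] by linarith
  finally show ?thesis by (simp add: mult_left_mono)
qed

lemma term_summable: "(\<lambda>i. cinner (blinfun_apply T (G i x)) (G i y)) summable_on I"
proof (rule abs_summable_summable, rule Infinite_Sum.abs_summable_on_comparison_test')
  show "(\<lambda>i. norm T * ((norm (G i x))\<^sup>2 + (norm (G i y))\<^sup>2)) summable_on I"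
    using has_sum_imp_summable[OF G_norm] by (intro summable_on_cmult_right summable_on_add) auto
qed (rule norm_term_le)

lemma term_sum_bound:
  assumes F: "finite F" "F \<subseteq> I"
  shows "cmod (\<Sum>i\<in>F. cinner (blinfun_apply T (G i x)) (G i y)) \<le> norm T * norm x * norm y"
proof -
  have L2: "L2_set (\<lambda>i. norm (G i x)) F \<le> norm x" for x
  proof -
    have "(\<Sum>i\<in>F. (norm (G i x))\<^sup>2) \<le> (norm x)\<^sup>2"
      using finite_sum_le_has_sum[OF G_norm F] by simp
    then show ?thesis unfolding L2_set_def by (rule real_le_lsqrt[rotated -1]) (auto simp: sum_nonneg)
  qed
  have "cmod (\<Sum>i\<in>F. cinner (blinfun_apply T (G i x)) (G i y)) \<le> (\<Sum>i\<in>F. norm T * (norm (G i x) * norm (G i y)))"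
  proof (rule sum_norm_le)
    fix i
    have "cmod (cinner (blinfun_apply T (G i x)) (G i y)) \<le> norm (T (G i x)) * norm (G i y)" by (rule norm_cinner_le)
    also have "\<dots> \<le> (norm T * norm (G i x)) * norm (G i y)" by (intro mult_right_mono norm_blinfun) auto
    finally show "cmod (cinner (blinfun_apply T (G i x)) (G i y)) \<le> norm T * (norm (G i x) * norm (G i y))"
      by (simp add: mult.assoc)
  qed
  also have "\<dots> = norm T * (\<Sum>i\<in>F. \<bar>norm (G i x)\<bar> * \<bar>norm (G i y)\<bar>)" by (simp add: sum_distrib_left)
  also have "\<dots> \<le> norm T * (L2_set (\<lambda>i. norm (G i x)) F * L2_set (\<lambda>i. norm (G i y)) F)"
    by (intro mult_left_mono L2_set_mult_ineq) auto
  also have "\<dots> \<le> norm T * (norm x * norm y)"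
    by (intro mult_left_mono mult_mono L2) auto
  finally show ?thesis by (simp add: mult.assoc)
qed

lemma kraus_operator_exists:
  assumes T: "T \<in> BH"
  shows "\<exists>S\<in>BH. \<forall>x y. cinner (blinfun_apply S x) y = (\<Sum>\<^sub>\<infinity>i\<in>I. cinner (blinfun_apply T (G i x)) (G i y))"
proof (rule sesquilinear_form_operator[where K = "norm T"])
  fix x x' y y' c
  show "(\<Sum>\<^sub>\<infinity>i\<in>I. cinner (blinfun_apply T (G i (x + x'))) (G i y))
      = (\<Sum>\<^sub>\<infinity>i\<in>I. cinner (blinfun_apply T (G i x)) (G i y)) + (\<Sum>\<^sub>\<infinity>i\<in>I. cinner (blinfun_apply T (G i x')) (G i y))"
    by (subst infsum_add[symmetric]) (auto intro!: term_summable infsum_cong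
        simp: G_add blinfun.add_right cinner_add_left)
  show "(\<Sum>\<^sub>\<infinity>i\<in>I. cinner (blinfun_apply T (G i x)) (G i (y + y')))
      = (\<Sum>\<^sub>\<infinity>i\<in>I. cinner (blinfun_apply T (G i x)) (G i y)) + (\<Sum>\<^sub>\<infinity>i\<in>I. cinner (blinfun_apply T (G i x)) (G i y'))"
    by (subst infsum_add[symmetric]) (auto intro!: term_summable infsum_cong
        simp: G_add blinfun.add_right cinner_add_right)
  show "(\<Sum>\<^sub>\<infinity>i\<in>I. cinner (blinfun_apply T (G i (c *\<^sub>C x))) (G i y)) = c * (\<Sum>\<^sub>\<infinity>i\<in>I. cinner (blinfun_apply T (G i x)) (G i y))"
    by (subst infsum_cmult_right[symmetric]) (auto intro!: term_summable infsum_cong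
        simp: G_scaleC BH_scaleC[OF T] cinner_scaleC_left)
  show "(\<Sum>\<^sub>\<infinity>i\<in>I. cinner (blinfun_apply T (G i x)) (G i (c *\<^sub>C y))) = cnj c * (\<Sum>\<^sub>\<infinity>i\<in>I. cinner (blinfun_apply T (G i x)) (G i y))"
    by (subst infsum_cmult_right[symmetric]) (auto intro!: term_summable infsum_cong
        simp: G_scaleC BH_scaleC[OF T] cinner_scaleC_right)
  have "((\<lambda>F. cmod (\<Sum>i\<in>F. cinner (blinfun_apply T (G i x)) (G i y))) \<longlongrightarrow>
      cmod (\<Sum>\<^sub>\<infinity>i\<in>I. cinner (blinfun_apply T (G i x)) (G i y))) (finite_subsets_at_top I)"
    by (intro tendsto_norm infsum_tendsto term_summable)
  then show "cmod (\<Sum>\<^sub>\<infinity>i\<in>I. cinner (blinfun_apply T (G i x)) (G i y)) \<le> norm T * norm x * norm y"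
    by (rule tendsto_upperbound)
      (auto intro!: eventually_finite_subsets_at_top_weakI term_sum_bound)
qed

text \<open>The map \<open>T \<mapsto> \<Sum>i. G_i* T G_i\<close>, read off from its sesquilinear
  form so that convergence is only a matter of scalar sums. The form determines the chosen
  operator.\<close>

definition kraus_map :: "('a \<Rightarrow>\<^sub>L 'a) \<Rightarrow> ('a \<Rightarrow>\<^sub>L 'a)" where
  "kraus_map T = (SOME S. S \<in> BH \<and> (\<forall>x y. cinner (blinfun_apply S x) y
     = (\<Sum>\<^sub>\<infinity>i\<in>I. cinner (blinfun_apply T (G i x)) (G i y))))"

lemma kraus_map_BH: "T \<in> BH \<Longrightarrow> kraus_map T \<in> BH"
  and kraus_map_infsum:
    "T \<in> BH \<Longrightarrow> cinner (blinfun_apply (kraus_map T) x) y = (\<Sum>\<^sub>\<infinity>i\<in>I. cinner (blinfun_apply T (G i x)) (G i y))"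
  using someI_ex[OF kraus_operator_exists[of T, unfolded Bex_def]] by (auto simp: kraus_map_def)

lemma kraus_map_has_sum:
  "T \<in> BH \<Longrightarrow> ((\<lambda>i. cinner (blinfun_apply T (G i x)) (G i y)) has_sum cinner (blinfun_apply (kraus_map T) x) y) I"
  by (simp add: kraus_map_infsum term_summable)

text \<open>Normality of the Kraus map: the double sum over \<open>n\<close> and \<open>i\<close>
  converges absolutely and can be flattened into one sequence. The new vectors depend on
  \<open>x\<close> and \<open>y\<close> but not on \<open>T\<close>.\<close>

lemma kraus_map_transfer:
  assumes x: "summable (\<lambda>n::nat. (norm (x n))\<^sup>2)" and y: "summable (\<lambda>n. (norm (y n))\<^sup>2)"
  shows "\<exists>x' y'. summable (\<lambda>n::nat. (norm (x' n))\<^sup>2) \<and> summable (\<lambda>n. (norm (y' n))\<^sup>2) \<and>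
        (\<forall>T\<in>BH. (\<Sum>n. cinner (blinfun_apply (kraus_map T) (x n)) (y n)) = (\<Sum>n. cinner (T (x' n)) (y' n)))"
proof -
  define A where "A = (UNIV :: nat set) \<times> I"
  \<comment> \<open>Countable, because a summable family of nonnegative reals has countable support;
    an injection into the naturals supplies the enumeration.\<close>
  define J where "J = (SIGMA n:UNIV. {i\<in>I. G i (x n) \<noteq> 0 \<or> G i (y n) \<noteq> 0})"
  have "countable {i\<in>I. G i z \<noteq> 0}" for z
    using summable_countable_real[OF has_sum_imp_summable[OF G_norm[of z]]] by simp
  then have "countable ({i\<in>I. G i (x n) \<noteq> 0} \<union> {i\<in>I. G i (y n) \<noteq> 0})" for n by blast
  moreover have "{i\<in>I. G i (x n) \<noteq> 0} \<union> {i\<in>I. G i (y n) \<noteq> 0}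
      = {i\<in>I. G i (x n) \<noteq> 0 \<or> G i (y n) \<noteq> 0}" for n by blast
  ultimately have "countable J" unfolding J_def by (intro countable_SIGMA) auto
  then obtain h :: "nat \<times> 'i \<Rightarrow> nat" where "inj_on h J" by (auto simp: countable_def)
  then have \<psi>: "bij_betw (the_inv_into J h) (h ` J) J"
    by (simp add: bij_betw_the_inv_into inj_on_imp_bij_betw)
  define K \<psi> where "K = h ` J" and "\<psi> = the_inv_into J h"
  note \<psi> = \<psi>[folded K_def \<psi>_def]
  have "J \<subseteq> A" by (auto simp: A_def J_def)
  note support = has_sum_countable_support[OF \<psi> \<open>J \<subseteq> A\<close>]
  define flat where "flat z k = (if k \<in> K then G (snd (\<psi> k)) (z (fst (\<psi> k))) else 0)" for z k
  have sq: "(\<lambda>j. (norm (G (snd j) (z (fst j))))\<^sup>2) summable_on A"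
    if z: "summable (\<lambda>n. (norm (z n))\<^sup>2)" for z
    unfolding A_def
  proof (rule summable_on_SigmaI)
    show "((\<lambda>i. (norm (G (snd (n, i)) (z (fst (n, i)))))\<^sup>2) has_sum (norm (z n))\<^sup>2) I" for n
      using G_norm by simp
    show "(\<lambda>n. (norm (z n))\<^sup>2) summable_on UNIV"
      using z by (simp add: summable_on_UNIV_nonneg_real_iff)
  qed simp
  have flat_summable: "summable (\<lambda>k. (norm (flat z k))\<^sup>2)"
    if z: "summable (\<lambda>n. (norm (z n))\<^sup>2)" "z = x \<or> z = y" for z
  proof -
    have "((\<lambda>k. if k \<in> K then (norm (G (snd (\<psi> k)) (z (fst (\<psi> k)))))\<^sup>2 else 0) has_sum
        (\<Sum>\<^sub>\<infinity>j\<in>A. (norm (G (snd j) (z (fst j))))\<^sup>2)) UNIV"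
      using sq[OF z(1)] z(2) by (subst support) (auto simp: A_def J_def)
    then have "summable (\<lambda>k. if k \<in> K then (norm (G (snd (\<psi> k)) (z (fst (\<psi> k)))))\<^sup>2 else 0)"
      using has_sum_imp_sums sums_summable by blast
    then show ?thesis by (simp add: flat_def if_distrib[of "\<lambda>u. (norm u)\<^sup>2"] cong: if_cong)
  qed
  have "(\<Sum>n. cinner (blinfun_apply (kraus_map T) (x n)) (y n)) = (\<Sum>n. cinner (T (flat x n)) (flat y n))"
    if T: "T \<in> BH" for T
  proof -
    define F where "F j = cinner (blinfun_apply T (G (snd j) (x (fst j)))) (G (snd j) (y (fst j)))" for j
    have "F summable_on A"
    proof (rule abs_summable_summable, rule Infinite_Sum.abs_summable_on_comparison_test')
      show "(\<lambda>j. norm T * ((norm (G (snd j) (x (fst j))))\<^sup>2 + (norm (G (snd j) (y (fst j))))\<^sup>2)) summable_on A"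
        by (intro summable_on_cmult_right summable_on_add sq x y)
    qed (simp add: F_def norm_term_le)
    then have F: "(F has_sum infsum F A) A" by simp
    have "((\<lambda>n. cinner (blinfun_apply (kraus_map T) (x n)) (y n)) has_sum infsum F A) UNIV"
      using F unfolding A_def
      by (rule has_sum_SigmaD) (use kraus_map_has_sum[OF T] in \<open>simp add: F_def\<close>)
    then have 1: "(\<lambda>n. cinner (blinfun_apply (kraus_map T) (x n)) (y n)) sums infsum F A" by (rule has_sum_imp_sums)
    have "((\<lambda>k. if k \<in> K then F (\<psi> k) else 0) has_sum infsum F A) UNIV"
      using F by (subst support) (auto simp: A_def J_def F_def blinfun.zero_right)
    then have "(\<lambda>k. if k \<in> K then F (\<psi> k) else 0) sums infsum F A" by (rule has_sum_imp_sums)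
    moreover have "(\<lambda>k. if k \<in> K then F (\<psi> k) else 0) = (\<lambda>k. cinner (T (flat x k)) (flat y k))"
      by (auto simp: flat_def F_def)
    ultimately show ?thesis using 1 by (metis sums_unique)
  qed
  then show ?thesis using flat_summable x y by blast
qed

lemma kraus_map_add: "S \<in> BH \<Longrightarrow> T \<in> BH \<Longrightarrow> kraus_map (S + T) = kraus_map S + kraus_map T"
proof (intro blinfun_eqI cinner_eqI)
  fix x y assume ST: "S \<in> BH" "T \<in> BH"
  have "((\<lambda>i. cinner ((S + T) (G i x)) (G i y)) has_sum
      (cinner (blinfun_apply (kraus_map S) x) y + cinner (blinfun_apply (kraus_map T) x) y)) I"
    unfolding blinfun.add_left cinner_add_left by (intro has_sum_add kraus_map_has_sum ST)
  moreover have "((\<lambda>i. cinner ((S + T) (G i x)) (G i y)) has_sum cinner (kraus_map (S + T) x) y) I"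
    by (intro kraus_map_has_sum BH_closed_ops ST)
  ultimately show "cinner (kraus_map (S + T) x) y = cinner ((kraus_map S + kraus_map T) x) y"
    using has_sum_unique by (fastforce simp: blinfun.add_left cinner_add_left)
qed

lemma kraus_map_scaleC: "T \<in> BH \<Longrightarrow> kraus_map (scaleC_op c T) = scaleC_op c (kraus_map T)"
proof (intro blinfun_eqI cinner_eqI)
  fix x y assume T: "T \<in> BH"
  have "((\<lambda>i. cinner (scaleC_op c T (G i x)) (G i y)) has_sum c * cinner (blinfun_apply (kraus_map T) x) y) I"
    unfolding scaleC_op.rep_eq cinner_scaleC_left by (intro has_sum_cmult_right kraus_map_has_sum T)
  moreover have "((\<lambda>i. cinner (scaleC_op c T (G i x)) (G i y)) has_sum cinner (kraus_map (scaleC_op c T) x) y) I"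
    by (intro kraus_map_has_sum BH_closed_ops T)
  ultimately show "cinner (kraus_map (scaleC_op c T) x) y = cinner (scaleC_op c (kraus_map T) x) y"
    using has_sum_unique by (fastforce simp: scaleC_op.rep_eq cinner_scaleC_left)
qed

lemma kraus_map_positive:
  assumes T: "T \<in> BH" "positive_op T" shows "positive_op (kraus_map T)"
  unfolding positive_op_def
proof
  fix x
  note s = kraus_map_has_sum[OF T(1), of x x]
  have "((\<lambda>i. Im (cinner (blinfun_apply T (G i x)) (G i x))) has_sum Im (cinner (blinfun_apply (kraus_map T) x) x)) I"
    using s by (rule has_sum_Im)
  then have "Im (cinner (blinfun_apply (kraus_map T) x) x) = 0"
    using T(2) by (simp add: positive_op_def) (metis has_sum_0_simp has_sum_unique)
  moreover have "0 \<le> Re (cinner (blinfun_apply (kraus_map T) x) x)"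
    using has_sum_Re[OF s] by (rule has_sum_nonneg) (use T(2) in \<open>simp add: positive_op_def\<close>)
  ultimately show "Im (cinner (blinfun_apply (kraus_map T) x) x) = 0 \<and> 0 \<le> Re (cinner (blinfun_apply (kraus_map T) x) x)" by simp
qed

end

section \<open>Normal characters and vector states\<close>

lemma subspace_closure:
  fixes L :: "'a :: real_normed_vector set"
  assumes "subspace L" shows "subspace (closure L)"
  unfolding subspace_def
proof safe
  show "0 \<in> closure L" using assms closure_subset subspace_0 by blast
next
  fix x y assume "x \<in> closure L" "y \<in> closure L"
  then obtain f g where f: "\<And>n. f n \<in> L" "f \<longlonglongrightarrow> x" and g: "\<And>n. g n \<in> L" "g \<longlonglongrightarrow> y"
    unfolding closure_sequential by blast
  have "(\<lambda>n. f n + g n) \<longlonglongrightarrow> x + y" by (intro tendsto_add f g)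
  moreover have "f n + g n \<in> L" for n by (intro subspace_add assms f g)
  ultimately show "x + y \<in> closure L"
    unfolding closure_sequential by (intro exI[of _ "\<lambda>n. f n + g n"]) simp
next
  fix c :: real and x assume "x \<in> closure L"
  then obtain f where f: "\<And>n. f n \<in> L" "f \<longlonglongrightarrow> x" unfolding closure_sequential by blast
  have "(\<lambda>n. c *\<^sub>R f n) \<longlonglongrightarrow> c *\<^sub>R x" by (intro tendsto_intros f)
  moreover have "c *\<^sub>R f n \<in> L" for n by (intro subspace_scale assms f)
  ultimately show "c *\<^sub>R x \<in> closure L"
    unfolding closure_sequential by (intro exI[of _ "\<lambda>n. c *\<^sub>R f n"]) simp
qed

locale normal_bimodule_homomorphism = vn_algebra D
  for D :: "('a :: complex_hilbert \<Rightarrow>\<^sub>L 'a) set" +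
  fixes A :: "('a \<Rightarrow>\<^sub>L 'a) set" and \<Phi> :: "('a \<Rightarrow>\<^sub>L 'a) \<Rightarrow> ('a \<Rightarrow>\<^sub>L 'a)"
  assumes subalg: "subalgebra_BH A" and D_sub: "D \<subseteq> A" and \<Phi>_range: "\<Phi> ` A \<subseteq> D"
    and hom: "homomorphism_on A \<Phi>" and \<Phi>_id: "\<Phi> id_blinfun = id_blinfun"
    and cont: "continuous_map (weak_star A) (weak_star D) \<Phi>"
    and bimod: "bimodule_map_on D A \<Phi>"
begin

lemma A_add: "S \<in> A \<Longrightarrow> T \<in> A \<Longrightarrow> S + T \<in> A"
  and A_scaleC: "T \<in> A \<Longrightarrow> scaleC_op c T \<in> A"
  and A_compose: "S \<in> A \<Longrightarrow> T \<in> A \<Longrightarrow> S o\<^sub>L T \<in> A"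
  and A_zero: "0 \<in> A"
  and A_BH: "T \<in> A \<Longrightarrow> T \<in> BH"
  and D_A: "d \<in> D \<Longrightarrow> d \<in> A"
  using subalg D_sub by (auto simp: subalgebra_BH_def)

lemma A_diff: "S \<in> A \<Longrightarrow> T \<in> A \<Longrightarrow> S - T \<in> A"
  by (metis A_add A_scaleC scaleC_minus_one_op diff_conv_add_uminus)

lemma \<Phi>_D: "a \<in> A \<Longrightarrow> \<Phi> a \<in> D"
  using \<Phi>_range by blast

lemma \<Phi>_add: "S \<in> A \<Longrightarrow> T \<in> A \<Longrightarrow> \<Phi> (S + T) = \<Phi> S + \<Phi> T"
  and \<Phi>_scaleC: "T \<in> A \<Longrightarrow> \<Phi> (scaleC_op c T) = scaleC_op c (\<Phi> T)"
  and \<Phi>_compose: "S \<in> A \<Longrightarrow> T \<in> A \<Longrightarrow> \<Phi> (S o\<^sub>L T) = \<Phi> S o\<^sub>L \<Phi> T"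
  using hom by (auto simp: homomorphism_on_def clinear_map_on_def)

lemma \<Phi>_diff: "S \<in> A \<Longrightarrow> T \<in> A \<Longrightarrow> \<Phi> (S - T) = \<Phi> S - \<Phi> T"
  using \<Phi>_add[of "S - T" T] by (simp add: A_diff)

lemma \<Phi>_bimodule: "a \<in> A \<Longrightarrow> c \<in> D \<Longrightarrow> d \<in> D \<Longrightarrow> \<Phi> (c o\<^sub>L a o\<^sub>L d) = c o\<^sub>L \<Phi> a o\<^sub>L d"
  using bimod by (auto simp: bimodule_map_on_def)

lemma \<Phi>_id_on_D:
  assumes "d \<in> D" shows "\<Phi> d = d"
proof -
  have "d o\<^sub>L id_blinfun o\<^sub>L id_blinfun = d" by (rule blinfun_eqI) simp
  then show ?thesis
    using \<Phi>_bimodule[OF D_A[OF id_mem] assms id_mem] by (simp add: \<Phi>_id)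
qed

text \<open>Continuity at zero of one vector functional of \<Phi>. The bound \<open>1\<close> is
  chosen to be contradicted at an element sent to \<open>e\<close>, whose value at a unit vector of
  its range is exactly \<open>1\<close>.\<close>

lemma \<Phi>_continuity:
  "\<exists>x \<delta>. summable (\<lambda>n::nat. (norm (x n))\<^sup>2) \<and> \<delta> > 0 \<and>
    (\<forall>T\<in>A. (\<Sum>n. (norm (blinfun_apply T (x n)))\<^sup>2) < \<delta> \<longrightarrow> cmod (cinner (\<Phi> T v) v) < 1)"
proof -
  \<comment> \<open>A sequence with one nonzero entry exhibits a vector functional as one of those
    defining the topology.\<close>
  define w :: "nat \<Rightarrow> 'a" where "w n = (if n = 0 then v else 0)" for n
  have sum_w: "(\<Sum>n. cinner (blinfun_apply T (w n)) (w n)) = cinner (T v) v" for T :: "'a \<Rightarrow>\<^sub>L 'a"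
    using suminf_finite[of "{0::nat}" "\<lambda>n. cinner (T (w n)) (w n)"] by (simp add: w_def)
  have w: "summable (\<lambda>n. (norm (w n))\<^sup>2)"
    by (rule summable_finite[of "{0}"]) (auto simp: w_def)
  define V where "V = {T. (\<Sum>n. cinner (blinfun_apply T (w n)) (w n)) \<in> ball 0 1}"
  have "openin ultraweak V"
    unfolding ultraweak_def V_def using w by (intro topology_generated_by_Basis) blast
  then have "openin (weak_star D) (V \<inter> D)"
    unfolding weak_star_def openin_subtopology by blast
  then have "openin (weak_star A) {T \<in> A. \<Phi> T \<in> V \<inter> D}"
    using openin_continuous_map_preimage[OF cont, of "V \<inter> D"] by (simp only: topspace_weak_star)
  then obtain U where U: "openin ultraweak U" "{T \<in> A. \<Phi> T \<in> V \<inter> D} = U \<inter> A"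
    unfolding weak_star_def openin_subtopology by blast
  have "\<Phi> 0 = 0" using \<Phi>_id_on_D[OF zero_mem] .
  then have "0 \<in> {T \<in> A. \<Phi> T \<in> V \<inter> D}" using A_zero zero_mem by (simp add: V_def)
  then have "0 \<in> U" unfolding U(2) by blast
  from ultrastrong_nbhd[OF U(1) this, unfolded diff_0_right] obtain x \<delta> where
    x: "summable (\<lambda>n::nat. (norm (x n))\<^sup>2)" "\<delta> > 0"
      "\<And>T. (\<Sum>n. (norm (blinfun_apply T (x n)))\<^sup>2) < \<delta> \<Longrightarrow> T \<in> U" by blast
  moreover have "cmod (cinner (\<Phi> T v) v) < 1" if "T \<in> A" "T \<in> U" for T
  proof -
    have "T \<in> {T \<in> A. \<Phi> T \<in> V \<inter> D}" unfolding U(2) using that by blast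
    then show ?thesis by (simp add: V_def sum_w)
  qed
  ultimately show ?thesis by blast
qed

text \<open>On \<open>eAe\<close> the homomorphism is a normal character, and \<open>J\<close> is its kernel. Removing from a
  vector \<open>\<xi>\<close> implementing the character its component in the closure of \<open>J\<xi>\<close> turns it into one
  that implements the character as a vector state, because \<open>J\<close> is an ideal (Hoffman and Rossi).\<close>

lemma minimal_vector_state:
  assumes e: "minimal_projection D e"
  shows "\<exists>\<zeta> :: nat \<Rightarrow> 'a. (\<forall>n. e (\<zeta> n) = \<zeta> n) \<and> (\<lambda>n. (norm (\<zeta> n))\<^sup>2) sums 1 \<and>
    (\<forall>a\<in>A. \<forall>u. e u = u \<longrightarrow>
      (\<lambda>n. cinner (blinfun_apply a (\<zeta> n)) (\<zeta> n) * (norm u)\<^sup>2) sums cinner (\<Phi> a u) u)"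
proof -
  note ep = minimal_projectionD[OF e]
  obtain z where "e z \<noteq> 0" using ep(4) by (metis blinfun_eqI blinfun.zero_left)
  define v where "v = (1 / norm (e z)) *\<^sub>R e z"
  have v: "e v = v" "norm v = 1" using \<open>e z \<noteq> 0\<close> by (simp_all add: v_def blinfun.scaleR_right ep)
  obtain x \<delta> where x: "summable (\<lambda>n::nat. (norm (x n))\<^sup>2)" "\<delta> > 0"
    "\<And>T. T \<in> A \<Longrightarrow> (\<Sum>n. (norm (blinfun_apply T (x n)))\<^sup>2) < \<delta> \<Longrightarrow> cmod (cinner (\<Phi> T v) v) < 1"
    using \<Phi>_continuity[of v] by blast
  \<comment> \<open>Compressed by \<open>e\<close> so that, for \<open>c\<close> in
    \<open>J\<close>, the vector \<open>\<xi> - c \<xi>\<close> has the coordinates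
    \<open>(e - c) (x n)\<close> that the continuity estimate controls.\<close>
  define \<xi> where "\<xi> = Abs_l2 (\<lambda>n. e (x n))"
  have \<xi>: "l2_nth \<xi> = (\<lambda>n. e (x n))"
    unfolding \<xi>_def by (intro l2_nth_Abs summable_norm_blinfun_power2 x)
  define J where "J = {c\<in>A. (\<forall>y. e (c y) = c y) \<and> (\<forall>y. c (e y) = c y) \<and> \<Phi> c = 0}"
  define L where "L = (\<lambda>c. l2_map c \<xi>) ` J"
  have J_add: "c + c' \<in> J" if "c \<in> J" "c' \<in> J" for c c'
    using that by (simp add: J_def A_add \<Phi>_add blinfun.add_left blinfun.add_right)
  have J_scaleC: "scaleC_op k c \<in> J" if "c \<in> J" for k c
    using that by (auto simp: J_def A_scaleC \<Phi>_scaleC scaleC_op.rep_eq scaleC_apply[OF ep(1)]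
        blinfun.zero_left scaleC_zero_right intro!: blinfun_eqI)
  have scaleR_op: "r *\<^sub>R c = scaleC_op (complex_of_real r) c" for r and c :: "'a \<Rightarrow>\<^sub>L 'a"
    by (rule blinfun_eqI) (simp add: scaleC_op.rep_eq blinfun.scaleR_left scaleR_scaleC)
  have J_compose: "c o\<^sub>L c' \<in> J" if "c \<in> J" "c' \<in> J" for c c'
    using that by (simp add: J_def A_compose \<Phi>_compose)
  have J_zero: "0 \<in> J" using \<Phi>_id_on_D[OF zero_mem] by (simp add: J_def A_zero blinfun.zero_left blinfun.zero_right)
  have "subspace L"
    unfolding subspace_def
  proof (intro conjI ballI allI)
    have "l2_map 0 \<xi> = 0" by (rule l2_eqI) (simp add: blinfun.zero_left)
    then show "0 \<in> L" unfolding L_def using J_zero by (metis image_eqI)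
  next
    fix s t assume "s \<in> L" "t \<in> L"
    then obtain c c' where c: "c \<in> J" "c' \<in> J" "s = l2_map c \<xi>" "t = l2_map c' \<xi>"
      by (auto simp: L_def)
    have "s + t = l2_map (c + c') \<xi>" unfolding c by (rule l2_eqI) (simp add: blinfun.add_left)
    then show "s + t \<in> L" unfolding L_def using J_add[OF c(1,2)] by blast
  next
    fix r s assume "s \<in> L"
    then obtain c where c: "c \<in> J" "s = l2_map c \<xi>" by (auto simp: L_def)
    have "r *\<^sub>R s = l2_map (r *\<^sub>R c) \<xi>" unfolding c by (rule l2_eqI) (simp add: blinfun.scaleR_left)
    then show "r *\<^sub>R s \<in> L" unfolding L_def using J_scaleC[OF c(1)] by (simp add: scaleR_op)
  qed
  then obtain p where p: "p \<in> closure L" "\<And>s. s \<in> closure L \<Longrightarrow> inner (\<xi> - p) s = 0"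
    using closed_projection_exists[OF closed_closure subspace_closure] by metis
  define \<eta> where "\<eta> = \<xi> - p"
  have cont_map: "continuous_on S (l2_map T)" for S and T :: "'a \<Rightarrow>\<^sub>L 'a"
    by (rule linear_continuous_on[OF bounded_linear_l2_map])
  \<comment> \<open>If some \<open>c \<xi>\<close> came close to \<xi>, then \<open>e - c\<close>
    would be small at the test sequence, although \<Phi> sends it to \<open>e\<close>.\<close>
  have "\<xi> \<notin> closure L"
  proof
    assume "\<xi> \<in> closure L"
    then obtain y where "y \<in> L" "dist y \<xi> < sqrt \<delta>"
      using x(2) unfolding closure_approachable by (meson real_sqrt_gt_zero)
    then obtain c where c: "c \<in> J" "norm (\<xi> - l2_map c \<xi>) < sqrt \<delta>"
      by (auto simp: L_def dist_norm norm_minus_commute)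
    have "(norm (\<xi> - l2_map c \<xi>))\<^sup>2 < \<delta>"
      using power_strict_mono[OF c(2) norm_ge_zero, of 2] x(2) by simp
    moreover have "l2_nth (\<xi> - l2_map c \<xi>) n = (e - c) (x n)" for n
      using c(1) by (simp add: \<xi> J_def blinfun.diff_left)
    ultimately have "(\<Sum>n. (norm ((e - c) (x n)))\<^sup>2) < \<delta>"
      using sums_unique[OF l2_norm_sums[of "\<xi> - l2_map c \<xi>"]] by simp
    then have "cmod (cinner (\<Phi> (e - c) v) v) < 1"
      using c(1) ep(1) by (intro x(3)) (auto simp: J_def A_diff D_A)
    moreover have "\<Phi> (e - c) = e"
      using c(1) ep(1) by (simp add: J_def \<Phi>_diff D_A \<Phi>_id_on_D)
    ultimately show False using v by (simp add: cinner_self)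
  qed
  then have "\<eta> \<noteq> 0" using p(1) by (auto simp: \<eta>_def)
  have J_closure: "l2_map c s \<in> closure L" if c: "c \<in> J" and s: "s \<in> closure L" for c s
  proof -
    have "l2_map c t \<in> L" if t: "t \<in> L" for t
    proof -
      obtain c' where c': "c' \<in> J" "t = l2_map c' \<xi>" using t by (auto simp: L_def)
      have "l2_map c t = l2_map (c o\<^sub>L c') \<xi>" unfolding c' by (rule l2_eqI) simp
      then show ?thesis unfolding L_def using J_compose[OF c c'(1)] by blast
    qed
    then have "l2_map c ` closure L \<subseteq> closure L"
      using closure_subset by (intro image_closure_subset cont_map closed_closure) blast
    then show ?thesis using s by blast
  qed
  \<comment> \<open>Multiplicativity of \<Phi> enters through \<open>J_compose\<close>: since
    \<open>J\<close> is closed under products, \<open>c\<close> maps the closure of \<open>L\<close>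
    into itself. Thus \<open>c \<eta> = c \<xi> - c p\<close> lies in that closure, to which \<eta>
    is orthogonal.\<close>
  have J_\<eta>: "inner (l2_map c \<eta>) \<eta> = 0" if c: "c \<in> J" for c
  proof -
    interpret bounded_linear "l2_map c" by (rule bounded_linear_l2_map)
    have "l2_map c \<xi> \<in> closure L" using c closure_subset by (fastforce simp: L_def)
    then have "l2_map c \<xi> - l2_map c p \<in> closure L"
      by (intro subspace_diff[OF subspace_closure] \<open>subspace L\<close> J_closure[OF c p(1)])
    then have "inner (\<xi> - p) (l2_map c \<xi> - l2_map c p) = 0" by (rule p(2))
    then show ?thesis by (simp add: \<eta>_def diff inner_commute)
  qed
  have e_\<eta>: "e (l2_nth \<eta> n) = l2_nth \<eta> n" for n
  proof -
    have "L \<subseteq> {t. l2_map e t = t}" by (auto simp: L_def J_def intro!: l2_eqI)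
    moreover have "closed {t. l2_map e t = t}"
      by (intro closed_Collect_eq cont_map continuous_on_id)
    ultimately have "closure L \<subseteq> {t. l2_map e t = t}" by (rule closure_minimal)
    then have "l2_map e p = p" using p(1) by blast
    moreover have "l2_map e \<xi> = \<xi>" by (rule l2_eqI) (simp add: \<xi> ep)
    ultimately have "l2_map e \<eta> = \<eta>"
      using linear_diff[OF bounded_linear.linear[OF bounded_linear_l2_map], of e \<xi> p]
      by (simp add: \<eta>_def)
    then show ?thesis by (metis l2_nth_map)
  qed
  have J_sums: "(\<lambda>n. cinner (c (l2_nth \<eta> n)) (l2_nth \<eta> n)) sums 0" if c: "c \<in> J" for c
  proof -
    have "(\<lambda>n. inner (l2_nth (l2_map c \<eta>) n) (l2_nth \<eta> n)) sums 0"
      using l2_inner_sums[of "l2_map c \<eta>" \<eta>] J_\<eta>[OF c] by simp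
    \<comment> \<open>The real inner product sees only real parts; multiplying \<open>c\<close> by
      \<open>- \<i>\<close> stays in \<open>J\<close> and brings out the imaginary part.\<close>
    moreover have "(\<lambda>n. inner (l2_nth (l2_map (scaleC_op (- \<i>) c) \<eta>) n) (l2_nth \<eta> n)) sums 0"
      using l2_inner_sums[of "l2_map (scaleC_op (- \<i>) c) \<eta>" \<eta>] J_\<eta>[OF J_scaleC[OF c]] by simp
    ultimately show ?thesis
      by (simp add: sums_complex_iff inner_eq_Re_cinner scaleC_op.rep_eq cinner_scaleC_left)
  qed
  define \<zeta> where "\<zeta> n = (1 / norm \<eta>) *\<^sub>R l2_nth \<eta> n" for n
  have scaled: "cinner (blinfun_apply T (\<zeta> n)) (\<zeta> n)
      = of_real (1 / (norm \<eta>)\<^sup>2) * cinner (T (l2_nth \<eta> n)) (l2_nth \<eta> n)" for T :: "'a \<Rightarrow>\<^sub>L 'a" and n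
    by (simp add: \<zeta>_def blinfun.scaleR_right cinner_scaleR_left cinner_scaleR_right power2_eq_square)
  have e\<zeta>: "e (\<zeta> n) = \<zeta> n" for n by (simp add: \<zeta>_def blinfun.scaleR_right e_\<eta>)
  have \<zeta>1: "(\<lambda>n. (norm (\<zeta> n))\<^sup>2) sums 1"
    using sums_mult[OF l2_norm_sums[of \<eta>], of "1 / (norm \<eta>)\<^sup>2"] \<open>\<eta> \<noteq> 0\<close>
    by (simp add: \<zeta>_def power_divide)
  have "(\<lambda>n. cinner (blinfun_apply a (\<zeta> n)) (\<zeta> n) * (norm u)\<^sup>2) sums cinner (\<Phi> a u) u"
    if a: "a \<in> A" and u: "e u = u" for a u
  proof -
    obtain k where k: "\<And>y. e (\<Phi> a (e y)) = k *\<^sub>C e y"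
      using minimal_compress_scalar[OF e \<Phi>_D[OF a]] by blast
    \<comment> \<open>Subtracting the value of the character puts the compressed element into the
      kernel \<open>J\<close>; vanishing of the vector state there gives its value at
      \<open>a\<close>.\<close>
    define c where "c = (e o\<^sub>L a o\<^sub>L e) - scaleC_op k e"
    have eae: "e o\<^sub>L a o\<^sub>L e \<in> A" by (intro A_compose D_A ep a)
    have "c \<in> J"
    proof -
      have "\<Phi> c = (e o\<^sub>L \<Phi> a o\<^sub>L e) - scaleC_op k e"
        unfolding c_def using eae ep(1) a
        by (simp add: \<Phi>_diff A_scaleC D_A \<Phi>_scaleC \<Phi>_id_on_D \<Phi>_bimodule)
      also have "\<dots> = 0"
        by (rule blinfun_eqI) (simp add: blinfun.diff_left scaleC_op.rep_eq k blinfun.zero_left)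
      finally show ?thesis
        using eae ep(1) ep(2) scaleC_apply[OF ep(1)]
        by (auto simp: J_def c_def A_diff A_scaleC D_A blinfun.diff_left blinfun.diff_right scaleC_op.rep_eq)
    qed
    from sums_mult[OF J_sums[OF this], of "of_real (1 / (norm \<eta>)\<^sup>2)"]
    have "(\<lambda>n. cinner (c (\<zeta> n)) (\<zeta> n)) sums 0" by (simp only: scaled mult_zero_right)
    moreover have "cinner (c (\<zeta> n)) (\<zeta> n) = cinner (a (\<zeta> n)) (\<zeta> n) - k * of_real ((norm (\<zeta> n))\<^sup>2)" for n
      using adjoint_shift[OF ep(3), of "a (\<zeta> n)" "\<zeta> n"]
      by (simp add: c_def blinfun.diff_left scaleC_op.rep_eq e\<zeta> cinner_diff_left cinner_scaleC_left cinner_self)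
    ultimately have "(\<lambda>n. cinner (a (\<zeta> n)) (\<zeta> n) - k * of_real ((norm (\<zeta> n))\<^sup>2)) sums 0" by simp
    moreover have "(\<lambda>n. k * complex_of_real ((norm (\<zeta> n))\<^sup>2)) sums (k * of_real 1)"
      by (intro sums_mult sums_of_real \<zeta>1)
    ultimately have "(\<lambda>n. cinner (a (\<zeta> n)) (\<zeta> n)) sums k"
      using sums_add by fastforce
    then have "(\<lambda>n. cinner (a (\<zeta> n)) (\<zeta> n) * (norm u)\<^sup>2) sums (k * (norm u)\<^sup>2)" by (rule sums_mult2)
    moreover have "cinner (\<Phi> a u) u = k * (norm u)\<^sup>2"
      using adjoint_shift[OF ep(3), of "\<Phi> a u" u] k[of u] u
      by (simp add: cinner_scaleC_left cinner_self)
    ultimately show ?thesis by simp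
  qed
  then show ?thesis using e\<zeta> \<zeta>1 by blast
qed

end

section \<open>Cyclic decomposition over an atomic algebra\<close>

text \<open>Zorn's lemma for pairwise related sets. Maximality asks for both directions because
  \<open>R\<close> is arbitrary. It supplies the family of disjoint minimal projections and the
  orthonormal vectors.\<close>

lemma maximal_pairwise:
  "\<exists>S. S \<subseteq> X \<and> pairwise R S \<and> (\<forall>z\<in>X. (\<forall>s\<in>S. R s z) \<longrightarrow> (\<forall>s\<in>S. R z s) \<longrightarrow> z \<in> S)"
proof -
  have "\<exists>S\<in>{S. S \<subseteq> X \<and> pairwise R S}. \<forall>T\<in>{S. S \<subseteq> X \<and> pairwise R S}. S \<subseteq> T \<longrightarrow> T = S"
  proof (rule subset_Zorn_nonempty)
    show "{S. S \<subseteq> X \<and> pairwise R S} \<noteq> {}" by (auto intro!: exI[of _ "{}"])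
    fix C assume C: "C \<noteq> {}" "subset.chain {S. S \<subseteq> X \<and> pairwise R S} C"
    then have "chain\<^sub>\<subseteq> C" by (auto simp: subset_chain_def chain_subset_def)
    then have "pairwise R (\<Union>C)"
      using C(2) by (intro pairwise_chain_Union) (auto simp: subset_chain_def)
    then show "\<Union>C \<in> {S. S \<subseteq> X \<and> pairwise R S}" using C(2) by (auto simp: subset_chain_def)
  qed
  then obtain S where SA: "S \<in> {S. S \<subseteq> X \<and> pairwise R S}"
    and max: "\<forall>T\<in>{S. S \<subseteq> X \<and> pairwise R S}. S \<subseteq> T \<longrightarrow> T = S" by (rule bexE)
  then have S: "S \<subseteq> X" "pairwise R S" by simp_all
  have "z \<in> S" if "z \<in> X" "\<And>s. s \<in> S \<Longrightarrow> R s z" "\<And>s. s \<in> S \<Longrightarrow> R z s" for z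
  proof -
    have "pairwise R (insert z S)" using S(2) that(2,3) by (simp add: pairwise_insert)
    then have "insert z S = S" using max that(1) S(1) by (simp add: subset_insertI)
    then show ?thesis by blast
  qed
  with S show ?thesis by (intro exI[of _ S]) simp
qed

section \<open>The cyclic module generated by a unit vector under a minimal projection\<close>

context vn_algebra
begin

text \<open>The compression of \<open>d* c\<close> to \<open>e\<close> is a scalar. Consequently
  identities and norms checked at one unit vector of the range of \<open>e\<close> hold at all its
  vectors, which is what allows \<open>b\<close> to be replaced by \<zeta>.\<close>

lemma module_form:
  assumes e: "minimal_projection D e" and c: "c \<in> D" "d \<in> D"
  shows "\<exists>k. \<forall>u v. e u = u \<longrightarrow> e v = v \<longrightarrow> cinner (blinfun_apply c u) (blinfun_apply d v) = k * cinner u v"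
proof -
  obtain d' where d': "d' \<in> D" "is_adjoint d d'" by (rule adjoint_mem[OF c(2)])
  obtain k where k: "\<And>x. e ((d' o\<^sub>L c) (e x)) = k *\<^sub>C e x"
    using minimal_compress_scalar[OF e compose_mem[OF d'(1) c(1)]] by blast
  have "cinner (c u) (d v) = k * cinner u v" if "e u = u" "e v = v" for u v
  proof -
    have "cinner (c u) (d v) = cinner (d' (c u)) (e v)"
      using adjoint_shift[OF is_adjoint_sym[OF d'(2)], of "c u" v] that by simp
    also have "\<dots> = cinner (e (d' (c (e u)))) v"
      using adjoint_shift[OF minimal_projectionD(3)[OF e], of "d' (c u)" v] that by simp
    also have "\<dots> = k * cinner u v" using k[of u] that by (simp add: cinner_scaleC_left)
    finally show ?thesis .
  qed
  then show ?thesis by blast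
qed

lemma module_norm:
  assumes e: "minimal_projection D e" and c: "c \<in> D" and b: "e b = b" "norm b = 1" and u: "e u = u"
  shows "norm (c u) = norm (c b) * norm u"
proof -
  obtain k where k: "\<And>u v. e u = u \<Longrightarrow> e v = v \<Longrightarrow> cinner (c u) (c v) = k * cinner u v"
    using module_form[OF e c c] by blast
  have "of_real ((norm (c u))\<^sup>2) = k * of_real ((norm u)\<^sup>2)" "of_real ((norm (c b))\<^sup>2) = k"
    using k[OF u u] k[OF b(1) b(1)] b(2) by (simp_all add: cinner_self)
  then have "complex_of_real ((norm (c u))\<^sup>2) = of_real ((norm (c b) * norm u)\<^sup>2)"
    by (metis of_real_mult power_mult_distrib)
  then have "(norm (c u))\<^sup>2 = (norm (c b) * norm u)\<^sup>2" using of_real_eq_iff by blast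
  then show ?thesis by (rule power2_eq_imp_eq) auto
qed

lemma projection_norm_le:
  assumes "e o\<^sub>L e = e" "is_adjoint e e" shows "norm (blinfun_apply e x) \<le> norm x"
proof (cases "e x = 0")
  case False
  have "norm (e x) * norm (e x) = cmod (cinner (e x) x)"
    using adjoint_shift[OF assms(2), of "e x" x] idem_apply[OF assms(1), of x]
    by (simp add: cinner_self power2_eq_square norm_mult)
  also have "\<dots> \<le> norm (e x) * norm x" by (rule norm_cinner_le)
  finally show ?thesis using False by simp
qed simp

text \<open>Compressed to a minimal projection \<open>e\<close>, an operator norm is the length of the image of any
  unit vector \<open>b\<close> in the range of \<open>e\<close>. Hence \<open>Db\<close> is isometric to the norm closed space \<open>De\<close>.\<close>

lemma cyclic_subspace_closed:
  assumes e: "minimal_projection D e" and b: "e b = b" "norm b = 1"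
  shows "closed {blinfun_apply c b | c. c \<in> D}"
  unfolding closed_sequential_limits
proof safe
  note ep = minimal_projectionD[OF e]
  fix f l assume f: "\<forall>n::nat. f n \<in> {blinfun_apply c b | c. c \<in> D}" and l: "f \<longlonglongrightarrow> l"
  have "\<forall>n. \<exists>c. c \<in> D \<and> f n = blinfun_apply c b" using f by blast
  then obtain c where c: "\<And>n. c n \<in> D" "\<And>n. f n = c n b" by metis
  \<comment> \<open>The values at \<open>b\<close> control only \<open>c n\<close> restricted to the
    range of \<open>e\<close>; after this compression the operators themselves form a Cauchy
    sequence.\<close>
  define X where "X n = c n o\<^sub>L e" for n
  have X: "X n \<in> D" for n by (simp add: X_def compose_mem c ep)
  have Xd: "norm (X m - X n) \<le> norm (f m - f n)" for m n
  proof (rule norm_blinfun_bound)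
    fix x
    have "norm ((X m - X n) x) = norm ((c m - c n) (e x))" by (simp add: X_def blinfun.diff_left)
    also have "\<dots> = norm ((c m - c n) b) * norm (e x)"
      by (intro module_norm[OF e] diff_mem c b ep)
    also have "\<dots> \<le> norm (f m - f n) * norm x"
      by (simp add: c blinfun.diff_left mult_left_mono projection_norm_le ep)
    finally show "norm ((X m - X n) x) \<le> norm (f m - f n) * norm x" .
  qed simp
  have "Cauchy X"
  proof (rule CauchyI)
    fix r :: real assume "r > 0"
    then obtain N where "\<forall>m\<ge>N. \<forall>n\<ge>N. norm (f m - f n) < r"
      using CauchyD[OF LIMSEQ_imp_Cauchy[OF l]] by blast
    then show "\<exists>N. \<forall>m\<ge>N. \<forall>n\<ge>N. norm (X m - X n) < r" using Xd le_less_trans by blast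
  qed
  then obtain T where T: "X \<longlonglongrightarrow> T" by (auto simp: Cauchy_convergent_iff convergent_def)
  have "T \<in> D" by (rule limit_mem[OF T X])
  have "(\<lambda>n. X n b) \<longlonglongrightarrow> T b" by (rule blinfun_tendsto_apply[OF T])
  then have "f \<longlonglongrightarrow> T b" by (simp add: X_def b c(2)[abs_def])
  then have "l = T b" using l LIMSEQ_unique by blast
  then show "\<exists>c. l = blinfun_apply c b \<and> c \<in> D" using \<open>T \<in> D\<close> by blast
qed

text \<open>The vector \<open>c b\<close> is the orthogonal projection of \<open>x\<close> onto
  \<open>D b\<close>; the condition \<open>c e = c\<close> singles out one \<open>c\<close> among
  all those with the same value at \<open>b\<close>.\<close>

definition module_coeff :: "('a \<Rightarrow>\<^sub>L 'a) \<Rightarrow> 'a \<Rightarrow> 'a \<Rightarrow> ('a \<Rightarrow>\<^sub>L 'a)" where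
  "module_coeff e b x =
    (SOME c. c \<in> D \<and> c o\<^sub>L e = c \<and> (\<forall>d\<in>D. cinner (x - blinfun_apply c b) (blinfun_apply d b) = 0))"

context
  fixes e b assumes e: "minimal_projection D e" and b: "e b = b" "norm b = 1"
begin

lemma module_coeff:
  "module_coeff e b x \<in> D \<and> module_coeff e b x o\<^sub>L e = module_coeff e b x
    \<and> (\<forall>d\<in>D. cinner (x - blinfun_apply (module_coeff e b x) b) (blinfun_apply d b) = 0)"
proof -
  let ?S = "{blinfun_apply c b | c. c \<in> D}"
  have "csubspace ?S"
    unfolding csubspace_def
  proof (intro conjI ballI allI)
    show "0 \<in> ?S" using zero_mem blinfun.zero_left by (metis (mono_tags, lifting) mem_Collect_eq)
  next
    fix x y assume "x \<in> ?S" "y \<in> ?S"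
    then obtain c c' where "c \<in> D" "c' \<in> D" "x = c b" "y = c' b" by blast
    then show "x + y \<in> ?S"
      using add_mem by (intro CollectI exI[of _ "c + c'"]) (simp add: blinfun.add_left)
  next
    fix k x assume "x \<in> ?S"
    then obtain c where "c \<in> D" "x = c b" by blast
    then show "k *\<^sub>C x \<in> ?S"
      using scaleC_mem by (intro CollectI exI[of _ "scaleC_op k c"]) (simp add: scaleC_op.rep_eq)
  qed
  then obtain p where "p \<in> ?S" "\<forall>s\<in>?S. cinner (x - p) s = 0"
    using closed_csubspace_projection_exists[OF cyclic_subspace_closed[OF e b]] by blast
  then obtain c where c: "c \<in> D" "\<forall>d\<in>D. cinner (x - c b) (blinfun_apply d b) = 0" by blast
  have "c o\<^sub>L e \<in> D \<and> (c o\<^sub>L e) o\<^sub>L e = c o\<^sub>L e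
      \<and> (\<forall>d\<in>D. cinner (x - (c o\<^sub>L e) b) (blinfun_apply d b) = 0)"
    using c minimal_projectionD[OF e] b by (auto simp: compose_mem compose_assoc)
  then show ?thesis unfolding module_coeff_def by (rule someI)
qed

lemma module_coeff_mem: "module_coeff e b x \<in> D"
  and module_coeff_support: "module_coeff e b x o\<^sub>L e = module_coeff e b x"
  and module_coeff_orthogonal: "d \<in> D \<Longrightarrow> cinner (x - module_coeff e b x b) (blinfun_apply d b) = 0"
  using module_coeff[of x] by auto

lemma module_coeff_unique:
  assumes c: "c \<in> D" "c o\<^sub>L e = c" "\<And>d. d \<in> D \<Longrightarrow> cinner (x - c b) (blinfun_apply d b) = 0"
  shows "module_coeff e b x = c"
proof -
  let ?m = "module_coeff e b x"
  have D: "?m - c \<in> D" by (intro diff_mem module_coeff_mem c)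
  have "cinner ((?m - c) b) ((?m - c) b)
      = cinner (x - c b) ((?m - c) b) - cinner (x - ?m b) ((?m - c) b)"
    by (simp add: blinfun.diff_left flip: cinner_diff_left)
  also have "\<dots> = 0" using c(3)[OF D] module_coeff_orthogonal[OF D] by simp
  finally have 0: "(?m - c) b = 0" by (simp add: cinner_self)
  have "(?m - c) x = 0" for x
  proof -
    have "(?m - c) x = (?m - c) (e x)"
      by (metis blinfun.diff_left blinfun_apply_blinfun_compose c(2) module_coeff_support)
    moreover have "norm ((?m - c) (e x)) = 0"
      using module_norm[OF e D b minimal_projectionD(2)[OF e, of x]] 0 by simp
    ultimately show ?thesis by simp
  qed
  then show ?thesis by (intro blinfun_eqI) (simp add: blinfun.diff_left)
qed

lemma module_coeff_add: "module_coeff e b (x + y) = module_coeff e b x + module_coeff e b y"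
proof (rule module_coeff_unique)
  fix d assume d: "d \<in> D"
  show "cinner (x + y - (module_coeff e b x + module_coeff e b y) b) (d b) = 0"
    using module_coeff_orthogonal[OF d, of x] module_coeff_orthogonal[OF d, of y]
    by (simp add: blinfun.add_left add_diff_add cinner_add_left)
qed (auto intro: add_mem module_coeff_mem simp: compose_bilinear module_coeff_support)

text \<open>The complement of \<open>D b\<close> is invariant under \<open>D\<close>, since
  \<open>D\<close> contains adjoints. This linearity over \<open>D\<close> is why the module maps
  built from coefficients commute with \<open>D\<close>.\<close>

lemma module_coeff_compose:
  assumes d: "d \<in> D" shows "module_coeff e b (d x) = d o\<^sub>L module_coeff e b x"
proof (rule module_coeff_unique)
  obtain d' where d': "d' \<in> D" "is_adjoint d d'" by (rule adjoint_mem[OF d])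
  fix c assume c: "c \<in> D"
  have "cinner (d x - (d o\<^sub>L module_coeff e b x) b) (c b) = cinner (x - module_coeff e b x b) ((d' o\<^sub>L c) b)"
    using adjoint_shift[OF d'(2), of "x - module_coeff e b x b" "c b"] by (simp add: blinfun.diff_right)
  also have "\<dots> = 0" by (intro module_coeff_orthogonal compose_mem d' c)
  finally show "cinner (d x - (d o\<^sub>L module_coeff e b x) b) (c b) = 0" .
qed (auto intro: compose_mem module_coeff_mem d simp: compose_assoc module_coeff_support)

lemma module_coeff_scaleC: "module_coeff e b (k *\<^sub>C x) = scaleC_op k (module_coeff e b x)"
proof -
  have "scaleC_op k id_blinfun o\<^sub>L module_coeff e b x = scaleC_op k (module_coeff e b x)"
    by (rule blinfun_eqI) (simp add: scaleC_op.rep_eq)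
  then show ?thesis
    using module_coeff_compose[OF scaleC_mem[OF id_mem, of k], of x] by (simp add: scaleC_op.rep_eq)
qed

end

section \<open>Disjoint minimal projections and a total frame\<close>

lemma op_le_range:
  assumes p: "p o\<^sub>L p = p" "is_adjoint p p" and f: "op_le f p" "blinfun_apply f x = x"
  shows "p x = x"
proof -
  have "inner (p x) x = (norm (p x))\<^sup>2"
    using adjoint_shift[OF p(2), of "p x" x] idem_apply[OF p(1), of x]
    by (simp add: inner_eq_Re_cinner cinner_self)
  moreover have "0 \<le> Re (cinner ((p - f) x) x)"
    using f(1) unfolding op_le_def positive_op_def by blast
  then have "0 \<le> inner (p x) x - (norm x)\<^sup>2"
    by (simp add: blinfun.diff_left f(2) cinner_diff_left inner_eq_Re_cinner cinner_self)
  moreover have "(norm (x - p x))\<^sup>2 = (norm x)\<^sup>2 - 2 * inner (p x) x + (norm (p x))\<^sup>2"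
    by (simp add: power2_norm_eq_inner inner_diff_left inner_diff_right inner_commute)
  ultimately have "(norm (x - p x))\<^sup>2 \<le> 0" by linarith
  then show ?thesis by simp
qed

text \<open>The condition \<open>e D f = 0\<close>, that is, orthogonality of central supports; for
  minimal projections it is inequivalence.\<close>

definition disjoint_projections :: "('a \<Rightarrow>\<^sub>L 'a) \<Rightarrow> ('a \<Rightarrow>\<^sub>L 'a) \<Rightarrow> bool" where
  "disjoint_projections e f \<longleftrightarrow> (\<forall>d\<in>D. \<forall>x. e (blinfun_apply d (f x)) = 0)"

lemma disjoint_projections_sym:
  assumes "disjoint_projections e f" "is_adjoint e e" "is_adjoint f f"
  shows "disjoint_projections f e"
  unfolding disjoint_projections_def
proof (intro ballI allI)
  fix d x assume d: "d \<in> D"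
  obtain d' where d': "d' \<in> D" "is_adjoint d d'" by (rule adjoint_mem[OF d])
  let ?y = "f (d (e x))"
  have "cinner ?y ?y = cinner x (e (d' (f ?y)))"
    using assms(2,3) d'(2) by (simp add: is_adjoint_def)
  also have "\<dots> = 0" using assms(1) d'(1) by (simp add: disjoint_projections_def)
  finally show "?y = 0" by (simp add: cinner_self)
qed

lemma disjoint_orthogonal:
  assumes ef: "disjoint_projections e f" and adj: "is_adjoint e e" and d: "c \<in> D" "d \<in> D"
    and u: "e u = u" "f v = v"
  shows "cinner (blinfun_apply c u) (blinfun_apply d v) = 0"
proof -
  obtain c' where c': "c' \<in> D" "is_adjoint c c'" by (rule adjoint_mem[OF d(1)])
  have "cinner (c u) (d v) = cinner u (e ((c' o\<^sub>L d) (f v)))"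
    using adjoint_shift[OF c'(2), of u "d v"] adjoint_shift[OF adj, of u "c' (d v)"] u by simp
  also have "e ((c' o\<^sub>L d) (f v)) = 0"
    using ef compose_mem[OF c'(1) d(2)] unfolding disjoint_projections_def by blast
  finally show ?thesis by simp
qed

text \<open>This is where atomicity enters. Vectors killed by \<open>e D\<close> for all
  \<open>e\<close> in a maximal family form a subspace whose projection is in \<open>D\<close>; were
  it nonzero, a minimal projection below it would be disjoint from the family and hence, by
  maximality, from itself.\<close>

lemma cyclic_frame_exists:
  assumes at: "atomic D"
  shows "\<exists>E B. (\<forall>e\<in>E. minimal_projection D e) \<and> pairwise disjoint_projections E \<and>
    (\<forall>b\<in>B. norm b = 1 \<and> (\<exists>e\<in>E. blinfun_apply e b = b)) \<and> pairwise (\<lambda>b b'. cinner b b' = 0) B \<and>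
    (\<forall>x. (\<forall>b\<in>B. \<forall>d\<in>D. cinner x (blinfun_apply d b) = 0) \<longrightarrow> x = 0)"
proof -
  obtain E where EX: "E \<subseteq> {e. minimal_projection D e}" "pairwise disjoint_projections E"
    and E_max: "\<forall>f\<in>{e. minimal_projection D e}. (\<forall>e\<in>E. disjoint_projections e f) \<longrightarrow>
      (\<forall>e\<in>E. disjoint_projections f e) \<longrightarrow> f \<in> E"
    using maximal_pairwise[of "{e. minimal_projection D e}" disjoint_projections]
    by (elim exE conjE)
  then have E: "\<And>e. e \<in> E \<Longrightarrow> minimal_projection D e" by blast
  note Ep = minimal_projectionD[OF E]
  have E_total: "x = 0" if x: "\<And>e d. e \<in> E \<Longrightarrow> d \<in> D \<Longrightarrow> e (blinfun_apply d x) = 0" for x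
  proof -
    \<comment> \<open>Elements of the commutant pass through both \<open>e\<close> and
      \<open>d\<close>, so the subspace is invariant and has its projection in
      \<open>D\<close>.\<close>
    define S where "S = (\<Inter>e\<in>E. \<Inter>d\<in>D. {y. blinfun_apply e (blinfun_apply d y) = 0})"
    have "closed S"
      unfolding S_def by (intro closed_INT ballI closed_Collect_eq continuous_intros)
    moreover have "csubspace S"
      using Ep(1) by (auto simp: S_def csubspace_def blinfun.zero_right blinfun.add_right
          scaleC_apply scaleC_zero_right)
    moreover have "R y \<in> S" if R: "R \<in> commutant D" and y: "y \<in> S" for R y
    proof -
      have "e (d (R y)) = R (e (d y))" if "e \<in> E" "d \<in> D" for e d
        using commutantD[OF R Ep(1)[OF that(1)]] commutantD[OF R that(2)] by simp
      then show ?thesis using y by (simp add: S_def blinfun.zero_right)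
    qed
    ultimately obtain p where p: "p \<in> projections D" "\<And>y. p y = y \<longleftrightarrow> y \<in> S"
      using invariant_projection by blast
    have "p = 0"
    proof (rule ccontr)
      assume "p \<noteq> 0"
      then obtain f where f: "minimal_projection D f" "op_le f p"
        using at p(1) unfolding atomic_def by blast
      note fp = minimal_projectionD[OF f(1)]
      have "f y \<in> S" for y
        using op_le_range[of p f "f y"] p f(2) fp(2) by (auto simp: projections_def)
      then have "e (d (f y)) = 0" if "e \<in> E" "d \<in> D" for e d y
        using that unfolding S_def by blast
      then have dis: "disjoint_projections e f" if "e \<in> E" for e
        using that by (simp add: disjoint_projections_def)
      have "disjoint_projections f e" if "e \<in> E" for e
        by (rule disjoint_projections_sym[OF dis[OF that] Ep(3)[OF that] fp(3)])
      with dis f(1) have "f \<in> E" using E_max by simp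
      \<comment> \<open>Disjointness of \<open>f\<close> from itself, taken at the identity of
        \<open>D\<close>, says that \<open>f f = 0\<close>.\<close>
      then have "f (id_blinfun (f y)) = 0" for y
        using dis[OF \<open>f \<in> E\<close>] id_mem unfolding disjoint_projections_def by blast
      then have "f = 0" using fp(2) by (intro blinfun_eqI) (simp add: blinfun.zero_left)
      then show False using fp(4) by simp
    qed
    moreover have "x \<in> S" using x by (simp add: S_def)
    ultimately show "x = 0" using p(2)[of x] by (simp add: blinfun.zero_left)
  qed
  let ?X = "{b :: 'a. norm b = 1 \<and> (\<exists>e\<in>E. blinfun_apply e b = b)}"
  obtain B where B: "B \<subseteq> ?X" "pairwise (\<lambda>b b'. cinner b b' = 0) B"
    and B_max: "\<forall>z\<in>?X. (\<forall>b\<in>B. cinner b z = 0) \<longrightarrow> (\<forall>b\<in>B. cinner z b = 0) \<longrightarrow> z \<in> B"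
    using maximal_pairwise[of ?X "\<lambda>b b'. cinner b b' = 0"] by (elim exE conjE)
  have "x = 0" if x: "\<And>b d. b \<in> B \<Longrightarrow> d \<in> D \<Longrightarrow> cinner x (blinfun_apply d b) = 0" for x
  proof (rule E_total)
    fix e d assume ed: "e \<in> E" "d \<in> D"
    define y where "y = e (d x)"
    obtain d' where d': "d' \<in> D" "is_adjoint d d'" by (rule adjoint_mem[OF ed(2)])
    have yB: "cinner y b = 0" if b: "b \<in> B" for b
    proof -
      have "cinner y b = cinner x ((d' o\<^sub>L e) b)"
        using Ep(3)[OF ed(1)] d'(2) by (simp add: y_def is_adjoint_def)
      also have "\<dots> = 0" by (intro x b compose_mem d' Ep ed)
      finally show ?thesis .
    qed
    show "e (d x) = 0"
    proof (rule ccontr)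
      assume "e (d x) \<noteq> 0"
      then have "y \<noteq> 0" by (simp add: y_def)
      define z where "z = (1 / norm y) *\<^sub>R y"
      have zB: "cinner z b = 0" if "b \<in> B" for b
        using yB[OF that] by (simp add: z_def cinner_scaleR_left)
      have "z \<in> ?X"
        using \<open>y \<noteq> 0\<close> ed(1) Ep(2)[OF ed(1)] by (auto simp: z_def y_def blinfun.scaleR_right)
      moreover have "cinner b z = 0" if "b \<in> B" for b
        using zB[OF that] cinner_commute[of b z] by simp
      ultimately have "z \<in> B" using zB B_max by blast
      then have "cinner z z = 0" by (rule zB)
      then show False using \<open>z \<in> ?X\<close> by (simp add: cinner_self)
    qed
  qed
  then show ?thesis using E EX(2) B by (intro exI[of _ E] exI[of _ B]) auto
qed

end

section \<open>The conditional expectation\<close>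

text \<open>The sequence \<zeta> is indexed by the minimal projection, so all basis vectors of one
  range share the same state. The Kraus map takes values in \<open>D\<close> because of
  this.\<close>

locale framed_homomorphism = normal_bimodule_homomorphism D A \<Phi>
  for D :: "('a :: complex_hilbert \<Rightarrow>\<^sub>L 'a) set" and A \<Phi> +
  fixes B :: "'a set" and \<epsilon> :: "'a \<Rightarrow> ('a \<Rightarrow>\<^sub>L 'a)" and \<zeta> :: "('a \<Rightarrow>\<^sub>L 'a) \<Rightarrow> nat \<Rightarrow> 'a"
  assumes \<epsilon>_minimal: "b \<in> B \<Longrightarrow> minimal_projection D (\<epsilon> b)"
    and \<epsilon>_disjoint: "b \<in> B \<Longrightarrow> b' \<in> B \<Longrightarrow> \<epsilon> b \<noteq> \<epsilon> b' \<Longrightarrow> disjoint_projections (\<epsilon> b) (\<epsilon> b')"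
    and \<epsilon>_fixes: "b \<in> B \<Longrightarrow> \<epsilon> b b = b"
    and B_norm: "b \<in> B \<Longrightarrow> norm b = 1"
    and B_orthogonal: "b \<in> B \<Longrightarrow> b' \<in> B \<Longrightarrow> b \<noteq> b' \<Longrightarrow> cinner b b' = 0"
    and B_total: "(\<And>b d. b \<in> B \<Longrightarrow> d \<in> D \<Longrightarrow> cinner x (blinfun_apply d b) = 0) \<Longrightarrow> x = 0"
    and \<zeta>_fixed: "b \<in> B \<Longrightarrow> \<epsilon> b (\<zeta> (\<epsilon> b) n) = \<zeta> (\<epsilon> b) n"
    and \<zeta>_norm: "b \<in> B \<Longrightarrow> (\<lambda>n. (norm (\<zeta> (\<epsilon> b) n))\<^sup>2) sums 1"
    and \<zeta>_state: "b \<in> B \<Longrightarrow> a \<in> A \<Longrightarrow> \<epsilon> b u = u \<Longrightarrow>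
      (\<lambda>n. cinner (blinfun_apply a (\<zeta> (\<epsilon> b) n)) (\<zeta> (\<epsilon> b) n) * (norm u)\<^sup>2) sums cinner (\<Phi> a u) u"
begin

definition coeff :: "'a \<Rightarrow> 'a \<Rightarrow> ('a \<Rightarrow>\<^sub>L 'a)" where
  "coeff b = module_coeff (\<epsilon> b) b"

text \<open>The orthogonal projection onto the cyclic subspace \<open>D b\<close>.\<close>

definition cyclic_part :: "'a \<Rightarrow> 'a \<Rightarrow> 'a" where
  "cyclic_part b x = coeff b x b"

lemmas frame = \<epsilon>_minimal \<epsilon>_fixes B_norm
lemmas \<epsilon>_proj = minimal_projectionD[OF \<epsilon>_minimal]

lemma coeff_mem: "b \<in> B \<Longrightarrow> coeff b x \<in> D"
  and coeff_orthogonal: "b \<in> B \<Longrightarrow> d \<in> D \<Longrightarrow> cinner (x - coeff b x b) (blinfun_apply d b) = 0"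
  and coeff_add: "b \<in> B \<Longrightarrow> coeff b (x + y) = coeff b x + coeff b y"
  and coeff_scaleC: "b \<in> B \<Longrightarrow> coeff b (k *\<^sub>C x) = scaleC_op k (coeff b x)"
  and coeff_compose: "b \<in> B \<Longrightarrow> d \<in> D \<Longrightarrow> coeff b (d x) = d o\<^sub>L coeff b x"
  by (simp_all add: coeff_def module_coeff_mem[OF frame] 
      module_coeff_orthogonal[OF frame] module_coeff_add[OF frame] module_coeff_scaleC[OF frame]
      module_coeff_compose[OF frame])

lemma cyclic_part_proj: "b \<in> B \<Longrightarrow> cinner (cyclic_part b x) (cyclic_part b y) = cinner (cyclic_part b x) y"
  using coeff_orthogonal[OF _ coeff_mem, of b b y x] cinner_commute[of "y - cyclic_part b y" "cyclic_part b x"]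
  by (simp add: cyclic_part_def cinner_diff_right)

text \<open>Within one range, orthogonality of \<open>b\<close> and \<open>b'\<close> spreads to
  \<open>D b\<close> and \<open>D b'\<close> because the form on the range is a multiple of the
  inner product; between different ranges it is disjointness.\<close>

lemma cyclic_part_orthogonal:
  assumes b: "b \<in> B" "b' \<in> B" "b \<noteq> b'"
  shows "cinner (cyclic_part b x) (cyclic_part b' y) = 0"
proof (cases "\<epsilon> b = \<epsilon> b'")
  case True
  obtain k where "\<And>u v. \<epsilon> b u = u \<Longrightarrow> \<epsilon> b v = v \<Longrightarrow> cinner (coeff b x u) (coeff b' y v) = k * cinner u v"
    using module_form[OF \<epsilon>_minimal[OF b(1)] coeff_mem[OF b(1)] coeff_mem[OF b(2)]] by blast
  from this[of b b'] show ?thesis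
    using True \<epsilon>_fixes[OF b(1)] \<epsilon>_fixes[OF b(2)] B_orthogonal[OF b] by (simp add: cyclic_part_def)
next
  case False
  then show ?thesis
    unfolding cyclic_part_def using b
    by (intro disjoint_orthogonal[OF \<epsilon>_disjoint[OF b(1,2)]] coeff_mem \<epsilon>_proj \<epsilon>_fixes)
qed

lemma cyclic_part_total:
  assumes "\<And>b. b \<in> B \<Longrightarrow> cyclic_part b x = 0" shows "x = 0"
proof (rule B_total)
  fix b d assume "b \<in> B" "d \<in> D"
  then show "cinner x (d b) = 0"
    using coeff_orthogonal[of b d x] assms[of b] by (simp add: cyclic_part_def)
qed

lemma cyclic_part_add: "b \<in> B \<Longrightarrow> cyclic_part b (x + y) = cyclic_part b x + cyclic_part b y"
  and cyclic_part_scaleC: "b \<in> B \<Longrightarrow> cyclic_part b (k *\<^sub>C x) = k *\<^sub>C cyclic_part b x"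
  and cyclic_part_compose: "b \<in> B \<Longrightarrow> d \<in> D \<Longrightarrow> cyclic_part b (d x) = d (cyclic_part b x)"
  by (simp_all add: cyclic_part_def coeff_add coeff_scaleC coeff_compose blinfun.add_left scaleC_op.rep_eq)

lemma cyclic_part_parseval: "((\<lambda>b. cinner (cyclic_part b x) (cyclic_part b y)) has_sum cinner x y) B"
  by (rule parseval) (fact cyclic_part_add cyclic_part_scaleC cyclic_part_proj cyclic_part_orthogonal cyclic_part_total)+

lemma cyclic_part_norm_has_sum: "((\<lambda>b. (norm (cyclic_part b x))\<^sup>2) has_sum (norm x)\<^sup>2) B"
  by (rule parseval_real) (fact cyclic_part_add cyclic_part_scaleC cyclic_part_proj cyclic_part_orthogonal cyclic_part_total)+

text \<open>The module map \<open>G\<close> of the overview: the coefficient that recovers the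
  cyclic part at \<open>b\<close> is evaluated at \<zeta> instead.\<close>

definition kraus :: "'a \<times> nat \<Rightarrow> 'a \<Rightarrow> 'a" where
  "kraus i x = coeff (fst i) x (\<zeta> (\<epsilon> (fst i)) (snd i))"

lemma kraus_compose: "fst i \<in> B \<Longrightarrow> d \<in> D \<Longrightarrow> kraus i (d x) = d (kraus i x)"
  by (simp add: kraus_def coeff_compose)

lemma norm_kraus: "b \<in> B \<Longrightarrow> norm (kraus (b, n) x) = norm (cyclic_part b x) * norm (\<zeta> (\<epsilon> b) n)"
  unfolding kraus_def cyclic_part_def fst_conv snd_conv
  by (rule module_norm[OF \<epsilon>_minimal coeff_mem \<epsilon>_fixes B_norm \<zeta>_fixed])

text \<open>Summed over \<open>n\<close> first, the squared norms of the \<zeta> add up to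
  \<open>1\<close> and leave the squared norm of the cyclic part; Parseval does the rest.\<close>

sublocale kraus_family kraus "B \<times> (UNIV :: nat set)"
proof
  fix i :: "'a \<times> nat" and x y c assume i: "i \<in> B \<times> UNIV"
  then show "kraus i (x + y) = kraus i x + kraus i y" "kraus i (c *\<^sub>C x) = c *\<^sub>C kraus i x"
    by (auto simp: kraus_def coeff_add coeff_scaleC blinfun.add_left scaleC_op.rep_eq)
next
  fix x
  have inner: "((\<lambda>n. (norm (kraus (b, n) x))\<^sup>2) has_sum (norm (cyclic_part b x))\<^sup>2) UNIV" if b: "b \<in> B" for b
  proof (rule sums_nonneg_imp_has_sum)
    show "(\<lambda>n. (norm (kraus (b, n) x))\<^sup>2) sums (norm (cyclic_part b x))\<^sup>2"
      using sums_mult[OF \<zeta>_norm[OF b], of "(norm (cyclic_part b x))\<^sup>2"]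
      by (simp add: norm_kraus[OF b] power_mult_distrib)
  qed simp
  have "(\<lambda>i. (norm (kraus i x))\<^sup>2) summable_on B \<times> UNIV"
    by (rule summable_on_SigmaI[OF inner]) (use has_sum_imp_summable[OF cyclic_part_norm_has_sum] in auto)
  then show "((\<lambda>i. (norm (kraus i x))\<^sup>2) has_sum (norm x)\<^sup>2) (B \<times> UNIV)"
    by (intro has_sum_SigmaI[OF inner cyclic_part_norm_has_sum])
qed

text \<open>States are given as ordered series, the Kraus sum is unordered. Absolute convergence of
  the Kraus terms reconciles the two.\<close>

lemma inner_term_has_sum:
  assumes T: "T \<in> BH" and b: "b \<in> B"
    and s: "(\<lambda>n. cinner (blinfun_apply T (kraus (b, n) x)) (kraus (b, n) y)) sums s"
  shows "((\<lambda>n. cinner (blinfun_apply T (kraus (b, n) x)) (kraus (b, n) y)) has_sum s) UNIV"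
proof -
  let ?f = "\<lambda>i. cinner (blinfun_apply T (kraus i x)) (kraus i y)"
  have "(\<lambda>(b, n). ?f (b, n)) summable_on B \<times> UNIV"
    using term_summable[of T x y] by (simp add: case_prod_unfold)
  then have "(\<lambda>n. ?f (b, n)) summable_on UNIV" using b by (rule summable_on_SigmaD1)
  then have *: "((\<lambda>n. ?f (b, n)) has_sum (\<Sum>\<^sub>\<infinity>n. ?f (b, n))) UNIV" by simp
  then have "(\<Sum>\<^sub>\<infinity>n. ?f (b, n)) = s" using has_sum_imp_sums s sums_unique2 by blast
  then show ?thesis using * by simp
qed

lemma kraus_map_collapse:
  assumes T: "T \<in> BH"
    and s: "\<And>b. b \<in> B \<Longrightarrow> (\<lambda>n. cinner (blinfun_apply T (kraus (b, n) x)) (kraus (b, n) y)) sums s b"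
  shows "(s has_sum cinner (kraus_map T x) y) B"
  using kraus_map_has_sum[OF T] inner_term_has_sum[OF T _ s] by (rule has_sum_SigmaD)

text \<open>The terms belonging to \<open>b\<close> form the state at \<open>?c\<close>, the product
  of the adjoint of \<open>coeff b y\<close>, \<open>a\<close> and \<open>coeff b x\<close>, which
  is in \<open>A\<close> since \<open>D\<close> is. Bimodularity extracts both coefficients from
  \<open>\<Phi> ?c\<close>, leaving a Parseval term for \<open>\<Phi> a x\<close> and
  \<open>y\<close>.\<close>

lemma kraus_map_extends:
  assumes a: "a \<in> A"
  shows "kraus_map a = \<Phi> a"
proof (intro blinfun_eqI cinner_eqI)
  fix x y
  have "((\<lambda>b. cinner (cyclic_part b (\<Phi> a x)) (cyclic_part b y)) has_sum cinner (kraus_map a x) y) B"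
  proof (rule kraus_map_collapse[OF A_BH[OF a]])
    fix b assume b: "b \<in> B"
    obtain d where d: "d \<in> D" "is_adjoint (coeff b y) d" by (rule adjoint_mem[OF coeff_mem[OF b]])
    let ?c = "d o\<^sub>L a o\<^sub>L coeff b x"
    have "?c \<in> A" by (intro A_compose D_A d coeff_mem b a)
    from \<zeta>_state[OF b this \<epsilon>_fixes[OF b]]
    have "(\<lambda>n. cinner (?c (\<zeta> (\<epsilon> b) n)) (\<zeta> (\<epsilon> b) n)) sums cinner (\<Phi> ?c b) b"
      by (simp only: B_norm[OF b] power_one of_real_1 mult_1_right)
    moreover have "cinner (?c u) v = cinner (a (coeff b x u)) (coeff b y v)" for u v
      using adjoint_shift[OF is_adjoint_sym[OF d(2)], of "a (coeff b x u)" v] by simp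
    moreover have "cinner (\<Phi> ?c b) b = cinner (\<Phi> a (coeff b x b)) (coeff b y b)"
      using adjoint_shift[OF is_adjoint_sym[OF d(2)], of "\<Phi> a (coeff b x b)" b]
      by (simp add: \<Phi>_bimodule[OF a d(1) coeff_mem[OF b]])
    ultimately show "(\<lambda>n. cinner (a (kraus (b, n) x)) (kraus (b, n) y)) sums cinner (cyclic_part b (\<Phi> a x)) (cyclic_part b y)"
      using cyclic_part_compose[OF b \<Phi>_D[OF a], of x] by (simp add: kraus_def cyclic_part_def)
  qed
  then show "cinner (kraus_map a x) y = cinner (\<Phi> a x) y"
    using cyclic_part_parseval has_sum_unique by blast
qed

lemma kraus_map_bimodule:
  assumes T: "T \<in> BH" and d: "c \<in> D" "d \<in> D"
  shows "kraus_map (c o\<^sub>L T o\<^sub>L d) = c o\<^sub>L kraus_map T o\<^sub>L d"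
proof (intro blinfun_eqI cinner_eqI)
  fix x y
  obtain c' where c': "c' \<in> D" "is_adjoint c c'" by (rule adjoint_mem[OF d(1)])
  have "cinner (kraus_map (c o\<^sub>L T o\<^sub>L d) x) y
      = (\<Sum>\<^sub>\<infinity>i\<in>B \<times> UNIV. cinner ((c o\<^sub>L T o\<^sub>L d) (kraus i x)) (kraus i y))"
    by (intro kraus_map_infsum BH_closed_ops T in_BH d)
  also have "\<dots> = (\<Sum>\<^sub>\<infinity>i\<in>B \<times> UNIV. cinner (T (kraus i (d x))) (kraus i (c' y)))"
    using adjoint_shift[OF c'(2)] by (intro infsum_cong) (auto simp: kraus_compose d(2) c'(1))
  also have "\<dots> = cinner (kraus_map T (d x)) (c' y)" by (simp add: kraus_map_infsum[OF T])
  finally show "cinner (kraus_map (c o\<^sub>L T o\<^sub>L d) x) y = cinner ((c o\<^sub>L kraus_map T o\<^sub>L d) x) y"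
    using adjoint_shift[OF c'(2)] by simp
qed

section \<open>Values of the Kraus map lie in \<open>D\<close>\<close>

text \<open>On the ranges of the minimal projections the operator coefficients reduce to Fourier
  coefficients with respect to the basis vectors of the same range.\<close>

lemma coeff_minimal_range:
  assumes b: "b \<in> B" "b' \<in> B" and u: "\<epsilon> b' u = u"
  shows "coeff b u = (if \<epsilon> b = \<epsilon> b' then scaleC_op (cinner u b) (\<epsilon> b) else 0)"
  unfolding coeff_def
proof (rule module_coeff_unique[OF frame, OF b(1) b(1) b(1)])
  let ?c = "if \<epsilon> b = \<epsilon> b' then scaleC_op (cinner u b) (\<epsilon> b) else 0"
  show "?c \<in> D" by (simp add: scaleC_mem zero_mem \<epsilon>_proj b)
  show "?c o\<^sub>L \<epsilon> b = ?c"
    using \<epsilon>_proj(2)[OF b(1)] by (auto intro!: blinfun_eqI simp: scaleC_op.rep_eq blinfun.zero_left)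
  fix d assume d: "d \<in> D"
  show "cinner (u - ?c b) (d b) = 0"
  proof (cases "\<epsilon> b = \<epsilon> b'")
    case True
    obtain k where k: "\<And>u v. \<epsilon> b u = u \<Longrightarrow> \<epsilon> b v = v \<Longrightarrow> cinner (id_blinfun u) (blinfun_apply d v) = k * cinner u v"
      using module_form[OF \<epsilon>_minimal[OF b(1)] id_mem d] by blast
    then have "cinner u (d b) = k * cinner u b" "cinner b (d b) = k"
      using k[of u b] k[of b b] True u \<epsilon>_fixes[OF b(1)] B_norm[OF b(1)] by (simp_all add: cinner_self)
    then show ?thesis
      using True \<epsilon>_fixes[OF b(1)] by (simp add: scaleC_op.rep_eq cinner_diff_left cinner_scaleC_left)
  next
    case False
    have "cinner (id_blinfun u) (d b) = 0"
      using False by (intro disjoint_orthogonal[OF \<epsilon>_disjoint[OF b(2,1)]] id_mem d \<epsilon>_proj b \<epsilon>_fixes u) auto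
    then show ?thesis using False by (simp add: blinfun.zero_left)
  qed
qed

text \<open>Every basis vector of the common range contributes the same factor, the state at
  \<open>T\<close>, so the Fourier series sums to a multiple of \<open>cinner u w\<close>. If the
  projections differ, no \<open>a\<close> has nonzero coefficients for both \<open>u\<close> and
  \<open>w\<close>.\<close>

lemma kraus_map_minimal_ranges:
  assumes T: "T \<in> BH" and b: "b \<in> B" "b' \<in> B"
  shows "\<exists>F. \<forall>u w. \<epsilon> b u = u \<longrightarrow> \<epsilon> b' w = w \<longrightarrow> cinner (kraus_map T u) w = F * cinner u w"
proof (cases "\<epsilon> b = \<epsilon> b'")
  case True
  let ?t = "\<lambda>n. cinner (T (\<zeta> (\<epsilon> b) n)) (\<zeta> (\<epsilon> b) n)"
  have "summable ?t"
  proof (rule summable_norm_cancel, rule summable_comparison_test')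
    let ?g = "\<lambda>n. norm T * ((norm (\<zeta> (\<epsilon> b) n))\<^sup>2 + (norm (\<zeta> (\<epsilon> b) n))\<^sup>2)"
    show "summable ?g" using \<zeta>_norm[OF b(1)] by (intro summable_mult summable_add) (auto simp: sums_iff)
    show "norm (cmod (?t n)) \<le> ?g n" for n
      unfolding real_norm_def abs_norm_cancel by (rule norm_term_le)
  qed
  then have F: "?t sums suminf ?t" by (rule summable_sums)
  have "cinner (kraus_map T u) w = suminf ?t * cinner u w" if u: "\<epsilon> b u = u" and w: "\<epsilon> b' w = w" for u w
  proof -
    have "((\<lambda>a. suminf ?t * cinner (cyclic_part a u) (cyclic_part a w)) has_sum cinner (kraus_map T u) w) B"
    proof (rule kraus_map_collapse[OF T])
      fix a assume a: "a \<in> B"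
      note cu = coeff_minimal_range[OF a b(1) u] and cw = coeff_minimal_range[OF a b(2) w]
      show "(\<lambda>n. cinner (T (kraus (a, n) u)) (kraus (a, n) w)) sums (suminf ?t * cinner (cyclic_part a u) (cyclic_part a w))"
      proof (cases "\<epsilon> a = \<epsilon> b")
        case eq: True
        have "cinner (cyclic_part a u) (cyclic_part a w) = cinner u a * cnj (cinner w a)"
          using eq True \<epsilon>_fixes[OF a] B_norm[OF a]
          by (simp add: cyclic_part_def cu cw scaleC_op.rep_eq cinner_scaleC_left cinner_scaleC_right cinner_self)
        moreover have "cinner (T (kraus (a, n) u)) (kraus (a, n) w) = ?t n * (cinner u a * cnj (cinner w a))" for n
          using eq True \<zeta>_fixed[OF b(1), of n]
          by (simp add: kraus_def cu cw scaleC_op.rep_eq BH_scaleC[OF T] cinner_scaleC_left cinner_scaleC_right)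
        ultimately show ?thesis using sums_mult2[OF F, of "cinner u a * cnj (cinner w a)"] by simp
      next
        case False
        then show ?thesis using True
          by (simp add: kraus_def cyclic_part_def cu cw blinfun.zero_left blinfun.zero_right)
      qed
    qed
    moreover have "((\<lambda>a. suminf ?t * cinner (cyclic_part a u) (cyclic_part a w)) has_sum (suminf ?t * cinner u w)) B"
      by (intro has_sum_cmult_right cyclic_part_parseval)
    ultimately show ?thesis by (rule has_sum_unique)
  qed
  then show ?thesis by blast
next
  case False
  have "cinner (kraus_map T u) w = 0 * cinner u w" if u: "\<epsilon> b u = u" and w: "\<epsilon> b' w = w" for u w
  proof -
    have "((\<lambda>a. 0) has_sum cinner (kraus_map T u) w) B"
    proof (rule kraus_map_collapse[OF T])
      fix a assume a: "a \<in> B"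
      show "(\<lambda>n. cinner (T (kraus (a, n) u)) (kraus (a, n) w)) sums 0"
        using coeff_minimal_range[OF a b(1) u] coeff_minimal_range[OF a b(2) w] False
        by (auto simp: kraus_def blinfun.zero_left blinfun.zero_right)
    qed
    then show ?thesis using has_sum_unique[OF _ has_sum_0_simp] by simp
  qed
  then show ?thesis by blast
qed

lemma operator_zeroI:
  assumes Q: "Q \<in> BH"
    and z: "\<And>b b' c d. b \<in> B \<Longrightarrow> b' \<in> B \<Longrightarrow> c \<in> D \<Longrightarrow> d \<in> D \<Longrightarrow>
      cinner (Q (blinfun_apply c b)) (blinfun_apply d b') = 0"
  shows "Q x = 0"
proof (rule B_total)
  obtain Q' where Q': "is_adjoint Q Q'" using adjoint_exists[OF Q] by blast
  fix b d assume b: "b \<in> B" "d \<in> D"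
  have "Q' (d b) = 0"
  proof (rule B_total)
    fix b' c assume "b' \<in> B" "c \<in> D"
    then have "cinner (c b') (Q' (d b)) = 0"
      using z[of b' b c d] b adjoint_shift[OF Q', of "c b'" "d b"] by simp
    then show "cinner (Q' (d b)) (c b') = 0" by (metis cinner_commute complex_cnj_zero)
  qed
  then show "cinner (Q x) (d b) = 0" using adjoint_shift[OF Q', of x "d b"] by simp
qed

text \<open>By the double commutant property it suffices that commutators with \<open>R\<close>
  vanish, tested on vectors \<open>c b\<close> and \<open>d b'\<close>. There the form is a multiple
  of the inner product on the ranges of minimal projections, where moving \<open>R\<close> across to
  its adjoint changes nothing.\<close>

lemma kraus_map_mem:
  assumes T: "T \<in> BH"
  shows "kraus_map T \<in> D"
proof (rule bicommutantI[OF kraus_map_BH[OF T]])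
  fix R x assume R: "R \<in> commutant D"
  obtain R' where R': "R' \<in> commutant D" "is_adjoint R R'" by (rule adjoint_commutant[OF R])
  define Q where "Q = (kraus_map T o\<^sub>L R) - (R o\<^sub>L kraus_map T)"
  have "Q \<in> BH" unfolding Q_def by (intro BH_closed_ops kraus_map_BH T commutant_BH[OF R])
  moreover have "cinner (Q (c b)) (d b') = 0" if b: "b \<in> B" "b' \<in> B" and d: "c \<in> D" "d \<in> D" for b b' c d
  proof -
    obtain d' where d': "d' \<in> D" "is_adjoint d d'" by (rule adjoint_mem[OF d(2)])
    \<comment> \<open>Bimodularity absorbs \<open>c\<close> and the adjoint of \<open>d\<close> into
      the operator, leaving vectors in the ranges of the minimal projections.\<close>
    let ?T = "d' o\<^sub>L T o\<^sub>L c"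
    have T': "?T \<in> BH" by (intro BH_closed_ops in_BH d' d T)
    obtain F where F: "\<And>u w. \<epsilon> b u = u \<Longrightarrow> \<epsilon> b' w = w \<Longrightarrow> cinner (kraus_map ?T u) w = F * cinner u w"
      using kraus_map_minimal_ranges[OF T' b] by blast
    have form: "cinner (kraus_map T (c u)) (d w) = F * cinner u w" if "\<epsilon> b u = u" "\<epsilon> b' w = w" for u w
      using F[OF that] adjoint_shift[OF is_adjoint_sym[OF d'(2)], of "kraus_map T (c u)" w]
      by (simp add: kraus_map_bimodule[OF T d'(1) d(1)])
    have "cinner (Q (c b)) (d b') = cinner (kraus_map T (c (R b))) (d b') - cinner (kraus_map T (c b)) (d (R' b'))"
      using adjoint_shift[OF R'(2), of "kraus_map T (c b)" "d b'"]
      by (simp add: Q_def blinfun.diff_left cinner_diff_left commutantD[OF R d(1)] commutantD[OF R'(1) d(2)])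
    \<comment> \<open>Since \<open>R\<close> commutes with \<open>\<epsilon> b\<close>, the vector
      \<open>R b\<close> is still in its range, so the same scalar \<open>F\<close> applies.\<close>
    also have "cinner (kraus_map T (c (R b))) (d b') = F * cinner (R b) b'"
      using commutantD[OF R \<epsilon>_proj(1)[OF b(1)], of b] b by (intro form) (simp_all add: \<epsilon>_fixes)
    also have "cinner (kraus_map T (c b)) (d (R' b')) = F * cinner b (R' b')"
      using commutantD[OF R'(1) \<epsilon>_proj(1)[OF b(2)], of b'] b by (intro form) (simp_all add: \<epsilon>_fixes)
    finally show ?thesis using adjoint_shift[OF R'(2), of b b'] by simp
  qed
  ultimately have "Q x = 0" by (rule operator_zeroI)
  then show "kraus_map T (R x) = R (kraus_map T x)" by (simp add: Q_def blinfun.diff_left)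
qed

lemma kraus_map_conditional_expectation:
  assumes M: "von_neumann_algebra M" "D \<subseteq> M"
  shows "conditional_expectation M D kraus_map"
proof -
  interpret M: vn_algebra M using M(1) by unfold_locales
  have D: "kraus_map d = d" if "d \<in> D" for d
    using kraus_map_extends[OF D_A[OF that]] \<Phi>_id_on_D[OF that] by simp
  show ?thesis
    unfolding conditional_expectation_def clinear_map_on_def bimodule_map_on_def
    using kraus_map_mem[OF M.in_BH] kraus_map_add[OF M.in_BH M.in_BH] kraus_map_scaleC[OF M.in_BH]
      kraus_map_positive[OF M.in_BH] kraus_map_bimodule[OF M.in_BH] D id_mem
    by (intro conjI) auto
qed

lemma kraus_map_normal:
  assumes "von_neumann_algebra M"
  shows "continuous_map (weak_star M) (weak_star D) kraus_map"
proof -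
  interpret M: vn_algebra M using assms by unfold_locales
  show ?thesis
  proof (rule weak_star_continuousI)
    show "kraus_map ` M \<subseteq> D" using kraus_map_mem[OF M.in_BH] by blast
    fix x y :: "nat \<Rightarrow> 'a"
    assume "summable (\<lambda>n. (norm (x n))\<^sup>2)" "summable (\<lambda>n. (norm (y n))\<^sup>2)"
    from kraus_map_transfer[OF this] obtain x' y' where
      "summable (\<lambda>n::nat. (norm (x' n))\<^sup>2)" "summable (\<lambda>n. (norm (y' n))\<^sup>2)"
      "\<forall>T\<in>BH. (\<Sum>n. cinner (kraus_map T (x n)) (y n)) = (\<Sum>n. cinner (blinfun_apply T (x' n)) (y' n))"
      by (elim exE conjE)
    then show "\<exists>x' y'. summable (\<lambda>n::nat. (norm (x' n))\<^sup>2) \<and> summable (\<lambda>n. (norm (y' n))\<^sup>2) \<and>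
        (\<forall>T\<in>M. (\<Sum>n. cinner (kraus_map T (x n)) (y n)) = (\<Sum>n. cinner (blinfun_apply T (x' n)) (y' n)))"
      using M.in_BH by (intro exI[of _ x'] exI[of _ y']) simp
  qed
qed

end

lemma (in normal_bimodule_homomorphism) framed_exists:
  assumes "atomic D"
  shows "\<exists>B \<epsilon> \<zeta>. framed_homomorphism D A \<Phi> B \<epsilon> \<zeta>"
proof -
  from cyclic_frame_exists[OF assms] obtain E B where
    E: "\<forall>e\<in>E. minimal_projection D e" "pairwise disjoint_projections E"
    and B: "\<forall>b\<in>B. norm b = 1 \<and> (\<exists>e\<in>E. blinfun_apply e b = b)" "pairwise (\<lambda>b b'. cinner b b' = 0) B"
      "\<forall>x. (\<forall>b\<in>B. \<forall>d\<in>D. cinner x (blinfun_apply d b) = 0) \<longrightarrow> x = 0"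
    by (elim exE conjE)
  have "\<forall>b\<in>B. \<exists>e. e \<in> E \<and> blinfun_apply e b = b" using B(1) by blast
  then obtain \<epsilon> where \<epsilon>: "\<forall>b\<in>B. \<epsilon> b \<in> E \<and> blinfun_apply (\<epsilon> b) b = b" by (elim bchoice[THEN exE])
  have "\<forall>e\<in>E. \<exists>\<zeta> :: nat \<Rightarrow> 'a. (\<forall>n. e (\<zeta> n) = \<zeta> n) \<and> (\<lambda>n. (norm (\<zeta> n))\<^sup>2) sums 1 \<and>
    (\<forall>a\<in>A. \<forall>u. e u = u \<longrightarrow>
      (\<lambda>n. cinner (blinfun_apply a (\<zeta> n)) (\<zeta> n) * (norm u)\<^sup>2) sums cinner (\<Phi> a u) u)"
    using minimal_vector_state E(1) by blast
  then obtain \<zeta> where \<zeta>: "\<forall>e\<in>E. (\<forall>n. blinfun_apply e (\<zeta> e n) = \<zeta> e n) \<and> (\<lambda>n. (norm (\<zeta> e n))\<^sup>2) sums 1 \<and>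
    (\<forall>a\<in>A. \<forall>u. e u = u \<longrightarrow>
      (\<lambda>n. cinner (blinfun_apply a (\<zeta> e n)) (\<zeta> e n) * (norm u)\<^sup>2) sums cinner (\<Phi> a u) u)"
    by (elim bchoice[THEN exE])
  have "framed_homomorphism D A \<Phi> B \<epsilon> \<zeta>"
  proof (unfold_locales, goal_cases)
    case (1 b) then show ?case using \<epsilon> E by blast
  next
    case (2 b b') then show ?case using \<epsilon> E(2) by (simp add: pairwise_def)
  next
    case (3 b) then show ?case using \<epsilon> by blast
  next
    case (4 b) then show ?case using B(1) by blast
  next
    case (5 b b') then show ?case using B(2) by (simp add: pairwise_def)
  next
    case (6 x) then show ?case using B(3) by simp
  next
    case (7 b n) then show ?case using \<epsilon> \<zeta> by simp
  next
    case (8 b) then show ?case using \<epsilon> \<zeta> by simp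
  next
    case (9 b a u) then show ?case using \<epsilon> \<zeta> by simp
  qed
  then show ?thesis by blast
qed

theorem theorem2p4:
  fixes M A D :: "('a :: complex_hilbert \<Rightarrow>\<^sub>L 'a) set"
    and \<Phi> :: "('a \<Rightarrow>\<^sub>L 'a) \<Rightarrow> ('a \<Rightarrow>\<^sub>L 'a)"
  assumes "von_neumann_algebra M"
    and "subalgebra_BH A" and "closedin (weak_star M) A"
    and "von_neumann_algebra D" and "atomic D"
    and "D \<subseteq> A" and "A \<subseteq> M"
    and "\<Phi> ` A \<subseteq> D" and "homomorphism_on A \<Phi>" and "\<Phi> id_blinfun = id_blinfun"
    and "continuous_map (weak_star A) (weak_star D) \<Phi>"
    and "bimodule_map_on D A \<Phi>"
  shows "\<exists>\<Psi>. conditional_expectation M D \<Psi> \<and>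
           continuous_map (weak_star M) (weak_star D) \<Psi> \<and>
           (\<forall>a\<in>A. \<Psi> a = \<Phi> a)"
proof -
  interpret normal_bimodule_homomorphism D A \<Phi>
    using assms by unfold_locales
  obtain B \<epsilon> \<zeta> where "framed_homomorphism D A \<Phi> B \<epsilon> \<zeta>"
    using framed_exists[OF \<open>atomic D\<close>] by blast
  then interpret framed_homomorphism D A \<Phi> B \<epsilon> \<zeta> .
  have "D \<subseteq> M" using \<open>D \<subseteq> A\<close> \<open>A \<subseteq> M\<close> by blast
  with \<open>von_neumann_algebra M\<close> show ?thesis
    using kraus_map_conditional_expectation kraus_map_normal kraus_map_extends by blast
qed

end
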